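(* For all $m\in\mathbb{N}_0$ and $c>0$, $$\left\|g_m^c\right\|_{L^{\infty}([-1,1])}\le \frac{\pi}{e^{2c}}\left(1+\frac{4c^2}{3}\right)^{1/2}\left(\frac{\sinh(4c)}{4c}\right)^{1/4}\cosh(2c)^{1/2}\left(\frac{2R(c)}{m+1/2}+\left(1+\sqrt{\frac23}\,\frac{R(c)}{m+1/2}\right)\sqrt{m+\frac12}\right).$$
   Context: $\mathbb{N}_0$ is the set of nonnegative integers and $\mathrm{sech}=1/\cosh$. For $c>0$, $\mathcal{Q}_c:L^2(-1,1)\to L^2(-1,1)$ is the operator $$\mathcal{Q}_c[h](x)=\int_{-1}^{1}\pi c\ \mathrm{sech}\left(\frac{\pi c}{2}(x-y)\right)h(y)\,dy,$$ which is trace class, symmetric and positive. Its positive eigenvalues in decreasing order, repeated according to multiplicity, are $(\rho_m^c)_{m\in\mathbb{N}_0}$, and $(g_m^c)_{m\in\mathbb{N}_0}$ are the corresponding eigenfunctions, taken real valued and orthonormal in $L^2(-1,1)$ (and continuous on $[-1,1]$). $\|f\|_{L^\infty([-1,1])}$ is the sup-norm of $f$ on $[-1,1]$. Further, $$U(c)=\int_{-1}^1\left(\cosh(4c)-\cosh(4c\xi)\right)^{-1/2}d\xi,$$ $$R(c)=\frac{2}{\pi^2}+\left(\frac{U(c)c}{\pi}\right)^2\left(\left(\cosh(4c)\left(1+\frac{c}{3}\coth(2c)\right)-1\right)+2c\sinh(4c)\right).$$ *)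

theory Defs
  imports "HOL-Analysis.Analysis"
begin

abbreviation I11 :: "real measure"
  where "I11 \<equiv> lebesgue_on {-1<..<1}"

definition sech :: "real \<Rightarrow> real"
  where "sech x = 1 / cosh x"

definition coth :: "real \<Rightarrow> real"
  where "coth x = cosh x / sinh x"

text \<open>
  The complex space \<open>L\<^sup>2(-1,1)\<close> is represented by its functions rather than by equivalence
  classes; identities between elements of \<open>L\<^sup>2(-1,1)\<close> are therefore stated almost everywhere.
\<close>

definition L2 :: "(real \<Rightarrow> complex) set"
  where "L2 = {h. h \<in> borel_measurable I11 \<and> integrable I11 (\<lambda>x. (cmod (h x))\<^sup>2)}"

definition Qop :: "real \<Rightarrow> (real \<Rightarrow> complex) \<Rightarrow> real \<Rightarrow> complex"
  where "Qop c h x = (LINT y|I11. complex_of_real (pi * c * sech (pi * c / 2 * (x - y))) * h y)"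

definition eigenspace :: "real \<Rightarrow> real \<Rightarrow> (real \<Rightarrow> complex) set"
  where "eigenspace c l = {h \<in> L2. AE x in I11. Qop c h x = complex_of_real l * h x}"

text \<open>
  The dimension of the eigenspace modulo null functions is \<open>n\<close>: it has a basis with \<open>n\<close>
  elements. The case \<open>n = 0\<close> says that \<open>l\<close> is not an eigenvalue.
\<close>

definition has_multiplicity :: "real \<Rightarrow> real \<Rightarrow> nat \<Rightarrow> bool"
  where "has_multiplicity c l n \<longleftrightarrow>
    (\<exists>f :: nat \<Rightarrow> real \<Rightarrow> complex.
      (\<forall>i<n. f i \<in> eigenspace c l) \<and>
      (\<forall>a :: nat \<Rightarrow> complex. (AE x in I11. (\<Sum>i<n. a i * f i x) = 0) \<longrightarrow> (\<forall>i<n. a i = 0)) \<and>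
      (\<forall>h \<in> eigenspace c l. \<exists>a :: nat \<Rightarrow> complex. AE x in I11. h x = (\<Sum>i<n. a i * f i x)))"

text \<open>
  Every positive number \<open>l\<close> occurs in the sequence exactly as many times as its multiplicity
  says, so that no positive eigenvalue is omitted.
\<close>

definition positive_eigenvalue_sequence :: "real \<Rightarrow> (nat \<Rightarrow> real) \<Rightarrow> bool"
  where "positive_eigenvalue_sequence c \<rho> \<longleftrightarrow>
    decseq \<rho> \<and> (\<forall>m. \<rho> m > 0) \<and>
    (\<forall>l>0. finite {m. \<rho> m = l} \<and> has_multiplicity c l (card {m. \<rho> m = l}))"

definition orthonormal_eigenfunctions ::
    "real \<Rightarrow> (nat \<Rightarrow> real) \<Rightarrow> (nat \<Rightarrow> real \<Rightarrow> real) \<Rightarrow> bool"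
  where "orthonormal_eigenfunctions c \<rho> g \<longleftrightarrow>
    (\<forall>m. continuous_on {-1..1} (g m)) \<and>
    (\<forall>m. (\<lambda>x. complex_of_real (g m x)) \<in> eigenspace c (\<rho> m)) \<and>
    (\<forall>m n. (LINT x|I11. g m x * g n x) = (if m = n then 1 else 0))"

definition sup_norm :: "(real \<Rightarrow> real) \<Rightarrow> real"
  where "sup_norm f = (SUP x\<in>{-1..1}. \<bar>f x\<bar>)"

definition U :: "real \<Rightarrow> real"
  where "U c = (LINT \<xi>|I11. (cosh (4 * c) - cosh (4 * c * \<xi>)) powr (-1/2))"

definition R :: "real \<Rightarrow> real"
  where "R c = 2 / pi\<^sup>2 + (U c * c / pi)\<^sup>2 *
    ((cosh (4 * c) * (1 + c / 3 * coth (2 * c)) - 1) + 2 * c * sinh (4 * c))"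

end

theory Submission
  imports Defs "HOL-Complex_Analysis.Complex_Analysis"
begin

text \<open>
  The operator \<open>\<Q>\<^sub>c\<close> commutes with the Sturm-Liouville operator \<open>L u = - (p u')' + q u\<close>, where
  \<open>p x = cosh k - cosh (k x)\<close>, \<open>q x = 3 k\<^sup>2 cosh (k x) / 16\<close> and \<open>k = 2 \<pi> c\<close>. In exponential variables its
  kernel is a Cauchy kernel, so \<open>\<Q>\<^sub>c f\<close> has at most as many zeros on the real line as \<open>f\<close> has sign
  changes in the interval. Hence no eigenfunction vanishes at an end point, all eigenvalues are simple, each
  \<open>g\<^sub>m\<close> is an eigenfunction of \<open>L\<close>, say for \<open>\<chi>\<close>, and a power iteration shows that \<open>g\<^sub>m\<close> has at
  most \<open>m\<close> zeros. In Liouville's form the equation for \<open>g\<^sub>m\<close> is \<open>v'' + \<phi> v = 0\<close> with \<open>\<phi>\<close> increasing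
  towards the end points: the zero count bounds \<open>\<chi>\<close> by \<open>m\<close>, and Sonin's monotone quantities
  \<open>\<phi> v\<^sup>2 + v'\<^sup>2\<close> and \<open>v\<^sup>2 + v'\<^sup>2 / \<phi>\<close> bound the amplitude of \<open>v\<close>, hence \<open>g\<^sub>m\<close>, by a multiple of
  \<open>(m + 1)\<^sup>1\<^sup>/\<^sup>2\<close>. For small \<open>\<chi>\<close> the energy \<open>\<integral> p g\<^sub>m'\<^sup>2\<close> alone gives a bound independent of
  \<open>m\<close>. Both bounds lie below the claimed one, whose numerical factors are generous.
\<close>

section \<open>The kernel and partial fractions\<close>

text \<open>Completeness of the eigenvalue sequence acts through one consequence: an eigenfunction
  orthogonal to \<open>g 0\<close>, ..., \<open>g m\<close> has an eigenvalue strictly below that of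
  \<open>g m\<close>. This lets the power iteration single out \<open>g m\<close>. Nothing relates
  the order of the numbers \<open>chi\<close> to that of the eigenvalues of the integral operator.
  Only an upper bound for \<open>chi\<close> in terms of m is obtained, and the Sonin estimate needs
  no more. The differential equation is singular at the end points. The Sonin quantities are
  therefore used only up to a point \<open>xe\<close>; beyond it the flux p g', which vanishes at
  the end, controls g. Since p lies below the parabola with the same zeros and end slopes, arcsin
  can replace the Liouville variable. Two values of \<open>k\<close> occur: 4a = 2 pi c in the
  differential operator and 4c in the integrand of \<open>U\<close>. For the claimed bound, with M =
  m + 1/2, its square is at least 3.4 (M + 1.632 R + 4 R / sqrt M), where R >= 2/pi^2 + 7c^2/6. It
  grows linearly in m and quadratically in c, so it can dominate both 3.14 (m + 1) and 0.81 + 2.98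
  sqrt(1 + (2 pi c)^2).\<close>

definition sech_conv :: "real \<Rightarrow> (real \<Rightarrow> real) \<Rightarrow> real \<Rightarrow> real"
  where "sech_conv a f x = integral {-1..1} (\<lambda>y. f y * sech (a * (x - y)))"

lemma cosh_nz [simp]: "cosh (x::real) \<noteq> 0"
  using cosh_real_pos[of x] by linarith

lemma sech_pos: "sech x > 0"
  by (simp add: sech_def)

lemma sech_le_1: "sech x \<le> 1"
  using cosh_real_ge_1[of x] by (simp add: sech_def)

text \<open>All differentiation falls on the kernel, so \<open>f\<close> need only be continuous on
  the interval. This is how an eigenfunction acquires two derivatives on the whole line.\<close>

lemma has_field_derivative_convolution:
  fixes k k' f :: "real \<Rightarrow> real"
  assumes k: "\<And>z. (k has_real_derivative k' z) (at z)"
    and k': "continuous_on UNIV k'" and f: "continuous_on {-1..1} f"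
  shows "((\<lambda>x. integral {-1..1} (\<lambda>y. f y * k (x - y))) has_real_derivative
    integral {-1..1} (\<lambda>y. f y * k' (x - y))) (at x)"
proof -
  have ck: "continuous_on UNIV k"
    by (rule DERIV_continuous_on[OF has_field_derivative_at_within[OF k]])
  have "((\<lambda>x. integral (cbox (-1) 1) (\<lambda>y. f y * k (x - y))) has_field_derivative
      integral (cbox (-1) 1) ((\<lambda>x y. f y * k' (x - y)) x)) (at x within UNIV)"
  proof (rule leibniz_rule_field_derivative)
    fix x t :: real
    show "((\<lambda>x. f t * k (x - t)) has_real_derivative f t * k' (x - t)) (at x within UNIV)"
      by (auto intro!: derivative_eq_intros DERIV_chain2[OF k])
  next
    fix x :: real
    show "(\<lambda>y. f y * k (x - y)) integrable_on cbox (-1) 1"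
    proof (rule integrable_continuous, rule continuous_on_mult)
      show "continuous_on (cbox (-1) 1) f" using f by simp
      have "continuous_on (cbox (-1) 1) (\<lambda>y. x - y)" by (intro continuous_intros)
      then show "continuous_on (cbox (-1) 1) (\<lambda>y. k (x - y))"
        by (rule continuous_on_compose2[OF ck]) simp
    qed
  next
    show "continuous_on (UNIV \<times> cbox (-1) 1) (\<lambda>(x, t). f t * k' (x - t))"
      unfolding case_prod_unfold
    proof (rule continuous_on_mult)
      have 1: "continuous_on (UNIV \<times> cbox (-1) 1) (\<lambda>p::real \<times> real. snd p)"
        "continuous_on (UNIV \<times> cbox (-1) 1) (\<lambda>p::real \<times> real. fst p - snd p)"
        by (intro continuous_intros)+
      show "continuous_on (UNIV \<times> cbox (-1) 1) (\<lambda>p::real \<times> real. f (snd p))"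
        by (rule continuous_on_compose2[OF f 1(1)]) auto
      show "continuous_on (UNIV \<times> cbox (-1) 1) (\<lambda>p::real \<times> real. k' (fst p - snd p))"
        by (rule continuous_on_compose2[OF k' 1(2)]) auto
    qed
  qed auto
  then show ?thesis by simp
qed

lemma continuous_on_sech [continuous_intros]:
  "continuous_on A f \<Longrightarrow> continuous_on A (\<lambda>x. sech (f x))"
  unfolding sech_def by (intro continuous_intros) auto

lemma integrable_sech_conv:
  assumes "continuous_on {-1..1} f"
  shows "(\<lambda>y. f y * sech (a * (x - y))) integrable_on {-1..1}"
  by (intro integrable_continuous_real) (use assms in \<open>auto intro!: continuous_intros\<close>)

definition sech' :: "real \<Rightarrow> real \<Rightarrow> real"
  where "sech' a z = - a * sinh (a * z) / (cosh (a * z))\<^sup>2"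

text \<open>The second derivative of z -> sech (a z), freed of \<open>sinh\<close> by sinh^2 =
  cosh^2 - 1.\<close>

definition sech'' :: "real \<Rightarrow> real \<Rightarrow> real"
  where "sech'' a z = a\<^sup>2 * (1 / cosh (a * z) - 2 / cosh (a * z) ^ 3)"

lemma DERIV_sech: "((\<lambda>z. sech (a * z)) has_real_derivative sech' a z) (at z)"
  unfolding sech_def sech'_def
  by (auto intro!: derivative_eq_intros simp: power2_eq_square field_simps)

lemma DERIV_sech': "(sech' a has_real_derivative sech'' a z) (at z)"
proof -
  define C S where "C = cosh (a * z)" and "S = sinh (a * z)"
  have s: "S\<^sup>2 = C\<^sup>2 - 1" and C: "C \<noteq> 0"
    by (simp_all add: C_def S_def sinh_square_eq)
  have 1: "((\<lambda>z. - a * sinh (a * z)) has_real_derivative - a * (C * a)) (at z)"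
    "((\<lambda>z. (cosh (a * z))\<^sup>2) has_real_derivative 2 * C * (S * a)) (at z)"
    unfolding C_def S_def by (auto intro!: derivative_eq_intros)
  have "((\<lambda>z. - a * sinh (a * z) / (cosh (a * z))\<^sup>2) has_real_derivative
      (- a * (C * a) * C\<^sup>2 - (- a * S) * (2 * C * (S * a))) / (C\<^sup>2 * C\<^sup>2)) (at z)"
    using DERIV_divide[OF 1] C by (simp add: C_def S_def)
  moreover have "(- a * (C * a) * C\<^sup>2 - (- a * S) * (2 * C * (S * a))) = a\<^sup>2 * C * (2 * S\<^sup>2 - C\<^sup>2)"
    by (simp add: power2_eq_square algebra_simps)
  moreover have "a\<^sup>2 * C * (2 * S\<^sup>2 - C\<^sup>2) / (C\<^sup>2 * C\<^sup>2) = sech'' a z"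
    unfolding s sech''_def C_def[symmetric] using C
    by (simp add: field_simps power2_eq_square power3_eq_cube)
  ultimately show ?thesis
    unfolding sech'_def[abs_def] by simp
qed

lemma continuous_on_sech': "continuous_on UNIV (sech' a)"
  unfolding sech'_def[abs_def] by (intro continuous_intros) auto

lemma continuous_on_sech'': "continuous_on UNIV (sech'' a)"
  unfolding sech''_def[abs_def] by (intro continuous_intros) auto

lemma sech_conv_deriv1:
  assumes "continuous_on {-1..1} f"
  shows "(sech_conv a f has_real_derivative integral {-1..1} (\<lambda>y. f y * sech' a (x - y))) (at x)"
  unfolding sech_conv_def[abs_def]
  by (rule has_field_derivative_convolution[OF DERIV_sech continuous_on_sech' assms])

lemma sech_conv_deriv2:
  assumes "continuous_on {-1..1} f"
  shows "((\<lambda>x. integral {-1..1} (\<lambda>y. f y * sech' a (x - y))) has_real_derivative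
    integral {-1..1} (\<lambda>y. f y * sech'' a (x - y))) (at x)"
  by (rule has_field_derivative_convolution[OF DERIV_sech' continuous_on_sech'' assms])

lemma continuous_on_sech_conv:
  assumes "continuous_on {-1..1} f"
  shows "continuous_on A (sech_conv a f)"
  by (rule DERIV_continuous_on[OF has_field_derivative_at_within[OF sech_conv_deriv1[OF assms]]])

section \<open>Partial fractions of quotients with simple real poles\<close>

lemma partial_fraction_mult:
  fixes X :: "real set"
  assumes "finite X" "x0 \<notin> X" "\<forall>x\<in>insert x0 X. t + x \<noteq> 0"
  shows "(\<Sum>x\<in>X. c x / (t + x)) * (1 / (t + x0)) =
    (\<Sum>x\<in>X. (c x / (x0 - x)) / (t + x)) - (\<Sum>x\<in>X. c x / (x0 - x)) / (t + x0)"
proof -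
  have "c x / (t + x) * (1 / (t + x0)) = (c x / (x0 - x)) / (t + x) - (c x / (x0 - x)) / (t + x0)"
    if "x \<in> X" for x
  proof -
    have "t + x \<noteq> 0" "t + x0 \<noteq> 0" "x0 - x \<noteq> 0" using that assms by auto
    then show ?thesis by (simp add: divide_simps) (simp add: algebra_simps)
  qed
  then have "(\<Sum>x\<in>X. c x / (t + x)) * (1 / (t + x0)) =
      (\<Sum>x\<in>X. (c x / (x0 - x)) / (t + x) - (c x / (x0 - x)) / (t + x0))"
    unfolding sum_distrib_right by (intro sum.cong refl)
  then show ?thesis by (simp add: sum_subtractf sum_divide_distrib)
qed

text \<open>Adjoining a zero y together with a pole -x0 multiplies the quotient by 1 - (x0 + y) / (t
  + x0), and \<open>partial_fraction_mult\<close> splits the products of two poles that arise. The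
  constant term 1 is the limit for large t.\<close>

lemma partial_fraction_balanced:
  fixes X Y :: "real set"
  assumes "finite Y" "finite X" "card X = card Y"
  shows "\<exists>c. \<forall>t. (\<forall>x\<in>X. t + x \<noteq> 0) \<longrightarrow>
    (\<Prod>y\<in>Y. t - y) / (\<Prod>x\<in>X. t + x) = 1 + (\<Sum>x\<in>X. c x / (t + x))"
  using assms
proof (induction Y arbitrary: X)
  case empty
  then show ?case by auto
next
  case (insert y Y)
  from insert have "X \<noteq> {}" by auto
  then obtain x0 where x0: "x0 \<in> X" by auto
  define X' where "X' = X - {x0}"
  have X: "X = insert x0 X'" "x0 \<notin> X'" "finite X'" using x0 insert by (auto simp: X'_def)
  have "card X' = card Y" using insert X by simp
  from insert.IH[OF X(3) this] obtain c where
    c: "\<And>t. (\<forall>x\<in>X'. t + x \<noteq> 0) \<Longrightarrow>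
      (\<Prod>y\<in>Y. t - y) / (\<Prod>x\<in>X'. t + x) = 1 + (\<Sum>x\<in>X'. c x / (t + x))" by blast
  define s where "s = (\<Sum>x\<in>X'. c x / (x0 - x))"
  \<comment> \<open>The residue at -x0 collects -(x0 + y) from the constant term and (x0 + y) s from
    the cross terms with the old poles.\<close>
  define c' where "c' x = (if x = x0 then - (x0 + y) * (1 - s) else c x - (x0 + y) * (c x / (x0 - x)))" for x
  show ?case
  proof (intro exI[of _ c'] allI impI)
    fix t assume t: "\<forall>x\<in>X. t + x \<noteq> 0"
    have "(\<Prod>y\<in>insert y Y. t - y) / (\<Prod>x\<in>X. t + x)
        = (t - y) / (t + x0) * ((\<Prod>y\<in>Y. t - y) / (\<Prod>x\<in>X'. t + x))"
      using insert X by simp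
    also have "\<dots> = (1 - (x0 + y) * (1 / (t + x0))) * (1 + (\<Sum>x\<in>X'. c x / (t + x)))"
    proof -
      have "(t - y) / (t + x0) = 1 - (x0 + y) * (1 / (t + x0))"
        using t X by (simp add: field_simps)
      then show ?thesis using c[of t] t X by simp
    qed
    also have "\<dots> = 1 - (x0 + y) * (1 / (t + x0)) + (\<Sum>x\<in>X'. c x / (t + x))
        - (x0 + y) * ((\<Sum>x\<in>X'. c x / (t + x)) * (1 / (t + x0)))"
      by (simp add: algebra_simps)
    also have "(\<Sum>x\<in>X'. c x / (t + x)) * (1 / (t + x0)) =
        (\<Sum>x\<in>X'. (c x / (x0 - x)) / (t + x)) - s / (t + x0)"
      unfolding s_def using t X by (intro partial_fraction_mult) auto
    also have "1 - (x0 + y) * (1 / (t + x0)) + (\<Sum>x\<in>X'. c x / (t + x))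
        - (x0 + y) * ((\<Sum>x\<in>X'. (c x / (x0 - x)) / (t + x)) - s / (t + x0))
      = 1 + (- (x0 + y) * (1 - s)) / (t + x0) + (\<Sum>x\<in>X'. (c x - (x0 + y) * (c x / (x0 - x))) / (t + x))"
      by (simp add: algebra_simps diff_divide_distrib sum_subtractf add_divide_distrib sum_distrib_left)
    also have "(\<Sum>x\<in>X'. (c x - (x0 + y) * (c x / (x0 - x))) / (t + x)) = (\<Sum>x\<in>X'. c' x / (t + x))"
      using X by (intro sum.cong) (auto simp: c'_def)
    also have "1 + (- (x0 + y) * (1 - s)) / (t + x0) + (\<Sum>x\<in>X'. c' x / (t + x)) = 1 + (\<Sum>x\<in>X. c' x / (t + x))"
      using X by (simp add: c'_def)
    finally show "(\<Prod>y\<in>insert y Y. t - y) / (\<Prod>x\<in>X. t + x) = 1 + (\<Sum>x\<in>X. c' x / (t + x))" .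
  qed
qed

text \<open>One pole in excess removes the constant term, leaving a pure combination of Cauchy
  kernels. The expansion of the balanced quotient is multiplied by the factor of the extra
  pole.\<close>

lemma partial_fraction_proper:
  fixes X Y :: "real set"
  assumes "finite Y" "finite X" "card X = Suc (card Y)"
  shows "\<exists>c. \<forall>t. (\<forall>x\<in>X. t + x \<noteq> 0) \<longrightarrow>
    (\<Prod>y\<in>Y. t - y) / (\<Prod>x\<in>X. t + x) = (\<Sum>x\<in>X. c x / (t + x))"
proof -
  obtain x0 X' where X: "X = insert x0 X'" "x0 \<notin> X'" "card X' = card Y"
    using assms(3) card_Suc_eq by (metis)
  have fX: "finite X'" using X assms by auto
  obtain c where c: "\<And>t. (\<forall>x\<in>X'. t + x \<noteq> 0) \<Longrightarrow>
      (\<Prod>y\<in>Y. t - y) / (\<Prod>x\<in>X'. t + x) = 1 + (\<Sum>x\<in>X'. c x / (t + x))"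
    using partial_fraction_balanced[OF assms(1) fX X(3)] by blast
  define s where "s = (\<Sum>x\<in>X'. c x / (x0 - x))"
  define c' where "c' x = (if x = x0 then 1 - s else c x / (x0 - x))" for x
  show ?thesis
  proof (intro exI[of _ c'] allI impI)
    fix t assume t: "\<forall>x\<in>X. t + x \<noteq> 0"
    have "(\<Prod>y\<in>Y. t - y) / (\<Prod>x\<in>X. t + x) = (\<Prod>y\<in>Y. t - y) / (\<Prod>x\<in>X'. t + x) * (1 / (t + x0))"
      using X fX by simp
    also have "\<dots> = 1 / (t + x0) + (\<Sum>x\<in>X'. c x / (t + x)) * (1 / (t + x0))"
      using c[of t] t X by (simp add: algebra_simps)
    also have "(\<Sum>x\<in>X'. c x / (t + x)) * (1 / (t + x0)) =
        (\<Sum>x\<in>X'. (c x / (x0 - x)) / (t + x)) - s / (t + x0)"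
      unfolding s_def using t X fX by (intro partial_fraction_mult) auto
    also have "(\<Sum>x\<in>X'. (c x / (x0 - x)) / (t + x)) = (\<Sum>x\<in>X'. c' x / (t + x))"
      using X by (intro sum.cong) (auto simp: c'_def)
    also have "1 / (t + x0) + ((\<Sum>x\<in>X'. c' x / (t + x)) - s / (t + x0)) = (\<Sum>x\<in>X. c' x / (t + x))"
      using X fX by (simp add: c'_def diff_divide_distrib)
    finally show "(\<Prod>y\<in>Y. t - y) / (\<Prod>x\<in>X. t + x) = (\<Sum>x\<in>X. c' x / (t + x))" .
  qed
qed

lemma infinite_nonzero:
  fixes f :: "real \<Rightarrow> real"
  assumes "continuous_on {-1..1} f" "x0 \<in> {-1..1}" "f x0 \<noteq> 0"
  shows "infinite {x\<in>{-1..1}. f x \<noteq> 0}"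
proof -
  obtain d where d: "d > 0" "\<And>x. x \<in> {-1..1} \<Longrightarrow> dist x x0 < d \<Longrightarrow> dist (f x) (f x0) < \<bar>f x0\<bar>"
    using assms unfolding continuous_on_iff by (metis zero_less_abs_iff)
  define l r where "l = max (-1) (x0 - d/2)" and "r = min 1 (x0 + d/2)"
  have "l < r" using d assms(2) by (auto simp: l_def r_def)
  have "{l..r} \<subseteq> {x\<in>{-1..1}. f x \<noteq> 0}"
  proof
    fix x assume "x \<in> {l..r}"
    then have "x \<in> {-1..1}" "dist x x0 < d"
      using d(1) by (auto simp: l_def r_def dist_real_def abs_le_iff)
    then show "x \<in> {x\<in>{-1..1}. f x \<noteq> 0}" using d(2)[of x] by (auto simp: dist_real_def)
  qed
  then show ?thesis using infinite_Icc[OF \<open>l < r\<close>] finite_subset by blast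
qed

text \<open>In the variables \<open>X = exp (2 a x)\<close>, \<open>Y = exp (2 a y)\<close> the kernel is a Cauchy kernel.\<close>

lemma sech_cauchy:
  "sech (a * (x - y)) = 2 * exp (a * x) * (exp (a * y) / (exp (2 * a * y) + exp (2 * a * x)))"
proof -
  have "cosh (a * (x - y)) = (exp (2 * a * y) + exp (2 * a * x)) / (2 * exp (a * x) * exp (a * y))"
    by (simp add: cosh_field_def field_simps flip: exp_add)
  then show ?thesis by (simp add: sech_def)
qed

lemma cauchy_integral_eq:
  assumes "continuous_on {-1..1} f"
  shows "integral {-1..1} (\<lambda>y. f y * exp (a * y) / (exp (2 * a * y) + exp (2 * a * x)))
    = sech_conv a f x / (2 * exp (a * x))"
proof -
  have "sech_conv a f x = integral {-1..1} (\<lambda>y. (2 * exp (a * x)) * (f y * exp (a * y) / (exp (2 * a * y) + exp (2 * a * x))))"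
    unfolding sech_conv_def sech_cauchy by (intro integral_cong) simp
  then show ?thesis by (simp only: integral_mult_right) simp
qed

lemma exp_sum_nz [simp]: "exp (x::real) + exp y \<noteq> 0"
  using exp_gt_zero[of x] exp_gt_zero[of y] by linarith

text \<open>At a zero of \<open>sech_conv a f\<close> the Cauchy transform of f(y) exp(a y)
  vanishes, so every pole term integrates to zero and only the constant term d survives. The case d
  = 0 gives the contradiction in variation diminution, the case d = 1 the sign of the integral of
  f(y) exp(a y).\<close>

lemma integral_partial_fraction:
  assumes f: "continuous_on {-1..1} f" and X: "finite X" and X0: "\<And>x. x \<in> X \<Longrightarrow> \<exists>u. x = exp (2 * a * u) \<and> sech_conv a f u = 0"
    and c: "\<And>t. (\<forall>x\<in>X. t + x \<noteq> 0) \<Longrightarrow> r t = d + (\<Sum>x\<in>X. c x / (t + x))"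
  shows "integral {-1..1} (\<lambda>y. f y * exp (a * y) * r (exp (2 * a * y))) = d * integral {-1..1} (\<lambda>y. f y * exp (a * y))"
proof -
  let ?w = "\<lambda>y. f y * exp (a * y)"
  have pos: "exp (2 * a * y) + x \<noteq> 0" if "x \<in> X" for x y
    using X0[OF that] by auto
  have w: "?w integrable_on {-1..1}"
    by (intro integrable_continuous_real) (use f in \<open>auto intro!: continuous_intros\<close>)
  have i: "(\<lambda>y. ?w y / (exp (2 * a * y) + x)) integrable_on {-1..1}" if "x \<in> X" for x
    by (intro integrable_continuous_real continuous_intros f) (use pos[OF that] in auto)
  have 0: "integral {-1..1} (\<lambda>y. ?w y / (exp (2 * a * y) + x)) = 0" if "x \<in> X" for x
    using X0[OF that] cauchy_integral_eq[OF f] by auto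
  have "integral {-1..1} (\<lambda>y. ?w y * r (exp (2 * a * y)))
      = integral {-1..1} (\<lambda>y. d * ?w y + (\<Sum>x\<in>X. c x * (?w y / (exp (2 * a * y) + x))))"
  proof (intro integral_cong)
    fix y :: real
    have "r (exp (2 * a * y)) = d + (\<Sum>x\<in>X. c x / (exp (2 * a * y) + x))" using pos by (intro c) auto
    then have "?w y * r (exp (2 * a * y)) = d * ?w y + ?w y * (\<Sum>x\<in>X. c x / (exp (2 * a * y) + x))"
      by (simp only: distrib_left mult.commute)
    also have "?w y * (\<Sum>x\<in>X. c x / (exp (2 * a * y) + x)) = (\<Sum>x\<in>X. c x * (?w y / (exp (2 * a * y) + x)))"
      unfolding sum_distrib_left by (intro sum.cong refl) simp
    finally show "?w y * r (exp (2 * a * y)) = d * ?w y + (\<Sum>x\<in>X. c x * (?w y / (exp (2 * a * y) + x)))" .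
  qed
  also have "\<dots> = integral {-1..1} (\<lambda>y. d * ?w y) + integral {-1..1} (\<lambda>y. \<Sum>x\<in>X. c x * (?w y / (exp (2 * a * y) + x)))"
    by (intro integral_add integrable_on_mult_right w integrable_sum X i)
  also have "integral {-1..1} (\<lambda>y. \<Sum>x\<in>X. c x * (?w y / (exp (2 * a * y) + x))) = (\<Sum>x\<in>X. integral {-1..1} (\<lambda>y. c x * (?w y / (exp (2 * a * y) + x))))"
    by (intro integral_sum X integrable_on_mult_right i)
  also have "\<dots> = (\<Sum>x\<in>X. 0)"
  proof (intro sum.cong refl)
    fix x assume "x \<in> X"
    have "integral {-1..1} (\<lambda>y. c x * (?w y / (exp (2 * a * y) + x)))
        = c x * integral {-1..1} (\<lambda>y. ?w y / (exp (2 * a * y) + x))" by (rule integral_mult_right)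
    then show "integral {-1..1} (\<lambda>y. c x * (?w y / (exp (2 * a * y) + x))) = 0"
      by (simp only: 0[OF \<open>x \<in> X\<close>] mult_zero_right)
  qed
  finally show ?thesis by simp
qed

section \<open>Variation diminution\<close>

text \<open>All sign changes of \<open>f\<close> occur at points of \<open>Y\<close>.\<close>

definition sign_pattern :: "real \<Rightarrow> real set \<Rightarrow> (real \<Rightarrow> real) \<Rightarrow> bool"
  where "sign_pattern s Y f \<longleftrightarrow> s \<noteq> 0 \<and> finite Y \<and> (\<forall>x\<in>{-1..1}. 0 \<le> s * f x * (\<Prod>y\<in>Y. x - y))"

text \<open>Since exp is increasing, the product over the exponentials of \<open>Y\<close> has the
  sign of the product over \<open>Y\<close> itself, and the denominator is positive. The integrand
  times \<open>s\<close> is therefore nonnegative.\<close>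

lemma weighted_integral_pos:
  assumes a: "a > 0" and f: "continuous_on {-1..1} f" "x0 \<in> {-1..1}" "f x0 \<noteq> 0"
    and s: "sign_pattern s Y f" and X: "finite X" "\<And>x. x \<in> X \<Longrightarrow> x > 0"
  shows "0 < s * integral {-1..1} (\<lambda>y. f y * exp (a * y) *
    ((\<Prod>u\<in>(\<lambda>u. exp (2 * a * u)) ` Y. exp (2 * a * y) - u) / (\<Prod>x\<in>X. exp (2 * a * y) + x)))"
proof -
  let ?E = "\<lambda>u. exp (2 * a * u)"
  let ?h = "\<lambda>y. s * (f y * exp (a * y) * ((\<Prod>u\<in>?E ` Y. ?E y - u) / (\<Prod>x\<in>X. ?E y + x)))"
  have inj: "inj_on ?E Y" using a by (auto simp: inj_on_def)
  have Yf: "finite Y" using s by (simp add: sign_pattern_def)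
  have pos: "?E y + x > 0" if "x \<in> X" for x y using X(2)[OF that] by (simp add: add_pos_pos)
  have pos': "(\<Prod>x\<in>X. ?E y + x) > 0" for y using pos by (intro prod_pos) auto
  have ch: "continuous_on {-1..1} ?h"
  proof -
    have nz: "\<forall>y\<in>{-1..1}. (\<Prod>x\<in>X. ?E y + x) \<noteq> 0" using pos' by (metis less_irrefl)
    have c: "continuous_on {-1..1} (\<lambda>y. exp (a * y))" "continuous_on {-1..1} (\<lambda>y. \<Prod>u\<in>?E ` Y. ?E y - u)"
      "continuous_on {-1..1} (\<lambda>y. \<Prod>x\<in>X. ?E y + x)"
      by (intro continuous_intros)+
    show ?thesis
      by (rule continuous_on_mult[OF continuous_on_const
        continuous_on_mult[OF continuous_on_mult[OF f(1) c(1)] continuous_on_divide[OF c(2,3) nz]]])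
  qed
  have nn: "0 \<le> ?h y" if "y \<in> {-1..1}" for y
  proof -
    have 1: "(\<Prod>u\<in>Y. ?E y - ?E u) * (\<Prod>u\<in>Y. y - u) \<ge> 0"
    proof -
      have "(?E y - ?E u) * (y - u) \<ge> 0" for u
        using a by (cases "y \<ge> u") (auto simp: mult_nonneg_nonneg mult_nonpos_nonpos)
      then show ?thesis unfolding prod.distrib[symmetric] by (intro prod_nonneg) blast
    qed
    have 2: "0 \<le> s * f y * (\<Prod>u\<in>Y. y - u)" using s that by (simp add: sign_pattern_def)
    have 3: "(\<Prod>u\<in>?E ` Y. ?E y - u) = (\<Prod>u\<in>Y. ?E y - ?E u)"
      using inj by (subst prod.reindex) auto
    have "0 \<le> s * f y * (\<Prod>u\<in>Y. ?E y - ?E u)"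
    proof (cases "y \<in> Y")
      case True
      then have "(\<Prod>u\<in>Y. ?E y - ?E u) = 0" using Yf by (intro prod_zero) auto
      then show ?thesis by simp
    next
      case False
      then have nz: "(\<Prod>u\<in>Y. y - u) \<noteq> 0" using Yf by auto
      \<comment> \<open>Multiplying two nonnegative quantities makes the product over
        \<open>Y\<close> appear squared; dividing by that square transfers the sign to the
        exponential product.\<close>
      have "0 \<le> (s * f y * (\<Prod>u\<in>Y. y - u)) * ((\<Prod>u\<in>Y. ?E y - ?E u) * (\<Prod>u\<in>Y. y - u))"
        using 1 2 by simp
      also have "\<dots> = (s * f y * (\<Prod>u\<in>Y. ?E y - ?E u)) * (\<Prod>u\<in>Y. y - u)\<^sup>2"
        by (simp add: power2_eq_square)
      finally show ?thesis using nz by (simp add: zero_le_mult_iff)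
    qed
    then have "0 \<le> (s * f y * (\<Prod>u\<in>Y. ?E y - ?E u)) * (exp (a * y) / (\<Prod>x\<in>X. ?E y + x))"
      using less_imp_le[OF pos'[of y]] by (intro mult_nonneg_nonneg[OF _ divide_nonneg_nonneg]) simp_all
    moreover have "(s * f y * (\<Prod>u\<in>Y. ?E y - ?E u)) * (exp (a * y) / (\<Prod>x\<in>X. ?E y + x))
        = s * (f y * exp (a * y) * ((\<Prod>u\<in>Y. ?E y - ?E u) / (\<Prod>x\<in>X. ?E y + x)))"
      by (simp only: times_divide_eq_right times_divide_eq_left mult_ac)
    ultimately show ?thesis unfolding 3 by (simp only:)
  qed
  have "integral {-1..1} ?h \<noteq> 0"
  proof
    assume 0: "integral {-1..1} ?h = 0"
    have *: "\<forall>y\<in>{-1..1}. ?h y = 0"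
      by (rule iffD1[OF integral_eq_0_iff[OF ch _ nn] 0]) simp
    \<comment> \<open>A vanishing integral would confine the support of \<open>f\<close> to the
      finite set \<open>Y\<close>, while a continuous nonzero function is nonzero at infinitely many
      points.\<close>
    have "{x\<in>{-1..1}. f x \<noteq> 0} \<subseteq> Y"
    proof
      fix y assume y: "y \<in> {x\<in>{-1..1}. f x \<noteq> 0}"
      then have "s * (f y * exp (a * y) * ((\<Prod>u\<in>?E ` Y. ?E y - u) / (\<Prod>x\<in>X. ?E y + x))) = 0"
        by (intro bspec[OF *]) simp
      moreover have "s \<noteq> 0" "(\<Prod>x\<in>X. ?E y + x) \<noteq> 0" "f y \<noteq> 0"
        using y pos'[of y] s by (simp_all add: sign_pattern_def)
      ultimately have "(\<Prod>u\<in>?E ` Y. ?E y - u) = 0"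
        by (simp only: mult_eq_0_iff divide_eq_0_iff exp_not_eq_zero simp_thms)
      then obtain u where "u \<in> Y" "?E y = ?E u" using Yf by auto
      then show "y \<in> Y" using a by auto
    qed
    then show False using infinite_nonzero[OF f] Yf finite_subset by blast
  qed
  moreover have "0 \<le> integral {-1..1} ?h"
    by (intro integral_nonneg integrable_continuous_real ch nn)
  ultimately have "0 < integral {-1..1} ?h" by linarith
  then show ?thesis by (simp only: integral_mult_right)
qed

text \<open>
  One zero too many would make \<open>\<Prod>(t - y\<^sub>i) / \<Prod>(t + x\<^sub>j)\<close> a combination of the Cauchy kernels at the zeros
  \<open>x\<^sub>j\<close>, so that it integrates to zero against \<open>f\<close>, although their product has constant sign.
\<close>

lemma variation_diminishing:
  assumes a: "a > 0" and f: "continuous_on {-1..1} f" "x0 \<in> {-1..1}" "f x0 \<noteq> 0"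
    and s: "sign_pattern s Y f"
  shows "finite {x. sech_conv a f x = 0} \<and> card {x. sech_conv a f x = 0} \<le> card Y"
proof (rule ccontr)
  assume *: "\<not> ?thesis"
  let ?Z = "{x. sech_conv a f x = 0}" and ?E = "\<lambda>u. exp (2 * a * u)"
  have Yf: "finite Y" using s by (simp add: sign_pattern_def)
  have "\<exists>Z\<subseteq>?Z. finite Z \<and> card Z = Suc (card Y)"
  proof (cases "finite ?Z")
    case True
    then show ?thesis using * by (meson not_less_eq_eq obtain_subset_with_card_n finite_subset)
  next
    case False
    then show ?thesis using infinite_arbitrarily_large by metis
  qed
  then obtain Z where Z: "Z \<subseteq> ?Z" "finite Z" "card Z = Suc (card Y)" by blast
  have inj: "inj_on ?E A" for A using a by (auto simp: inj_on_def)
  have "card (?E ` Z) = Suc (card (?E ` Y))" using Z(3) by (simp add: card_image inj)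
  then obtain c where c: "\<And>t. (\<forall>x\<in>?E ` Z. t + x \<noteq> 0) \<Longrightarrow>
    (\<Prod>y\<in>?E ` Y. t - y) / (\<Prod>x\<in>?E ` Z. t + x) = (\<Sum>x\<in>?E ` Z. c x / (t + x))"
    using partial_fraction_proper[of "?E ` Y" "?E ` Z"] Yf Z(2) by auto
  have "integral {-1..1} (\<lambda>y. f y * exp (a * y) * ((\<lambda>t. (\<Prod>y\<in>?E ` Y. t - y) / (\<Prod>x\<in>?E ` Z. t + x)) (?E y)))
      = 0 * integral {-1..1} (\<lambda>y. f y * exp (a * y))"
    using Z c by (intro integral_partial_fraction[where X = "?E ` Z" and c = c] f) auto
  moreover have "0 < s * integral {-1..1} (\<lambda>y. f y * exp (a * y) * ((\<Prod>u\<in>?E ` Y. ?E y - u) / (\<Prod>x\<in>?E ` Z. ?E y + x)))"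
    using Z by (intro weighted_integral_pos[OF a f s]) auto
  ultimately show False by simp
qed

lemma const_sign:
  fixes h :: "real \<Rightarrow> real"
  assumes "connected D" "continuous_on D h" "\<And>x. x \<in> D \<Longrightarrow> h x \<noteq> 0"
  shows "\<exists>t. t \<noteq> 0 \<and> (\<forall>x\<in>D. 0 < t * h x)"
proof (cases "\<exists>x\<in>D. 0 < h x")
  case True
  then obtain u where u: "u \<in> D" "0 < h u" by blast
  have "0 < h x" if "x \<in> D" for x
  proof (rule ccontr)
    assume "\<not> 0 < h x"
    then have "0 \<in> h ` D"
      using connected_contains_Icc[OF connected_continuous_image[OF assms(2,1)], of "h x" "h u"] that u by auto
    then show False using assms(3) by auto
  qed
  then show ?thesis by (intro exI[of _ 1]) simp
next
  case False
  then have "h x < 0" if "x \<in> D" for x using assms(3)[OF that] that by (meson linorder_neqE_linordered_idom)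
  then show ?thesis by (intro exI[of _ "-1"]) simp
qed

text \<open>Induction on the largest zero z: to its right \<open>h\<close> has one sign, and z
  enters \<open>Y\<close> only if that sign differs from the one the pattern on the left predicts.
  Zeros without a change of sign are thus left out.\<close>

lemma sign_changes_exist:
  fixes h :: "real \<Rightarrow> real"
  assumes "finite Z" "is_interval D" "continuous_on D h" "Z = {x\<in>D. h x = 0}"
  shows "\<exists>s Y. s \<noteq> 0 \<and> Y \<subseteq> Z \<and> (\<forall>x\<in>D. 0 \<le> s * h x * (\<Prod>y\<in>Y. x - y))"
  using assms
proof (induction Z arbitrary: D rule: finite_psubset_induct)
  case (psubset Z)
  show ?case
  proof (cases "Z = {}")
    case True
    then obtain t where "t \<noteq> 0" "\<forall>x\<in>D. 0 < t * h x"
      using const_sign[of D h] psubset by (auto simp: is_interval_connected_1)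
    then show ?thesis by (intro exI[of _ t] exI[of _ "{}"]) (auto simp: less_imp_le)
  next
    case False
    define z where "z = Max Z"
    have z: "z \<in> Z" "\<And>x. x \<in> Z \<Longrightarrow> x \<le> z"
      unfolding z_def by (rule Max_in[OF psubset.hyps(1) False], rule Max_ge[OF psubset.hyps(1)])
    define D1 D2 where "D1 = D \<inter> {..<z}" and "D2 = D \<inter> {z<..}"
    have i: "is_interval D1" "is_interval D2"
      unfolding D1_def D2_def using psubset by (auto intro!: is_interval_Int simp: is_interval_io is_interval_oi)
    have c: "continuous_on D1 h" "continuous_on D2 h"
      using psubset.prems(2) by (auto simp: D1_def D2_def intro: continuous_on_subset)
    define Z1 where "Z1 = {x\<in>D1. h x = 0}"
    have "Z1 \<subset> Z" using z psubset.prems by (auto simp: Z1_def D1_def)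
    from psubset.IH[OF this i(1) c(1) Z1_def] obtain s Y where
      s: "s \<noteq> 0" "Y \<subseteq> Z1" "\<And>x. x \<in> D1 \<Longrightarrow> 0 \<le> s * h x * (\<Prod>y\<in>Y. x - y)" by blast
    have "h x \<noteq> 0" if "x \<in> D2" for x
      using that z(2)[of x] psubset.prems(3) by (auto simp: D2_def)
    then obtain t where t: "t \<noteq> 0" "\<And>x. x \<in> D2 \<Longrightarrow> 0 < t * h x"
      using const_sign[of D2 h] i c by (auto simp: is_interval_connected_1)
    have Y1: "Y \<subseteq> Z" using s(2) \<open>Z1 \<subset> Z\<close> by simp
    have Yf: "finite Y" by (rule finite_subset[OF Y1 psubset.hyps(1)])
    have Yz: "y < z" if "y \<in> Y" for y using s that by (auto simp: Z1_def D1_def)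
    have pos: "0 < (\<Prod>y\<in>Y. x - y)" if "x \<in> D2" for x
    proof (intro prod_pos)
      fix y assume "y \<in> Y"
      then show "0 < x - y" using Yz[of y] that by (simp add: D2_def)
    qed
    have D: "x \<in> D1 \<or> x = z \<or> x \<in> D2" if "x \<in> D" for x using that by (auto simp: D1_def D2_def)
    have hz: "h z = 0" using z psubset.prems by auto
    have zY: "z \<notin> Y" using Yz by blast
    show ?thesis
    proof (cases "0 < t * s")
      case True
      have "0 \<le> s * h x * (\<Prod>y\<in>Y. x - y)" if "x \<in> D2" for x
      proof -
        have "0 < (t * s) * (t * h x)" using True t(2)[OF that] by simp
        also have "\<dots> = (s * h x) * t\<^sup>2" by (simp add: power2_eq_square mult_ac)
        finally have "0 < s * h x" using t(1) by (simp add: zero_less_mult_iff)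
        then show ?thesis using pos[OF that] by simp
      qed
      then have "0 \<le> s * h x * (\<Prod>y\<in>Y. x - y)" if "x \<in> D" for x
        using D[OF that] s(3)[of x] hz by auto
      then show ?thesis using s(1) Y1 by blast
    next
      case False
      then have ts: "t * s < 0" using t(1) s(1) by (simp add: not_less le_less)
      \<comment> \<open>The new factor x - z is negative on the left part, where it is compensated
        by passing from s to -s.\<close>
      have "0 \<le> (- s) * h x * (\<Prod>y\<in>insert z Y. x - y)" if "x \<in> D" for x
        using D[OF that]
      proof (elim disjE)
        assume x: "x \<in> D1"
        then have "0 \<le> (s * h x * (\<Prod>y\<in>Y. x - y)) * (z - x)" using s(3)[OF x] by (simp add: D1_def)
        then show ?thesis using zY Yf by (simp add: algebra_simps)
      next
        assume x: "x \<in> D2"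
        have "0 < (- (t * s)) * (t * h x)" using ts t(2)[OF x] by (simp add: mult_neg_pos)
        also have "\<dots> = (- s * h x) * t\<^sup>2" by (simp add: power2_eq_square mult_ac)
        finally have sh: "0 < - s * h x" by (rule zero_less_mult_pos2) (simp add: t(1))
        then have "0 \<le> (- s * h x) * ((x - z) * (\<Prod>y\<in>Y. x - y))"
          using less_imp_le[OF pos[OF x]] less_imp_le[OF sh] x
          by (intro mult_nonneg_nonneg[OF _ mult_nonneg_nonneg]) (simp_all add: D2_def)
        then show ?thesis using zY Yf by simp
      qed (simp add: hz)
      moreover have "- s \<noteq> 0" "insert z Y \<subseteq> Z" using s(1) Y1 z(1) by simp_all
      ultimately show ?thesis by blast
    qed
  qed
qed

text \<open>End points cannot be sign changes: the inequality is obtained on the open interval and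
  reaches the closed one by continuity. That \<open>Y\<close> contains only interior zeros is what
  later excludes zeros at the end points.\<close>

lemma sign_pattern_exists:
  assumes "continuous_on {-1..1} h" "finite {x\<in>{-1<..<1}. h x = 0}"
  shows "\<exists>s Y. sign_pattern s Y h \<and> Y \<subseteq> {x\<in>{-1<..<1}. h x = 0}"
proof -
  have "continuous_on {-1<..<1} h" using assms(1) by (rule continuous_on_subset) auto
  then obtain s Y where s: "s \<noteq> 0" "Y \<subseteq> {x\<in>{-1<..<1}. h x = 0}"
    "\<And>x. x \<in> {-1<..<1} \<Longrightarrow> 0 \<le> s * h x * (\<Prod>y\<in>Y. x - y)"
    using sign_changes_exist[OF assms(2), of "{-1<..<1}" h] by (auto simp: is_interval_oo)
  have cl: "closure {-1<..<1} = {-1..1::real}" by simp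
  have "0 \<le> s * h x * (\<Prod>y\<in>Y. x - y)" if "x \<in> {-1..1}" for x
  proof (rule continuous_ge_on_closure[where S = "{-1<..<1}" and f = "\<lambda>x. s * h x * (\<Prod>y\<in>Y. x - y)"])
    show "continuous_on (closure {-1<..<1}) (\<lambda>x. s * h x * (\<Prod>y\<in>Y. x - y))"
      unfolding cl by (intro continuous_intros assms)
  qed (use that cl s in auto)
  moreover have "finite Y" using s(2) assms(2) finite_subset by blast
  ultimately show ?thesis using s by (auto simp: sign_pattern_def intro!: exI[of _ s] exI[of _ Y])
qed

lemma cosh_of_real_complex: "cosh (complex_of_real x) = of_real (cosh x)"
  by (simp add: cosh_field_def exp_of_real flip: of_real_minus)

section \<open>Eigenfunctions\<close>

definition eigenfun :: "real \<Rightarrow> real \<Rightarrow> (real \<Rightarrow> real) \<Rightarrow> bool"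
  where "eigenfun a l f \<longleftrightarrow> continuous_on {-1..1} f \<and> l \<noteq> 0 \<and> (\<forall>x\<in>{-1..1}. sech_conv a f x = l * f x)"

lemma cosh_complex_nz:
  assumes "\<bar>Im w\<bar> < pi / 2"
  shows "cosh w \<noteq> (0::complex)"
proof
  assume "cosh w = 0"
  moreover have "Re (cosh w) = (exp (Re w) + exp (- Re w)) / 2 * cos (Im w)"
    by (simp add: cosh_field_def Re_exp field_simps)
  moreover have "cos (Im w) > 0" using assms by (intro cos_gt_zero_pi) auto
  ultimately have "exp (Re w) + exp (- Re w) = 0" by simp
  then show False using exp_gt_zero[of "Re w"] exp_gt_zero[of "- Re w"] by linarith
qed

text \<open>The kernel is holomorphic in a strip around the real line, hence so is the convolution.
  Infinitely many zeros in a compact interval accumulate there, and the identity theorem makes the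
  function vanish.\<close>

lemma eigenfun_finite_zeros:
  assumes a: "a > 0" and e: "eigenfun a l f" and x0: "x0 \<in> {-1..1}" "f x0 \<noteq> 0"
  shows "finite {x\<in>{-1..1}. f x = 0}"
proof (rule ccontr)
  assume inf: "infinite {x\<in>{-1..1}. f x = 0}"
  have f: "continuous_on {-1..1} f" and l: "l \<noteq> 0" and fl: "\<And>x. x \<in> {-1..1} \<Longrightarrow> sech_conv a f x = l * f x"
    using e by (auto simp: eigenfun_def)
  \<comment> \<open>In this strip the argument of cosh has imaginary part of modulus below 1 < pi /
    2, so cosh has no zero.\<close>
  define S where "S = {z. - (1/a) < Im z} \<inter> {z. Im z < 1/a}"
  have S: "open S" "convex S"
    unfolding S_def by (auto intro!: open_Int convex_Int open_halfspace_Im_gt open_halfspace_Im_lt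
        convex_halfspace_Im_gt convex_halfspace_Im_lt)
  define F where "F z = integral (cbox (-1) 1) (\<lambda>y. of_real (f y) / cosh (of_real a * (z - of_real y)))" for z :: complex
  have nz: "cosh (of_real a * (z - of_real y)) \<noteq> 0" if "z \<in> S" for z and y :: real
  proof (rule cosh_complex_nz)
    have "\<bar>a * Im z\<bar> < 1" using that a by (auto simp: S_def abs_less_iff field_simps)
    then show "\<bar>Im (of_real a * (z - of_real y))\<bar> < pi / 2" using pi_gt3 by simp
  qed
  have cf: "continuous_on (cbox (-1) 1) (\<lambda>y. of_real (f y) :: complex)"
    using f by (intro continuous_intros) simp
  have "F holomorphic_on S"
    unfolding holomorphic_on_def field_differentiable_def
  proof (intro ballI exI)
    fix z assume z: "z \<in> S"
    show "(F has_field_derivative integral (cbox (-1) 1)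
        ((\<lambda>z y. of_real (f y) * (- (of_real a * sinh (of_real a * (z - of_real y))) / (cosh (of_real a * (z - of_real y)))\<^sup>2)) z)) (at z within S)"
      unfolding F_def
    proof (rule leibniz_rule_field_derivative[OF _ _ _ z S(2)])
      fix z t assume "z \<in> S"
      then show "((\<lambda>z. of_real (f t) / cosh (of_real a * (z - of_real t))) has_field_derivative
        of_real (f t) * (- (of_real a * sinh (of_real a * (z - of_real t))) / (cosh (of_real a * (z - of_real t)))\<^sup>2)) (at z within S)"
        using nz[of z t] by (auto intro!: derivative_eq_intros simp: power2_eq_square field_simps)
    next
      fix z assume "z \<in> S"
      then show "(\<lambda>y. of_real (f y) / cosh (of_real a * (z - of_real y))) integrable_on cbox (-1) 1"
        using nz by (intro integrable_continuous continuous_on_divide cf continuous_intros) auto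
    next
      have 1: "continuous_on (S \<times> cbox (-1) 1) (\<lambda>p::complex \<times> real. snd p)" by (intro continuous_intros)
      have 2: "continuous_on (S \<times> cbox (-1) 1) (\<lambda>p::complex \<times> real. of_real (f (snd p)) :: complex)"
        by (rule continuous_on_compose2[OF cf 1]) auto
      have 3: "continuous_on (S \<times> cbox (-1) 1) (\<lambda>p::complex \<times> real. of_real a * (fst p - of_real (snd p)) :: complex)"
        by (intro continuous_intros)
      have 4: "\<forall>p\<in>S \<times> cbox (-1) 1. (cosh (of_real a * (fst p - of_real (snd p)) :: complex))\<^sup>2 \<noteq> 0"
        using nz by auto
      show "continuous_on (S \<times> cbox (-1) 1) (\<lambda>(z, y). of_real (f y) * (- (of_real a * sinh (of_real a * (z - of_real y))) / (cosh (of_real a * (z - of_real y)))\<^sup>2))"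
        unfolding case_prod_unfold
        by (intro continuous_on_mult[OF 2] continuous_on_divide continuous_on_minus continuous_on_power
            continuous_on_mult[OF continuous_on_const] continuous_on_sinh continuous_on_cosh 3 4)
    qed
  qed
  have Freal: "F (of_real x) = of_real (sech_conv a f x)" for x
  proof -
    have "F (of_real x) = integral {-1..1} (of_real \<circ> (\<lambda>y. f y * sech (a * (x - y))))"
      unfolding F_def box_real by (intro integral_cong)
        (simp add: sech_def cosh_of_real_complex flip: of_real_mult of_real_diff)
    also have "\<dots> = of_real (sech_conv a f x)"
      unfolding sech_conv_def by (rule integral_linear[OF integrable_sech_conv[OF f] bounded_linear_of_real])
    finally show ?thesis .
  qed
  let ?U = "(of_real :: real \<Rightarrow> complex) ` {x\<in>{-1..1}. f x = 0}"
  have U: "infinite ?U" using inf by (simp add: finite_image_iff inj_on_def)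
  have "compact ((of_real :: real \<Rightarrow> complex) ` {-1..1})"
    by (intro compact_continuous_image continuous_intros compact_Icc)
  then have "\<forall>T. infinite T \<and> T \<subseteq> (of_real :: real \<Rightarrow> complex) ` {-1..1} \<longrightarrow> (\<exists>x\<in>of_real ` {-1..1}. x islimpt T)"
    unfolding compact_eq_Bolzano_Weierstrass .
  moreover have "?U \<subseteq> of_real ` {-1..1}" by auto
  ultimately obtain xi where xi: "xi \<in> of_real ` {-1..1}" "xi islimpt ?U"
    using U by blast
  have rS: "of_real x \<in> S" for x using a by (simp add: S_def)
  have "F (of_real x0) = 0"
  proof (rule analytic_continuation[OF \<open>F holomorphic_on S\<close> S(1) convex_connected[OF S(2)] _ _ xi(2)])
    show "?U \<subseteq> S" "xi \<in> S" using rS xi by auto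
    show "F z = 0" if "z \<in> ?U" for z using that fl by (auto simp: Freal)
  qed (rule rS)
  then show False using fl x0 l by (simp add: Freal)
qed

text \<open>With X = exp (2 a x), X times the Cauchy transform differs from the integral J of f(y)
  exp(a y) by at most B / X. For large x the convolution therefore has the sign of J.\<close>

lemma sech_conv_eventually_sign:
  assumes a: "a > 0" and f: "continuous_on {-1..1} f" and s: "0 < s * integral {-1..1} (\<lambda>y. f y * exp (a * y))"
  shows "\<exists>x\<ge>1. 0 < s * sech_conv a f x"
proof -
  let ?E = "\<lambda>u. exp (2 * a * u)" and ?w = "\<lambda>y. f y * exp (a * y)"
  have c: "continuous_on {-1..1} ?w" "continuous_on {-1..1} (\<lambda>y. \<bar>?w y\<bar> * ?E y)"
    by (intro continuous_intros f)+
  have c3: "continuous_on {-1..1} (\<lambda>y. ?w y / (?E y + ?E x))" for x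
    by (intro continuous_intros f) auto
  define B where "B = integral {-1..1} (\<lambda>y. \<bar>?w y\<bar> * ?E y)"
  define J where "J = integral {-1..1} ?w"
  have B: "B \<ge> 0" unfolding B_def by (intro integral_nonneg integrable_continuous_real c) simp
  \<comment> \<open>Chosen so that exp (2 a x) > 2 a x > |s| B / (s J), which makes the error
    smaller than s J.\<close>
  define x where "x = 1 + \<bar>s\<bar> * B / (s * J) / (2 * a)"
  have sJ: "s * J > 0" using s by (simp add: J_def)
  have x1: "x \<ge> 1" using a B sJ by (simp add: x_def)
  have "2 * a * x = 2 * a + \<bar>s\<bar> * B / (s * J)" using a by (simp add: x_def field_simps)
  then have "\<bar>s\<bar> * B / (s * J) < ?E x" using exp_ge_add_one_self[of "2 * a * x"] a by linarith
  then have lt: "\<bar>s\<bar> * (B / ?E x) < s * J" using sJ by (simp add: pos_divide_less_eq mult.commute field_simps)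
  define H where "H = integral {-1..1} (\<lambda>y. ?w y / (?E y + ?E x))"
  have i3: "(\<lambda>y. ?E x * (?w y / (?E y + ?E x))) integrable_on {-1..1}"
    by (intro integrable_on_mult_right integrable_continuous_real c3)
  have "integral {-1..1} (\<lambda>y. ?E x * (?w y / (?E y + ?E x))) = ?E x * H"
    unfolding H_def by (rule integral_mult_right)
  then have JH: "J - ?E x * H = integral {-1..1} (\<lambda>y. ?w y - ?E x * (?w y / (?E y + ?E x)))"
    using integral_diff[OF integrable_continuous_real[OF c(1)] i3] by (simp only: J_def)
  have "\<bar>integral {-1..1} (\<lambda>y. ?w y - ?E x * (?w y / (?E y + ?E x)))\<bar> \<le> integral {-1..1} (\<lambda>y. (\<bar>?w y\<bar> * ?E y) / ?E x)"
  proof (rule integral_norm_bound_integral[where f = h for h :: "real \<Rightarrow> real", unfolded real_norm_def])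
    show "(\<lambda>y. ?w y - ?E x * (?w y / (?E y + ?E x))) integrable_on {-1..1}"
      by (rule integrable_diff[OF integrable_continuous_real[OF c(1)] i3])
    show "(\<lambda>y. (\<bar>?w y\<bar> * ?E y) / ?E x) integrable_on {-1..1}"
      by (intro integrable_on_divide integrable_continuous_real c)
    fix y :: real
    have "?w y - ?E x * (?w y / (?E y + ?E x)) = ?w y * (?E y / (?E y + ?E x))"
      by (simp add: field_simps)
    then have "\<bar>?w y - ?E x * (?w y / (?E y + ?E x))\<bar> = \<bar>?w y\<bar> * (?E y / (?E y + ?E x))"
      by (simp only: abs_mult abs_divide abs_exp_cancel) (simp add: abs_of_pos add_pos_pos)
    also have "\<dots> \<le> \<bar>?w y\<bar> * (?E y / ?E x)"
      by (intro mult_left_mono divide_left_mono) (auto simp: add_pos_pos)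
    finally show "\<bar>?w y - ?E x * (?w y / (?E y + ?E x))\<bar> \<le> (\<bar>?w y\<bar> * ?E y) / ?E x"
      by (simp only: times_divide_eq_right)
  qed
  then have "\<bar>J - ?E x * H\<bar> \<le> B / ?E x" unfolding JH B_def integral_divide .
  then have "\<bar>s\<bar> * \<bar>J - ?E x * H\<bar> \<le> \<bar>s\<bar> * (B / ?E x)" by (intro mult_left_mono) auto
  then have "\<bar>s * J - ?E x * (s * H)\<bar> < s * J" using lt by (simp add: algebra_simps flip: abs_mult)
  then have "0 < ?E x * (s * H)" by linarith
  then have "0 < s * H" by (simp add: zero_less_mult_iff)
  moreover have "sech_conv a f x = 2 * exp (a * x) * H"
    using cauchy_integral_eq[OF f, of a x] by (simp add: H_def)
  moreover have "s * (2 * exp (a * x) * H) = 2 * exp (a * x) * (s * H)" by simp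
  ultimately have "0 < s * sech_conv a f x" by (simp only: zero_less_mult_iff exp_gt_zero) simp
  then show ?thesis using x1 by blast
qed

text \<open>
  The zeros in the open interval already exhaust the bound by the number of sign changes, so there is none left
  for the end points. The balanced partial fraction gives the sign of the eigenfunction near \<open>\<infinity>\<close>, which
  fixes the sign of the eigenvalue.
\<close>

lemma eigenfun_nodal:
  assumes a: "a > 0" and e: "eigenfun a l f" and x0: "x0 \<in> {-1..1}" "f x0 \<noteq> 0"
  obtains s Z where "Z = {x\<in>{-1<..<1}. f x = 0}" "sign_pattern s Z f" "Z = {x\<in>{-1..1}. f x = 0}"
    "f 1 \<noteq> 0" "f (-1) \<noteq> 0" "l > 0"
proof -
  have f: "continuous_on {-1..1} f" and l: "l \<noteq> 0" and fl: "\<And>x. x \<in> {-1..1} \<Longrightarrow> sech_conv a f x = l * f x"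
    using e by (auto simp: eigenfun_def)
  define Z where "Z = {x\<in>{-1<..<1}. f x = 0}"
  have "finite {x\<in>{-1..1}. f x = 0}" by (rule eigenfun_finite_zeros[OF a e x0])
  then have Zf: "finite Z" by (rule rev_finite_subset) (auto simp: Z_def)
  then obtain s Y where s: "sign_pattern s Y f" "Y \<subseteq> Z"
    using sign_pattern_exists[OF f] by (auto simp: Z_def)
  let ?W = "{x. sech_conv a f x = 0}"
  have W: "finite ?W" "card ?W \<le> card Y" using variation_diminishing[OF a f x0 s(1)] by auto
  have "{x\<in>{-1..1}. f x = 0} \<subseteq> ?W" using fl by auto
  moreover have "Z \<subseteq> {x\<in>{-1..1}. f x = 0}" by (auto simp: Z_def)
  ultimately have sub: "Y \<subseteq> Z" "Z \<subseteq> {x\<in>{-1..1}. f x = 0}" "{x\<in>{-1..1}. f x = 0} \<subseteq> ?W" using s by auto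
  then have "Y \<subseteq> ?W" by blast
  then have "Y = ?W" using W card_seteq by blast
  then have ZY: "Z = Y" "Z = {x\<in>{-1..1}. f x = 0}" "Z = ?W" using sub by auto
  have f1: "f 1 \<noteq> 0" and fm1: "f (-1) \<noteq> 0"
  proof -
    have "1 \<notin> Z" "-1 \<notin> Z" by (simp_all add: Z_def)
    then have "1 \<notin> {x\<in>{-1..1}. f x = 0}" "-1 \<notin> {x\<in>{-1..1}. f x = 0}"
      unfolding ZY(2)[symmetric] .
    then show "f 1 \<noteq> 0" "f (-1) \<noteq> 0" by simp_all
  qed
  have sZ: "sign_pattern s Z f" using s ZY by simp
  let ?E = "\<lambda>u. exp (2 * a * u)"
  obtain c where c: "\<And>t. (\<forall>x\<in>?E ` Z. t + x \<noteq> 0) \<Longrightarrow>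
    (\<Prod>y\<in>?E ` Z. t - y) / (\<Prod>x\<in>?E ` Z. t + x) = 1 + (\<Sum>x\<in>?E ` Z. c x / (t + x))"
    using partial_fraction_balanced[of "?E ` Z" "?E ` Z"] Zf by auto
  have "integral {-1..1} (\<lambda>y. f y * exp (a * y) * ((\<lambda>t. (\<Prod>y\<in>?E ` Z. t - y) / (\<Prod>x\<in>?E ` Z. t + x)) (?E y)))
      = 1 * integral {-1..1} (\<lambda>y. f y * exp (a * y))"
    using Zf c ZY(3) by (intro integral_partial_fraction[where X = "?E ` Z" and c = c] f) auto
  moreover have "0 < s * integral {-1..1} (\<lambda>y. f y * exp (a * y) * ((\<Prod>u\<in>?E ` Z. ?E y - u) / (\<Prod>x\<in>?E ` Z. ?E y + x)))"
    using Zf by (intro weighted_integral_pos[OF a f x0 sZ]) auto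
  ultimately have "0 < s * integral {-1..1} (\<lambda>y. f y * exp (a * y))" by simp
  then obtain x1 where x1: "x1 \<ge> 1" "0 < s * sech_conv a f x1"
    using sech_conv_eventually_sign[OF a f] by blast
  \<comment> \<open>Every zero of the convolution on the whole real line lies in \<open>Z\<close>,
    so none is met between 1 and \<open>x1\<close> and the sign found far out persists at 1.\<close>
  have "sech_conv a f x \<noteq> 0" if "x \<in> {1..x1}" for x
  proof
    assume "sech_conv a f x = 0"
    then have "x \<in> Z" unfolding ZY(3) by simp
    then show False using that by (simp add: Z_def)
  qed
  then obtain t where t: "t \<noteq> 0" "\<forall>x\<in>{1..x1}. 0 < t * sech_conv a f x"
    using const_sign[of "{1..x1}" "sech_conv a f"] continuous_on_sech_conv[OF f] by auto
  have "0 < t * sech_conv a f 1" "0 < t * sech_conv a f x1" using t x1 by auto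
  then have "0 < s * sech_conv a f 1" using x1(2) by (auto simp: zero_less_mult_iff)
  then have 1: "0 < s * (l * f 1)" using fl[of 1] by simp
  \<comment> \<open>At 1 the sign pattern gives s f(1) >= 0, the far field gives s l f(1) > 0, and
    together they force l > 0.\<close>
  have "0 < (\<Prod>y\<in>Z. 1 - y)" by (intro prod_pos) (auto simp: Z_def)
  moreover have "0 \<le> s * f 1 * (\<Prod>y\<in>Z. 1 - y)" using sZ by (auto simp: sign_pattern_def)
  ultimately have sf: "0 \<le> s * f 1" by (simp add: zero_le_mult_iff)
  have "0 < (s * f 1) * l" using 1 by (simp only: mult_ac)
  then have "l > 0" using sf unfolding zero_less_mult_iff[of "s * f 1" l] by linarith
  then show thesis using that[of Z s] ZY(2) sZ f1 fm1 Z_def by blast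
qed

lemma sech_conv_lincomb:
  assumes "continuous_on {-1..1} f" "continuous_on {-1..1} g"
  shows "sech_conv a (\<lambda>x. u * f x + v * g x) x = u * sech_conv a f x + v * sech_conv a g x"
proof -
  have "sech_conv a (\<lambda>x. u * f x + v * g x) x =
      integral {-1..1} (\<lambda>y. u * (f y * sech (a * (x - y))) + v * (g y * sech (a * (x - y))))"
    unfolding sech_conv_def by (intro integral_cong) (simp add: algebra_simps)
  then show ?thesis
    unfolding sech_conv_def
    by (simp only: integral_add integrable_on_mult_right integrable_sech_conv assms integral_mult_right)
qed

text \<open>An eigenfunction that vanishes at 1 is zero. Subtracting from g the multiple of f with
  the same value at 1 produces such a function.\<close>

lemma eigenfun_simple:
  assumes a: "a > 0" and f: "eigenfun a l f" and g: "eigenfun a l g" and f0: "x0 \<in> {-1..1}" "f x0 \<noteq> 0"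
  shows "f 1 \<noteq> 0 \<and> (\<forall>x\<in>{-1..1}. g x = g 1 / f 1 * f x)"
proof -
  have f1: "f 1 \<noteq> 0" using eigenfun_nodal[OF a f f0] by metis
  define h where "h x = 1 * g x + (- (g 1 / f 1)) * f x" for x
  have c: "continuous_on {-1..1} f" "continuous_on {-1..1} g" using f g by (auto simp: eigenfun_def)
  have "sech_conv a h x = l * h x" if "x \<in> {-1..1}" for x
    using f g that unfolding h_def[abs_def] sech_conv_lincomb[OF c(2,1)]
    by (simp add: eigenfun_def algebra_simps)
  moreover have "continuous_on {-1..1} h" unfolding h_def by (intro continuous_intros c)
  ultimately have h: "eigenfun a l h" using f by (auto simp: eigenfun_def)
  have "h 1 = 0" using f1 by (simp add: h_def)
  then have h0: "h x = 0" if "x \<in> {-1..1}" for x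
    using eigenfun_nodal[OF a h that] by metis
  have "g x = g 1 / f 1 * f x" if "x \<in> {-1..1}" for x
    using h0[OF that] unfolding h_def by linarith
  then show ?thesis using f1 by blast
qed

section \<open>The largest eigenvalue on an orthogonal complement\<close>

definition ip :: "(real \<Rightarrow> real) \<Rightarrow> (real \<Rightarrow> real) \<Rightarrow> real"
  where "ip f g = integral {-1..1} (\<lambda>x. f x * g x)"

text \<open>Continuous functions on [-1, 1], with no differentiability implied. The convolution maps
  into this space, so an incomplete inner product space suffices and limits are taken
  uniformly.\<close>

abbreviation C11 :: "(real \<Rightarrow> real) set"
  where "C11 \<equiv> {f. continuous_on {-1..1} f}"

lemma ip_commute: "ip f g = ip g f"
  by (simp add: ip_def mult.commute)

lemma ip_cong: "(\<And>x. x \<in> {-1..1} \<Longrightarrow> f x = f' x) \<Longrightarrow> ip f g = ip f' g"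
  unfolding ip_def by (intro integral_cong) simp

lemma ip_integrable: "f \<in> C11 \<Longrightarrow> g \<in> C11 \<Longrightarrow> (\<lambda>x. f x * g x) integrable_on {-1..1}"
  by (intro integrable_continuous_real continuous_on_mult) simp_all

lemma ip_lincomb:
  assumes "f \<in> C11" "g \<in> C11" "h \<in> C11"
  shows "ip (\<lambda>x. u * f x + v * g x) h = u * ip f h + v * ip g h"
proof -
  have "ip (\<lambda>x. u * f x + v * g x) h = integral {-1..1} (\<lambda>x. u * (f x * h x) + v * (g x * h x))"
    unfolding ip_def by (intro integral_cong) (simp add: algebra_simps)
  then show ?thesis
    unfolding ip_def using assms
    by (simp only: integral_add integrable_on_mult_right ip_integrable integral_mult_right)
qed

lemma ip_lincomb2:
  assumes "f \<in> C11" "g \<in> C11" "h \<in> C11"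
  shows "ip h (\<lambda>x. u * f x + v * g x) = u * ip h f + v * ip h g"
  using ip_lincomb[OF assms] by (simp add: ip_commute)

lemma C11_lincomb: "f \<in> C11 \<Longrightarrow> g \<in> C11 \<Longrightarrow> (\<lambda>x. u * f x + v * g x) \<in> C11"
  by (auto intro!: continuous_intros)

lemma C11_sech_conv: "f \<in> C11 \<Longrightarrow> sech_conv a f \<in> C11"
  using continuous_on_sech_conv by auto

lemma ip_nonneg: "f \<in> C11 \<Longrightarrow> 0 \<le> ip f f"
  unfolding ip_def by (intro integral_nonneg ip_integrable) auto

lemma ip_eq_0:
  assumes "f \<in> C11" "ip f f = 0" "x \<in> {-1..1}"
  shows "f x = 0"
proof -
  have c: "continuous_on {-1..1} (\<lambda>x. f x * f x)"
    using assms(1) by (intro continuous_on_mult) simp_all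
  have "\<forall>x\<in>{-1..1}. f x * f x = 0"
    by (rule iffD1[OF integral_eq_0_iff[OF c]]) (use assms(2) in \<open>simp_all add: ip_def\<close>)
  then show ?thesis using assms(3) by simp
qed

lemma ip_Cauchy_Schwarz:
  assumes f: "f \<in> C11" and g: "g \<in> C11"
  shows "(ip f g)\<^sup>2 \<le> ip f f * ip g g"
proof -
  have *: "0 \<le> u * (u * ip f f + v * ip f g) + v * (u * ip f g + v * ip g g)" for u v
    using ip_nonneg[OF C11_lincomb[OF f g, of u v]]
    by (simp only: ip_lincomb ip_lincomb2 C11_lincomb f g ip_commute[of g f])
  show ?thesis
  proof (cases "ip g g = 0")
    case True
    then have g0: "g x = 0" if "x \<in> {-1..1}" for x using ip_eq_0[OF g _ that] by simp
    have "ip f g = integral {-1..1} (\<lambda>x::real. 0)" using integral_cong[of "{-1..1}" "\<lambda>x. f x * g x" "\<lambda>x. 0"] g0 by (simp add: ip_def)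
    then show ?thesis using True by simp
  next
    case False
    then have "0 < ip g g" using ip_nonneg[OF g] by simp
    moreover have "0 \<le> ip g g * (ip f f * ip g g - (ip f g)\<^sup>2)"
      using *[of "ip g g" "- ip f g"] by (simp add: ip_commute power2_eq_square algebra_simps)
    ultimately show ?thesis by (simp add: zero_le_mult_iff)
  qed
qed

section \<open>Symmetry, boundedness and equicontinuity of the convolution\<close>

lemma sech_conv_cong:
  "(\<And>x. x \<in> {-1..1} \<Longrightarrow> f x = f' x) \<Longrightarrow> sech_conv a f = sech_conv a f'"
  unfolding sech_conv_def by (intro ext integral_cong) simp

lemma sech_conv_symmetric:
  assumes f: "f \<in> C11" and g: "g \<in> C11"
  shows "ip (sech_conv a f) g = ip f (sech_conv a g)"
proof -
  let ?k = "\<lambda>x y. f y * sech (a * (x - y)) * g x"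
  have c1: "continuous_on (cbox (-1, -1) (1, 1)) (\<lambda>p::real \<times> real. fst p)"
    "continuous_on (cbox (-1, -1) (1, 1)) (\<lambda>p::real \<times> real. snd p)" by (intro continuous_intros)+
  have c2: "continuous_on (cbox (-1, -1) (1, 1)) (\<lambda>p::real \<times> real. f (snd p))"
    using f by (intro continuous_on_compose2[OF _ c1(2), of "{-1..1}"]) (auto simp: mem_box)
  have c3: "continuous_on (cbox (-1, -1) (1, 1)) (\<lambda>p::real \<times> real. g (fst p))"
    using g by (intro continuous_on_compose2[OF _ c1(1), of "{-1..1}"]) (auto simp: mem_box)
  have "continuous_on (cbox (-1, -1) (1, 1)) (\<lambda>(x, y). ?k x y)"
    unfolding case_prod_unfold by (intro continuous_on_mult c2 c3 continuous_intros)
  from integral_swap_continuous[OF this]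
  have *: "integral {-1..1} (\<lambda>x. integral {-1..1} (\<lambda>y. ?k x y)) = integral {-1..1} (\<lambda>y. integral {-1..1} (\<lambda>x. ?k x y))"
    by (simp only: box_real)
  have "ip (sech_conv a f) g = integral {-1..1} (\<lambda>x. integral {-1..1} (\<lambda>y. ?k x y))"
    unfolding ip_def sech_conv_def by (simp only: integral_mult_left)
  also have "\<dots> = integral {-1..1} (\<lambda>y. integral {-1..1} (\<lambda>x. ?k x y))" by (rule *)
  also have "\<dots> = ip f (sech_conv a g)"
    unfolding ip_def
  proof (intro integral_cong)
    fix y
    have "integral {-1..1} (\<lambda>x. ?k x y) = integral {-1..1} (\<lambda>x. f y * (g x * sech (a * (y - x))))"
    proof (intro integral_cong)
      fix x
      have "sech (a * (x - y)) = sech (a * (y - x))"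
        using cosh_minus[of "a * (y - x)"] by (simp add: sech_def minus_mult_right)
      then show "?k x y = f y * (g x * sech (a * (y - x)))" by simp
    qed
    then show "integral {-1..1} (\<lambda>x. ?k x y) = f y * sech_conv a g y"
      unfolding sech_conv_def by (simp only: integral_mult_right)
  qed
  finally show ?thesis .
qed

lemma ip_le_sup:
  assumes f: "f \<in> C11" and b: "\<And>x. x \<in> {-1..1} \<Longrightarrow> \<bar>f x\<bar> \<le> B"
  shows "ip f f \<le> 2 * B\<^sup>2"
proof -
  have B: "f x * f x \<le> B\<^sup>2" if "x \<in> {-1..1}" for x
    using power_mono[OF b[OF that], of 2] by (simp add: power2_eq_square)
  have c: "(\<lambda>x::real. B\<^sup>2) integrable_on {-1..1}" by (intro integrable_continuous_real continuous_intros)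
  have "ip f f \<le> integral {-1..1} (\<lambda>x::real. B\<^sup>2)"
    unfolding ip_def by (rule integral_le[OF ip_integrable[OF f f] c B])
  then show ?thesis by simp
qed

lemma sech_conv_le:
  assumes f: "f \<in> C11"
  shows "(sech_conv a f x)\<^sup>2 \<le> 2 * ip f f"
proof -
  let ?k = "\<lambda>y. sech (a * (x - y))"
  have k: "?k \<in> C11" by (auto intro!: continuous_intros)
  have "ip ?k ?k \<le> 2 * 1\<^sup>2"
    by (rule ip_le_sup[OF k]) (simp add: abs_of_pos sech_pos sech_le_1)
  moreover have "sech_conv a f x = ip f ?k" by (simp add: sech_conv_def ip_def)
  ultimately have "(sech_conv a f x)\<^sup>2 \<le> ip f f * ip ?k ?k" "ip f f * ip ?k ?k \<le> ip f f * 2"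
    using ip_Cauchy_Schwarz[OF f k] ip_nonneg[OF f] by (auto intro: mult_left_mono)
  then show ?thesis by linarith
qed

lemma sech_conv_ip_le:
  assumes f: "f \<in> C11"
  shows "ip (sech_conv a f) (sech_conv a f) \<le> 4 * ip f f"
proof -
  have "\<bar>sech_conv a f x\<bar> \<le> sqrt (2 * ip f f)" for x
    using sech_conv_le[OF f, of a x] real_le_rsqrt real_sqrt_abs real_sqrt_le_iff by metis
  from ip_le_sup[OF C11_sech_conv[OF f] this] show ?thesis using ip_nonneg[OF f] by simp
qed

text \<open>A Lipschitz bound depending only on the L2 norm of \<open>f\<close>; it supplies the
  equicontinuity for the selection of a uniformly convergent subsequence.\<close>

lemma sech_conv_lipschitz:
  assumes a: "a > 0" and f: "f \<in> C11"
  shows "(sech_conv a f x - sech_conv a f x')\<^sup>2 \<le> ip f f * (2 * (a * \<bar>x - x'\<bar>)\<^sup>2)"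
proof -
  let ?k = "\<lambda>y. 1 * sech (a * (x - y)) + (-1) * sech (a * (x' - y))"
  have d: "\<bar>sech' a z\<bar> \<le> a" for z
  proof -
    have "\<bar>sinh (a * z)\<bar> \<le> cosh (a * z)"
      by (simp add: abs_le_iff sinh_field_def cosh_field_def field_simps)
    also have "\<dots> \<le> cosh (a * z) * cosh (a * z)" using cosh_real_ge_1[of "a * z"] by simp
    finally have "\<bar>sinh (a * z)\<bar> / (cosh (a * z))\<^sup>2 \<le> 1"
      by (simp add: power2_eq_square)
    then have "a * (\<bar>sinh (a * z)\<bar> / (cosh (a * z))\<^sup>2) \<le> a * 1" using a by (intro mult_left_mono) auto
    then show ?thesis using a by (simp add: sech'_def abs_mult)
  qed
  have lip: "\<bar>sech (a * u) - sech (a * v)\<bar> \<le> a * \<bar>u - v\<bar>" for u v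
    using field_differentiable_bound[of UNIV "\<lambda>z. sech (a * z)" "sech' a" a u v] d DERIV_sech by simp
  have k: "?k \<in> C11" by (auto intro!: continuous_intros)
  have "ip ?k ?k \<le> 2 * (a * \<bar>x - x'\<bar>)\<^sup>2"
  proof (rule ip_le_sup[OF k])
    fix y
    show "\<bar>1 * sech (a * (x - y)) + - 1 * sech (a * (x' - y))\<bar> \<le> a * \<bar>x - x'\<bar>"
      using lip[of "x - y" "x' - y"] by simp
  qed
  moreover have "sech_conv a f x - sech_conv a f x' = ip f ?k"
  proof -
    have "ip f ?k = 1 * ip f (\<lambda>y. sech (a * (x - y))) + (-1) * ip f (\<lambda>y. sech (a * (x' - y)))"
      by (intro ip_lincomb2 f) (auto intro!: continuous_intros)
    then show ?thesis by (simp add: sech_conv_def ip_def)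
  qed
  ultimately show ?thesis
    using order_trans[OF ip_Cauchy_Schwarz[OF f k] mult_left_mono[OF _ ip_nonneg[OF f]]] by (simp only:)
qed

text \<open>The supremum of the quotient of the squared norms of S f and f is attained in the limit
  of a maximizing sequence, by compactness. The limit satisfies S^2 psi = M psi, from which an
  eigenfunction for N = sqrt M is extracted.\<close>

lemma sech_conv_top_eigenfun:
  assumes a: "a > 0" and G: "\<And>g. g \<in> G \<Longrightarrow> \<exists>l. eigenfun a l g"
  defines "X \<equiv> {f. f \<in> C11 \<and> (\<forall>g\<in>G. ip f g = 0)}"
  obtains N where "N \<ge> 0" "\<And>f. f \<in> X \<Longrightarrow> ip (sech_conv a f) (sech_conv a f) \<le> N\<^sup>2 * ip f f"
    "N > 0 \<Longrightarrow> \<exists>p x. p \<in> X \<and> x \<in> {-1..1} \<and> p x \<noteq> 0 \<and> eigenfun a N p"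
proof -
  let ?S = "sech_conv a"
  have XC: "f \<in> C11" if "f \<in> X" for f using that by (simp add: X_def)
  have GC: "g \<in> C11" if "g \<in> G" for g using G[OF that] by (auto simp: eigenfun_def)
  have SX: "?S f \<in> X" if f: "f \<in> X" for f
  proof -
    have "ip (?S f) g = 0" if g: "g \<in> G" for g
    proof -
      obtain l where l: "eigenfun a l g" using G[OF g] by blast
      have "ip (?S f) g = ip (?S g) f"
        using sech_conv_symmetric[OF XC[OF f] GC[OF g]] by (simp add: ip_commute)
      also have "\<dots> = ip (\<lambda>x. l * g x + 0 * g x) f" using l by (intro ip_cong) (simp add: eigenfun_def)
      also have "\<dots> = l * ip f g" by (subst ip_lincomb) (use XC[OF f] GC[OF g] in \<open>simp_all add: ip_commute\<close>)
      finally show ?thesis using f g by (simp add: X_def)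
    qed
    then show ?thesis using C11_sech_conv[OF XC[OF f]] by (simp add: X_def)
  qed
  have Xlin: "(\<lambda>x. u * f x + v * h x) \<in> X" if "f \<in> X" "h \<in> X" for u v f h
  proof -
    have "ip (\<lambda>x. u * f x + v * h x) g = 0" if g: "g \<in> G" for g
      using ip_lincomb[OF XC[OF \<open>f \<in> X\<close>] XC[OF \<open>h \<in> X\<close>] GC[OF g]] that \<open>f \<in> X\<close> \<open>h \<in> X\<close> by (simp add: X_def)
    then show ?thesis using C11_lincomb[OF XC[OF \<open>f \<in> X\<close>] XC[OF \<open>h \<in> X\<close>]] by (simp add: X_def)
  qed
  \<comment> \<open>The inserted 0 gives the supremum a meaning when the orthogonal complement
    contains no unit vector.\<close>
  define V where "V = insert 0 {ip (?S f) (?S f) | f. f \<in> X \<and> ip f f = 1}"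
  have Vb: "v \<le> 4" if "v \<in> V" for v
  proof -
    have "v = 0 \<or> (\<exists>f. v = ip (?S f) (?S f) \<and> f \<in> X \<and> ip f f = 1)" using that by (auto simp: V_def)
    then show ?thesis using sech_conv_ip_le[OF XC, of _ a] by fastforce
  qed
  then have bdd: "bdd_above V" by (auto simp: bdd_above_def)
  define M where "M = Sup V"
  have M0: "0 \<le> M" unfolding M_def by (intro cSup_upper bdd) (simp add: V_def)
  have MX: "ip (?S f) (?S f) \<le> M * ip f f" if f: "f \<in> X" for f
  proof (cases "ip f f = 0")
    case True
    then show ?thesis using sech_conv_ip_le[OF XC[OF f], of a] by simp
  next
    case False
    then have p: "0 < ip f f" using ip_nonneg[OF XC[OF f]] by simp
    define u where "u = 1 / sqrt (ip f f)"
    have u2: "u * u = 1 / ip f f" using p by (simp add: u_def)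
    \<comment> \<open>The summand with coefficient 0 gives the scaled function the shape of the
      lemmas on two-term combinations.\<close>
    let ?f = "\<lambda>x. u * f x + 0 * f x"
    have fC: "f \<in> C11" using XC[OF f] .
    have 1: "ip ?f ?f = 1"
    proof -
      have "ip ?f ?f = (u * u) * ip f f"
        by (simp only: ip_lincomb ip_lincomb2 C11_lincomb fC) simp
      then show ?thesis using u2 p by simp
    qed
    have 2: "ip (?S ?f) (?S ?f) = (u * u) * ip (?S f) (?S f)"
    proof -
      have "?S ?f = (\<lambda>x. u * ?S f x + 0 * ?S f x)"
        using fC by (intro ext sech_conv_lincomb) simp_all
      then show ?thesis
        by (simp only: ip_lincomb ip_lincomb2 C11_lincomb C11_sech_conv fC) simp
    qed
    have "ip (?S ?f) (?S ?f) \<in> V" unfolding V_def using Xlin[OF f f, of u 0] 1 by blast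
    then have "ip (?S ?f) (?S ?f) \<le> M" unfolding M_def by (intro cSup_upper bdd)
    then show ?thesis using p unfolding 2 u2 by (simp add: field_simps)
  qed
  have case0: "\<exists>p x. p \<in> X \<and> x \<in> {-1..1} \<and> p x \<noteq> 0 \<and> eigenfun a (sqrt M) p" if M: "M > 0"
  proof -
    have "\<exists>f. f \<in> X \<and> ip f f = 1 \<and> M - M / real (Suc n) \<le> ip (?S f) (?S f)" for n
    proof -
      show ?thesis
      \<comment> \<open>For n = 0 the bound is 0 and any unit vector will do. For larger n the bound
        is positive, so the near-maximal value is not the inserted 0.\<close>
      proof (cases "n = 0")
        case True
        have "\<exists>v\<in>V. 0 < v" using less_cSupD[of V 0] M by (auto simp: M_def V_def)
        then show ?thesis using True M by (auto simp: V_def)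
      next
        case False
        then have "0 < M - M / real (Suc n)" using M by (simp add: field_simps)
        moreover have "\<exists>v\<in>V. M - M / real (Suc n) < v"
          unfolding M_def by (rule less_cSupD) (use M in \<open>auto simp: V_def M_def\<close>)
        ultimately show ?thesis by (force simp: V_def)
      qed
    qed
    then obtain F where F: "\<And>n. F n \<in> X" "\<And>n. ip (F n) (F n) = 1"
      "\<And>n. M - M / real (Suc n) \<le> ip (?S (F n)) (?S (F n))" by metis
    have FC: "F n \<in> C11" for n using XC[OF F(1)] .
    have FS: "?S (F n) \<in> C11" for n using C11_sech_conv[OF FC] .
    obtain psi r where psi: "continuous_on {-1..1} psi" and r: "strict_mono (r :: nat \<Rightarrow> nat)"
      and lim: "\<And>e. 0 < e \<Longrightarrow> \<exists>N. \<forall>n x. n \<ge> N \<and> x \<in> {-1..1} \<longrightarrow> norm (?S (F (r n)) x - psi x) < e"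
    proof (rule Arzela_Ascoli[of "{-1..1::real}" "\<lambda>n. ?S (F n)" "sqrt 2"])
      show "norm (?S (F n) x) \<le> sqrt 2" for n x
        using sech_conv_le[OF FC, of a n x] F(2)[of n] real_le_rsqrt[of "\<bar>?S (F n) x\<bar>" 2] by simp
      fix x e :: real assume e: "0 < e"
      show "\<exists>d>0. \<forall>n y. y \<in> {-1..1} \<and> norm (x - y) < d \<longrightarrow> norm (?S (F n) x - ?S (F n) y) < e"
      proof (intro exI[of _ "e / (2 * a)"] conjI allI impI)
        fix n y assume y: "y \<in> {-1..1} \<and> norm (x - y) < e / (2 * a)"
        then have "a * \<bar>x - y\<bar> < e / 2" using a by (simp add: field_simps)
        then have "(a * \<bar>x - y\<bar>)\<^sup>2 \<le> (e / 2)\<^sup>2" using a by (intro power_mono) auto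
        then have "(?S (F n) x - ?S (F n) y)\<^sup>2 \<le> 2 * (e / 2)\<^sup>2"
          using sech_conv_lipschitz[OF a FC, of n x y] by (simp add: F(2))
        also have "\<dots> < e\<^sup>2" using e by (simp add: power2_eq_square)
        finally have "\<bar>?S (F n) x - ?S (F n) y\<bar>\<^sup>2 < e\<^sup>2" by simp
        then have "\<bar>?S (F n) x - ?S (F n) y\<bar> < e" by (rule power2_less_imp_less) (use e in simp)
        then show "norm (?S (F n) x - ?S (F n) y) < e" using e by simp
      qed (use a e in simp)
    qed auto
    have psiC: "psi \<in> C11" using psi by simp
    define H where "H n = (\<lambda>x. 1 * ?S (F (r n)) x + (-1) * psi x)" for n
    have HC: "H n \<in> C11" for n unfolding H_def by (intro C11_lincomb FS psiC)
    have d0: "(\<lambda>n. ip (H n) (H n)) \<longlonglongrightarrow> 0"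
    proof (rule LIMSEQ_I)
      fix e :: real assume e: "0 < e"
      obtain N where N: "\<And>n x. n \<ge> N \<Longrightarrow> x \<in> {-1..1} \<Longrightarrow> \<bar>H n x\<bar> < sqrt (e / 4)"
        using lim[of "sqrt (e / 4)"] e by (auto simp: H_def)
      have "norm (ip (H n) (H n) - 0) < e" if "n \<ge> N" for n
      proof -
        have "ip (H n) (H n) \<le> 2 * (sqrt (e / 4))\<^sup>2"
          by (rule ip_le_sup[OF HC]) (use N[OF that] less_imp_le in blast)
        then show ?thesis using e ip_nonneg[OF HC, of n] by simp
      qed
      then show "\<exists>no. \<forall>n\<ge>no. norm (ip (H n) (H n) - 0) < e" by blast
    qed
    \<comment> \<open>The residual of S^2 F = M F. Expanding its square and using the maximality of
      M on S F bounds it by M (M - |S F|^2), which tends to 0.\<close>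
    define u where "u n = (\<lambda>x. 1 * ?S (?S (F (r n))) x + (- M) * F (r n) x)" for n
    have uC: "u n \<in> C11" for n unfolding u_def by (intro C11_lincomb C11_sech_conv FC)
    have un: "ip (u n) (u n) \<le> M * (M / real (Suc (r n)))" for n
    proof -
      let ?f = "F (r n)"
      have "ip (?S (?S ?f)) ?f = ip (?S ?f) (?S ?f)" using sech_conv_symmetric[OF FS FC] .
      then have "ip (u n) (u n) = ip (?S (?S ?f)) (?S (?S ?f)) - 2 * M * ip (?S ?f) (?S ?f) + M * M"
        unfolding u_def
        by (simp only: ip_lincomb ip_lincomb2 C11_lincomb C11_sech_conv FC)
          (simp add: F(2) ip_commute[of ?f] algebra_simps)
      also have "\<dots> \<le> M * ip (?S ?f) (?S ?f) - 2 * M * ip (?S ?f) (?S ?f) + M * M"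
        using MX[OF SX[OF F(1)], of "r n"] by simp
      also have "\<dots> = M * (M - ip (?S ?f) (?S ?f))" by (simp add: algebra_simps)
      also have "\<dots> \<le> M * (M / real (Suc (r n)))" using F(3)[of "r n"] M0 by (intro mult_left_mono) auto
      finally show ?thesis .
    qed
    have r_ge: "n \<le> r n" for n using seq_suble[OF r] .
    have u0: "(\<lambda>n. ip (u n) (u n)) \<longlonglongrightarrow> 0"
    proof (rule tendsto_sandwich[of "\<lambda>_. 0" _ _ "\<lambda>n. M * M * inverse (real (Suc n))"])
      show "eventually (\<lambda>n. ip (u n) (u n) \<le> M * M * inverse (real (Suc n))) sequentially"
      proof (intro always_eventually allI)
        fix n
        have "M * (M / real (Suc (r n))) \<le> M * (M / real (Suc n))"
          using M r_ge[of n] by (intro mult_left_mono divide_left_mono) auto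
        then show "ip (u n) (u n) \<le> M * M * inverse (real (Suc n))" using un[of n] by (simp add: divide_inverse)
      qed
      show "(\<lambda>n. M * M * inverse (real (Suc n))) \<longlonglongrightarrow> 0"
        using tendsto_mult_left[OF LIMSEQ_inverse_real_of_nat, of "M * M"] by simp
    qed (use ip_nonneg[OF uC] in auto)
    have eig: "?S (?S psi) x = M * psi x" if x: "x \<in> {-1..1}" for x
    proof -
      have *: "?S (u n) x = ?S (?S (?S (F (r n)))) x - M * ?S (F (r n)) x" for n
        unfolding u_def using C11_sech_conv[OF FS, of a] FC by (subst sech_conv_lincomb) auto
      have SH: "?S (H n) = (\<lambda>x. 1 * ?S (?S (F (r n))) x + (-1) * ?S psi x)" for n
        unfolding H_def using FS psi by (intro ext sech_conv_lincomb) auto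
      have **: "?S (?S (H n)) x = ?S (?S (?S (F (r n)))) x - ?S (?S psi) x" for n
        unfolding SH using C11_sech_conv[OF FS, of a] C11_sech_conv[OF psiC, of a] by (subst sech_conv_lincomb) auto
      \<comment> \<open>Only S F converges, not F itself. Hence the residual is used after one more
        application of S, where every term is controlled by \<open>u\<close> and
        \<open>H\<close>.\<close>
      have e: "?S (?S psi) x - M * psi x = ?S (u n) x - ?S (?S (H n)) x + M * H n x" for n
        unfolding * ** by (simp add: H_def algebra_simps)
      \<comment> \<open>The factor 8 serves both uses: 2 for one application of S and 2 * 4 for
        two.\<close>
      have z: "(\<lambda>n. s n) \<longlonglongrightarrow> 0" if "\<And>n. (s n)\<^sup>2 \<le> 8 * t n" "t \<longlonglongrightarrow> 0" for s t :: "nat \<Rightarrow> real"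
      proof -
        have "(\<lambda>n. (s n)\<^sup>2) \<longlonglongrightarrow> 0"
          by (rule tendsto_sandwich[of "\<lambda>_. 0" _ _ "\<lambda>n. 8 * t n"])
            (use that(1) tendsto_mult_left[OF that(2), of 8] in auto)
        then have "(\<lambda>n. sqrt ((s n)\<^sup>2)) \<longlonglongrightarrow> 0" using tendsto_real_sqrt by fastforce
        then show ?thesis by (simp add: tendsto_rabs_zero_iff)
      qed
      have 1: "(\<lambda>n. ?S (u n) x) \<longlonglongrightarrow> 0"
      proof (rule z[OF _ u0])
        show "(?S (u n) x)\<^sup>2 \<le> 8 * ip (u n) (u n)" for n
          using sech_conv_le[OF uC, of a n x] ip_nonneg[OF uC, of n] by linarith
      qed
      have 2: "(\<lambda>n. ?S (?S (H n)) x) \<longlonglongrightarrow> 0"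
      proof (rule z[OF _ d0])
        show "(?S (?S (H n)) x)\<^sup>2 \<le> 8 * ip (H n) (H n)" for n
          using sech_conv_le[OF C11_sech_conv[OF HC, of a], of a n x] sech_conv_ip_le[OF HC, of a n] by linarith
      qed
      have 3: "(\<lambda>n. H n x) \<longlonglongrightarrow> 0"
      proof (rule LIMSEQ_I)
        fix e :: real assume "0 < e"
        then show "\<exists>no. \<forall>n\<ge>no. norm (H n x - 0) < e" using lim[of e] x by (auto simp: H_def)
      qed
      have "(\<lambda>n. ?S (u n) x - ?S (?S (H n)) x + M * H n x) \<longlonglongrightarrow> 0 - 0 + M * 0"
        by (intro tendsto_intros 1 2 3)
      then have "(\<lambda>n::nat. ?S (?S psi) x - M * psi x) \<longlonglongrightarrow> 0" unfolding e[symmetric] by simp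
      from LIMSEQ_unique[OF this tendsto_const] show ?thesis by simp
    qed
    have psiX: "psi \<in> X"
    proof -
      have "ip psi g = 0" if g: "g \<in> G" for g
      proof -
        have "ip (H n) g = - ip psi g" for n
          unfolding H_def using SX[OF F(1), of "r n"] g
          by (subst ip_lincomb) (use FS psiC GC[OF g] in \<open>auto simp: X_def\<close>)
        then have "(ip psi g)\<^sup>2 \<le> ip (H n) (H n) * ip g g" for n
          using ip_Cauchy_Schwarz[OF HC GC[OF g], of n] by simp
        moreover have "(\<lambda>n. ip (H n) (H n) * ip g g) \<longlonglongrightarrow> 0 * ip g g" by (intro tendsto_intros d0)
        ultimately have "(ip psi g)\<^sup>2 \<le> 0" by (intro LIMSEQ_le_const[of _ 0 "(ip psi g)\<^sup>2"]) auto
        then show ?thesis by simp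
      qed
      then show ?thesis using psiC by (simp add: X_def)
    qed
    \<comment> \<open>The squared norms of S F stay above M / 2 along the sequence, so their uniform
      limit is not zero.\<close>
    have "\<exists>x\<in>{-1..1}. psi x \<noteq> 0"
    proof (rule ccontr)
      assume "\<not> ?thesis"
      then have "ip (H n) (H n) = ip (?S (F (r n))) (?S (F (r n)))" for n
        unfolding ip_def H_def by (intro integral_cong) simp
      moreover have "M / 2 \<le> ip (?S (F (r n))) (?S (F (r n)))" if "n \<ge> 1" for n
      proof -
        have "M / real (Suc (r n)) \<le> M / 2" using M r_ge[of n] that by (intro divide_left_mono) auto
        then show ?thesis using F(3)[of "r n"] by linarith
      qed
      ultimately have "M / 2 \<le> 0" by (intro LIMSEQ_le_const[OF d0]) auto
      then show False using M by simp
    qed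
    then obtain x0 where x0: "x0 \<in> {-1..1}" "psi x0 \<noteq> 0" by blast
    define N where "N = sqrt M"
    have N: "N > 0" "N * N = M" using M by (simp_all add: N_def)
    \<comment> \<open>S - N annihilates this function because S^2 psi = N^2 psi. Were it zero, psi
      would be an eigenfunction for -N, contrary to the positivity of all eigenvalues.\<close>
    define p where "p = (\<lambda>x. 1 * ?S psi x + N * psi x)"
    have pX: "p \<in> X" unfolding p_def by (intro Xlin SX psiX)
    have Sp: "?S p x = N * p x" if "x \<in> {-1..1}" for x
    proof -
      have "?S p x = 1 * ?S (?S psi) x + N * ?S psi x"
        unfolding p_def using C11_sech_conv[OF psiC, of a] psi by (intro sech_conv_lincomb) auto
      then show ?thesis using eig[OF that] N(2) by (simp add: p_def algebra_simps)
    qed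
    have "\<exists>x\<in>{-1..1}. p x \<noteq> 0"
    proof (rule ccontr)
      assume "\<not> ?thesis"
      then have "eigenfun a (- N) psi" using psi N by (auto simp: eigenfun_def p_def add_eq_0_iff)
      from eigenfun_nodal[OF a this x0] have "- N > 0" by metis
      then show False using N by simp
    qed
    moreover have "eigenfun a N p" using Sp N XC[OF pX] by (auto simp: eigenfun_def)
    ultimately show ?thesis using pX unfolding N_def by blast
  qed
  show thesis
  proof (rule that[of "sqrt M"])
    show "ip (?S f) (?S f) \<le> (sqrt M)\<^sup>2 * ip f f" if "f \<in> X" for f
      using MX[OF that] M0 by simp
    show "\<exists>p x. p \<in> X \<and> x \<in> {-1..1} \<and> p x \<noteq> 0 \<and> eigenfun a (sqrt M) p" if "sqrt M > 0"
      using case0 that by simp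
  qed (use M0 in simp)
qed

section \<open>Counting zeros\<close>

text \<open>Gaussian elimination: a nonzero entry of the last equation serves as pivot and
  eliminates one unknown from the other equations.\<close>

lemma homogeneous_system_nontrivial:
  fixes A :: "nat \<Rightarrow> 'a \<Rightarrow> real"
  assumes "finite Z" "m < card Z"
  shows "\<exists>b. (\<exists>z\<in>Z. b z \<noteq> 0) \<and> (\<forall>i<m. (\<Sum>z\<in>Z. b z * A i z) = 0)"
  using assms
proof (induction m arbitrary: Z A)
  case 0
  then have "Z \<noteq> {}" by auto
  then show ?case by (intro exI[of _ "\<lambda>_. 1"]) auto
next
  case (Suc m)
  show ?case
  proof (cases "\<forall>z\<in>Z. A m z = 0")
    case True
    obtain b where "\<exists>z\<in>Z. b z \<noteq> 0" "\<forall>i<m. (\<Sum>z\<in>Z. b z * A i z) = 0"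
      using Suc.IH[of Z A] Suc.prems by auto
    then show ?thesis using True by (intro exI[of _ b]) (auto simp: less_Suc_eq)
  next
    case False
    then obtain z0 where z0: "z0 \<in> Z" "A m z0 \<noteq> 0" by blast
    define Z' where "Z' = Z - {z0}"
    have Z: "Z = insert z0 Z'" "z0 \<notin> Z'" "finite Z'" using z0 Suc.prems by (auto simp: Z'_def)
    have "m < card Z'" using Suc.prems Z by simp
    then obtain b where b: "\<exists>z\<in>Z'. b z \<noteq> 0"
      "\<And>i. i < m \<Longrightarrow> (\<Sum>z\<in>Z'. b z * (A i z - A i z0 * (A m z / A m z0))) = 0"
      using Suc.IH[of Z' "\<lambda>i z. A i z - A i z0 * (A m z / A m z0)"] Z by auto
    define s where "s = (\<Sum>z\<in>Z'. b z * A m z) / A m z0"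
    define b' where "b' z = (if z = z0 then - s else b z)" for z
    have b'Z: "(\<Sum>z\<in>Z. b' z * A i z) = - s * A i z0 + (\<Sum>z\<in>Z'. b z * A i z)" for i
    proof -
      have "(\<Sum>z\<in>Z'. b' z * A i z) = (\<Sum>z\<in>Z'. b z * A i z)"
        using Z by (intro sum.cong) (auto simp: b'_def)
      then show ?thesis using Z by (simp add: b'_def)
    qed
    have "(\<Sum>z\<in>Z. b' z * A i z) = 0" if "i < Suc m" for i
    proof (cases "i = m")
      case True
      then show ?thesis using z0 by (simp add: b'Z s_def)
    next
      case False
      have "(\<Sum>z\<in>Z'. b z * (A i z - A i z0 * (A m z / A m z0)))
          = (\<Sum>z\<in>Z'. b z * A i z - (A i z0 / A m z0) * (b z * A m z))"
        by (intro sum.cong refl) (simp add: algebra_simps)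
      also have "\<dots> = (\<Sum>z\<in>Z'. b z * A i z) - A i z0 * s"
        by (simp add: sum_subtractf s_def sum_distrib_left sum_divide_distrib)
      finally show ?thesis using b(2)[of i] False that by (simp add: b'Z mult.commute)
    qed
    moreover have "\<exists>z\<in>Z. b' z \<noteq> 0" using b(1) Z by (auto simp: b'_def)
    ultimately show ?thesis by blast
  qed
qed

lemma separation_exists:
  fixes Z :: "real set"
  assumes "finite Z" "Z \<subseteq> {-1<..<1}"
  obtains e where "e > 0" "\<And>z. z \<in> Z \<Longrightarrow> -1 < z - e \<and> z + e < 1"
    "\<And>z z'. z \<in> Z \<Longrightarrow> z' \<in> Z \<Longrightarrow> z \<noteq> z' \<Longrightarrow> 2 * e < \<bar>z - z'\<bar>"
proof -
  \<comment> \<open>The element 1 keeps the set nonempty when \<open>Z\<close> is empty. A third of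
    the minimum leaves strict room for both requirements.\<close>
  define D where "D = insert 1 ((\<lambda>z. 1 - z) ` Z \<union> (\<lambda>z. z + 1) ` Z \<union> (\<lambda>(z, z'). \<bar>z - z'\<bar>) ` {p \<in> Z \<times> Z. fst p \<noteq> snd p})"
  have fD: "finite D" "D \<noteq> {}" using assms(1) by (auto simp: D_def)
  define e where "e = Min D / 3"
  have "0 < d" if "d \<in> D" for d using that assms(2) by (auto simp: D_def)
  then have M: "Min D > 0" using fD by simp
  have le: "3 * e \<le> d" if "d \<in> D" for d using fD that by (simp add: e_def)
  show thesis
  proof (rule that[of e])
    show e: "e > 0" using M by (simp add: e_def)
    show "-1 < z - e \<and> z + e < 1" if "z \<in> Z" for z
      using le[of "1 - z"] le[of "z + 1"] that e by (auto simp: D_def)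
    show "2 * e < \<bar>z - z'\<bar>" if "z \<in> Z" "z' \<in> Z" "z \<noteq> z'" for z z'
      using le[of "\<bar>z - z'\<bar>"] that e by (fastforce simp: D_def image_iff)
  qed
qed

text \<open>For \<open>F\<close> itself only the sign changes are bounded, not the zeros, hence the
  guard n > 0. From the first iterate on, the sign changes lie at zeros already counted and bound
  the zeros of the next iterate.\<close>

lemma iterated_zeros:
  assumes a: "a > 0" and F: "continuous_on {-1..1} F" "x0 \<in> {-1..1}" "F x0 \<noteq> 0" and s: "sign_pattern s Y F"
  shows "continuous_on {-1..1} ((sech_conv a ^^ n) F) \<and>
    (n > 0 \<longrightarrow> finite {x. (sech_conv a ^^ n) F x = 0} \<and> card {x. (sech_conv a ^^ n) F x = 0} \<le> card Y)"
proof (induction n)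
  case 0
  then show ?case using F by simp
next
  case (Suc n)
  let ?f = "(sech_conv a ^^ n) F"
  have c: "continuous_on {-1..1} ?f" using Suc by simp
  have "\<exists>t W x1. sign_pattern t W ?f \<and> card W \<le> card Y \<and> x1 \<in> {-1..1} \<and> ?f x1 \<noteq> 0"
  proof (cases "n = 0")
    case True
    then show ?thesis using s F by auto
  next
    case False
    then have fin: "finite {x. ?f x = 0}" "card {x. ?f x = 0} \<le> card Y" using Suc by auto
    have "finite {x\<in>{-1<..<1}. ?f x = 0}" by (rule rev_finite_subset[OF fin(1)]) auto
    then obtain t W where W: "sign_pattern t W ?f" "W \<subseteq> {x\<in>{-1<..<1}. ?f x = 0}"
      using sign_pattern_exists[OF c] by blast
    have "card W \<le> card {x. ?f x = 0}" using W(2) by (intro card_mono fin) auto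
    moreover have "\<exists>x1\<in>{-1..1}. ?f x1 \<noteq> 0"
    proof (rule ccontr)
      assume "\<not> ?thesis"
      then have "{-1..1} \<subseteq> {x. ?f x = 0}" by auto
      from finite_subset[OF this fin(1)] show False by (simp add: infinite_Icc)
    qed
    ultimately show ?thesis using W fin by (meson order_trans)
  qed
  then obtain t W x1 where W: "sign_pattern t W ?f" "card W \<le> card Y" "x1 \<in> {-1..1}" "?f x1 \<noteq> 0" by blast
  from variation_diminishing[OF a c W(3,4,1)] W(2) continuous_on_sech_conv[OF c, of "{-1..1}" a]
  show ?case by simp
qed

lemma continuous_on_cut:
  fixes g :: "real \<Rightarrow> real"
  assumes "continuous_on {-1..1} g" "g z = 0"
  shows "continuous_on {-1..1} (\<lambda>x. if x \<le> z then 0 else g x)"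
proof (rule continuous_on_cases_le)
  show "continuous_on {t \<in> {-1..1}. z \<le> t} g"
    by (rule continuous_on_subset[OF assms(1)]) auto
qed (use assms(2) in \<open>simp_all add: continuous_on_const continuous_on_id\<close>)

lemma C11_sum: "finite Z \<Longrightarrow> (\<And>z. z \<in> Z \<Longrightarrow> h z \<in> C11) \<Longrightarrow> (\<lambda>x. \<Sum>z\<in>Z. b z * h z x) \<in> C11"
  by (auto intro!: continuous_intros)

lemma ip_sum:
  assumes "finite Z" "\<And>z. z \<in> Z \<Longrightarrow> h z \<in> C11" "f \<in> C11"
  shows "ip (\<lambda>x. \<Sum>z\<in>Z. b z * h z x) f = (\<Sum>z\<in>Z. b z * ip (h z) f)"
  using assms
proof (induction Z rule: finite_induct)
  case empty
  then show ?case by (simp add: ip_def)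
next
  case (insert z Z)
  have "ip (\<lambda>x. \<Sum>z\<in>insert z Z. b z * h z x) f = ip (\<lambda>x. b z * h z x + 1 * (\<Sum>z\<in>Z. b z * h z x)) f"
    using insert by simp
  also have "\<dots> = b z * ip (h z) f + 1 * ip (\<lambda>x. \<Sum>z\<in>Z. b z * h z x) f"
    by (intro ip_lincomb C11_sum insert) (use insert in auto)
  finally show ?case using insert by simp
qed

text \<open>Split F into its component along \<open>g m\<close> and a remainder orthogonal to
  \<open>g 0\<close>, ..., \<open>g m\<close>. On that complement the norm N of the convolution is
  an eigenvalue or 0, hence below \<open>lam m\<close>, and the remainder decays like (N /
  \<open>lam m\<close>)^n.\<close>

lemma power_iteration:
  fixes m :: nat
  assumes a: "a > 0" and g: "\<And>i. i \<le> m \<Longrightarrow> eigenfun a (lam i) (g i)"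
    and orth: "\<And>i j. i \<le> m \<Longrightarrow> j \<le> m \<Longrightarrow> ip (g i) (g j) = (if i = j then 1 else 0)"
    and top: "\<And>N p x. eigenfun a N p \<Longrightarrow> x \<in> {-1..1} \<Longrightarrow> p x \<noteq> 0 \<Longrightarrow> (\<And>i. i \<le> m \<Longrightarrow> ip p (g i) = 0) \<Longrightarrow> N < lam m"
    and F: "F \<in> C11" "\<And>i. i < m \<Longrightarrow> ip F (g i) = 0"
    and x: "x \<in> {-1..1}"
  shows "(\<lambda>n. (sech_conv a ^^ n) F x / lam m ^ n) \<longlonglongrightarrow> ip F (g m) * g m x"
proof -
  let ?S = "sech_conv a" and ?c = "ip F (g m)" and ?l = "lam m"
  have gC: "g i \<in> C11" if "i \<le> m" for i using g[OF that] by (simp add: eigenfun_def)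
  have l0: "?l > 0"
  proof -
    have "\<exists>x\<in>{-1..1}. g m x \<noteq> 0"
    proof (rule ccontr)
      assume "\<not> ?thesis"
      then have "ip (g m) (g m) = ip (\<lambda>x. 0) (g m)" by (intro ip_cong) simp
      then show False using orth[OF order_refl order_refl] by (simp add: ip_def)
    qed
    then obtain x where "x \<in> {-1..1}" "g m x \<noteq> 0" by blast
    from eigenfun_nodal[OF a g[OF order_refl] this] show ?thesis by blast
  qed
  define f where "f = (\<lambda>x. 1 * F x + (- ?c) * g m x)"
  have fC: "f \<in> C11" unfolding f_def by (intro C11_lincomb F gC) simp
  have f0: "ip f (g i) = 0" if "i \<le> m" for i
  proof -
    have "ip f (g i) = 1 * ip F (g i) + (- ?c) * ip (g m) (g i)"
      unfolding f_def by (rule ip_lincomb[OF F(1) gC gC[OF that]]) simp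
    then show ?thesis using that F(2)[of i] orth[OF order_refl that] by (cases "i = m") auto
  qed
  obtain N where N: "N \<ge> 0" "\<And>h. h \<in> {h. h \<in> C11 \<and> (\<forall>g\<in>g ` {..m}. ip h g = 0)} \<Longrightarrow> ip (?S h) (?S h) \<le> N\<^sup>2 * ip h h"
    "N > 0 \<Longrightarrow> \<exists>p x. p \<in> {h. h \<in> C11 \<and> (\<forall>g\<in>g ` {..m}. ip h g = 0)} \<and> x \<in> {-1..1} \<and> p x \<noteq> 0 \<and> eigenfun a N p"
    using sech_conv_top_eigenfun[OF a, of "g ` {..m}"] g by blast
  have Nl: "N < ?l"
  proof (cases "N > 0")
    case True
    then obtain p x where "\<forall>i\<le>m. ip p (g i) = 0" "x \<in> {-1..1}" "p x \<noteq> 0" "eigenfun a N p" using N(3) by auto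
    then show ?thesis using top by blast
  next
    case False
    then show ?thesis using l0 by simp
  qed
  have Sf: "(?S ^^ n) f \<in> C11 \<and> (\<forall>i\<le>m. ip ((?S ^^ n) f) (g i) = 0) \<and> ip ((?S ^^ n) f) ((?S ^^ n) f) \<le> N ^ (2 * n) * ip f f" for n
  proof (induction n)
    case 0
    then show ?case using fC f0 by simp
  next
    case (Suc n)
    let ?h = "(?S ^^ n) f"
    have hC: "?h \<in> C11" using Suc by blast
    have "ip (?S ?h) (g i) = 0" if i: "i \<le> m" for i
    proof -
      have "ip (?S ?h) (g i) = ip (?S (g i)) ?h"
        using sech_conv_symmetric[OF hC gC[OF i]] by (simp add: ip_commute)
      also have "\<dots> = ip (\<lambda>x. lam i * g i x + 0 * g i x) ?h"
        using g[OF i] by (intro ip_cong) (simp add: eigenfun_def)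
      also have "\<dots> = lam i * ip ?h (g i) + 0 * ip ?h (g i)"
        by (simp only: ip_lincomb gC[OF i] hC ip_commute[of ?h])
      finally show ?thesis using Suc i by simp
    qed
    moreover have "ip (?S ?h) (?S ?h) \<le> N ^ (2 * Suc n) * ip f f"
    proof -
      have "ip (?S ?h) (?S ?h) \<le> N\<^sup>2 * ip ?h ?h" using Suc by (intro N(2)) auto
      also have "\<dots> \<le> N\<^sup>2 * (N ^ (2 * n) * ip f f)" using Suc by (intro mult_left_mono) auto
      finally show ?thesis by (simp add: power_add power2_eq_square mult_ac)
    qed
    ultimately show ?case using C11_sech_conv[OF hC] by simp
  qed
  have SF: "(?S ^^ n) F x = ?c * ?l ^ n * g m x + (?S ^^ n) f x" if "x \<in> {-1..1}" for n x
    using that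
  proof (induction n arbitrary: x)
    case 0
    then show ?case by (simp add: f_def)
  next
    case (Suc n)
    have "?S ((?S ^^ n) F) = ?S (\<lambda>x. (?c * ?l ^ n) * g m x + 1 * (?S ^^ n) f x)"
      by (rule sech_conv_cong) (simp add: Suc.IH)
    also have "\<dots> = (\<lambda>x. (?c * ?l ^ n) * ?S (g m) x + 1 * ?S ((?S ^^ n) f) x)"
      using gC[of m] Sf[of n] by (intro ext sech_conv_lincomb) auto
    finally show ?case using g[of m] Suc.prems by (simp add: eigenfun_def mult_ac)
  qed
  \<comment> \<open>The decay is known in the L2 norm only; one application of S is spent to convert
    it into a pointwise bound, hence the shift of the index.\<close>
  have lim: "(\<lambda>n. (?S ^^ Suc n) f x / ?l ^ Suc n) \<longlonglongrightarrow> 0"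
  proof -
    have "(\<lambda>n. ((?S ^^ Suc n) f x / ?l ^ Suc n)\<^sup>2) \<longlonglongrightarrow> 0"
    proof (rule tendsto_sandwich[of "\<lambda>_. 0" _ _ "\<lambda>n. (2 * ip f f / ?l\<^sup>2) * ((N / ?l)\<^sup>2) ^ n"])
      show "eventually (\<lambda>n. ((?S ^^ Suc n) f x / ?l ^ Suc n)\<^sup>2 \<le> (2 * ip f f / ?l\<^sup>2) * ((N / ?l)\<^sup>2) ^ n) sequentially"
      proof (intro always_eventually allI)
        fix n
        have "((?S ^^ Suc n) f x)\<^sup>2 \<le> 2 * (N ^ (2 * n) * ip f f)"
          using sech_conv_le[of "(?S ^^ n) f" a x] Sf[of n] by simp
        then have "((?S ^^ Suc n) f x)\<^sup>2 / (?l ^ Suc n)\<^sup>2 \<le> 2 * (N ^ (2 * n) * ip f f) / (?l ^ Suc n)\<^sup>2"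
          by (intro divide_right_mono) auto
        also have "\<dots> = (2 * ip f f / ?l\<^sup>2) * ((N / ?l)\<^sup>2) ^ n"
          by (simp add: power_divide power_mult_distrib field_simps flip: power_mult)
        finally show "((?S ^^ Suc n) f x / ?l ^ Suc n)\<^sup>2 \<le> (2 * ip f f / ?l\<^sup>2) * ((N / ?l)\<^sup>2) ^ n"
          by (simp only: power_divide)
      qed
      have "(N / ?l)\<^sup>2 < 1"
        using N(1) Nl l0 power_strict_mono[of "N / ?l" 1 2] by simp
      then have "(\<lambda>n. (2 * ip f f / ?l\<^sup>2) * ((N / ?l)\<^sup>2) ^ n) \<longlonglongrightarrow> (2 * ip f f / ?l\<^sup>2) * 0"
        by (intro tendsto_mult_left LIMSEQ_power_zero) simp
      then show "(\<lambda>n. (2 * ip f f / ?l\<^sup>2) * ((N / ?l)\<^sup>2) ^ n) \<longlonglongrightarrow> 0" by simp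
    qed auto
    then have "(\<lambda>n. sqrt (((?S ^^ Suc n) f x / ?l ^ Suc n)\<^sup>2)) \<longlonglongrightarrow> sqrt 0" by (rule tendsto_real_sqrt)
    then have "(\<lambda>n. \<bar>(?S ^^ Suc n) f x / ?l ^ Suc n\<bar>) \<longlonglongrightarrow> 0" by (simp only: real_sqrt_abs real_sqrt_zero)
    then show ?thesis by (rule tendsto_rabs_zero_cancel)
  qed
  have "(\<lambda>n. ?c * g m x + (?S ^^ Suc n) f x / ?l ^ Suc n) \<longlonglongrightarrow> ?c * g m x + 0"
    by (intro tendsto_add tendsto_const lim)
  moreover have "(?S ^^ Suc n) F x / ?l ^ Suc n = ?c * g m x + (?S ^^ Suc n) f x / ?l ^ Suc n" for n
    unfolding SF[OF x] using l0 by (simp add: add_divide_distrib)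
  ultimately have "(\<lambda>n. (?S ^^ Suc n) F x / ?l ^ Suc n) \<longlonglongrightarrow> ?c * g m x" by simp
  then show ?thesis by (subst (asm) filterlim_sequentially_Suc)
qed

text \<open>Pairing the factors gives (z - y)^2 - e^2 for each y, which is negative for y = z only.
  So the sign pattern changes sign at each of its points.\<close>

lemma prod_symmetric_points:
  assumes Z: "finite Z" "z \<in> Z" and e: "e > 0"
    and sep: "\<And>z'. z' \<in> Z \<Longrightarrow> z \<noteq> z' \<Longrightarrow> 2 * e < \<bar>z - z'\<bar>"
  shows "(\<Prod>y\<in>Z. z - e - y) * (\<Prod>y\<in>Z. z + e - y) < (0::real)"
proof -
  have "(\<Prod>y\<in>Z. z - e - y) * (\<Prod>y\<in>Z. z + e - y) = (\<Prod>y\<in>Z. (z - y)\<^sup>2 - e\<^sup>2)"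
    by (simp add: power2_eq_square algebra_simps flip: prod.distrib)
  also have "\<dots> = - e\<^sup>2 * (\<Prod>y\<in>Z - {z}. (z - y)\<^sup>2 - e\<^sup>2)"
    using Z by (simp add: prod.remove)
  also have "\<dots> < 0"
  proof -
    have "0 < (\<Prod>y\<in>Z - {z}. (z - y)\<^sup>2 - e\<^sup>2)"
    proof (intro prod_pos)
      fix y assume y: "y \<in> Z - {z}"
      then have "e < \<bar>z - y\<bar>" using sep[of y] e by auto
      then have "e\<^sup>2 < \<bar>z - y\<bar>\<^sup>2" using e by (intro power_strict_mono) auto
      then show "0 < (z - y)\<^sup>2 - e\<^sup>2" by simp
    qed
    then show ?thesis using e by (simp add: mult_neg_pos)
  qed
  finally show ?thesis .
qed

text \<open>All numbers strictly between 0 and -v qualify. The shift t later makes a step function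
  with values 0 and v change sign without vanishing.\<close>

lemma avoid_finite_between:
  fixes v :: real
  assumes "finite A" "v \<noteq> 0"
  obtains t where "t \<notin> A" "t * (v + t) < 0"
proof -
  define l r where "l = min 0 (- v)" and "r = max 0 (- v)"
  have "l < r" using assms(2) by (auto simp: l_def r_def)
  then have "infinite {l<..<r}" by (rule infinite_Ioo)
  then obtain t where t: "t \<in> {l<..<r}" "t \<notin> A" using assms(1) by (meson finite_subset subsetI)
  have "t * (v + t) < 0"
  proof (cases "v > 0")
    case True
    then have "t < 0" "0 < v + t" using t by (auto simp: l_def r_def)
    then show ?thesis by (rule mult_neg_pos)
  next
    case False
    then have "0 < t" "v + t < 0" using t by (auto simp: l_def r_def)
    then show ?thesis by (rule mult_pos_neg)
  qed
  then show thesis using that t by blast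
qed

text \<open>
  With more than \<open>m\<close> zeros, \<open>g\<^sub>m\<close> times a step function jumping at its zeros can be made orthogonal to
  \<open>g\<^sub>0, \<dots>, g\<^bsub>m-1\<^esub>\<close> with fewer sign changes than \<open>g\<^sub>m\<close>; but its normalized iterates
  converge to a nonzero multiple of \<open>g\<^sub>m\<close>.
\<close>

lemma card_zeros_le:
  fixes m :: nat
  assumes a: "a > 0" and g: "\<And>i. i \<le> m \<Longrightarrow> eigenfun a (lam i) (g i)"
    and orth: "\<And>i j. i \<le> m \<Longrightarrow> j \<le> m \<Longrightarrow> ip (g i) (g j) = (if i = j then 1 else 0)"
    and top: "\<And>N p x. eigenfun a N p \<Longrightarrow> x \<in> {-1..1} \<Longrightarrow> p x \<noteq> 0 \<Longrightarrow> (\<And>i. i \<le> m \<Longrightarrow> ip p (g i) = 0) \<Longrightarrow> N < lam m"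
  shows "finite {x\<in>{-1<..<1}. g m x = 0} \<and> card {x\<in>{-1<..<1}. g m x = 0} \<le> m"
proof -
  let ?g = "g m" and ?S = "sech_conv a"
  have gC: "g i \<in> C11" if "i \<le> m" for i using g[OF that] by (simp add: eigenfun_def)
  have gc: "continuous_on {-1..1} ?g" using gC[of m] by simp
  have "\<exists>x\<in>{-1..1}. ?g x \<noteq> 0"
  proof (rule ccontr)
    assume "\<not> ?thesis"
    then have "ip ?g ?g = ip (\<lambda>x. 0) ?g" by (intro ip_cong) simp
    then show False using orth[OF order_refl order_refl] by (simp add: ip_def)
  qed
  then obtain x0 where x0: "x0 \<in> {-1..1}" "?g x0 \<noteq> 0" by blast
  obtain s Z where Z: "Z = {x\<in>{-1<..<1}. ?g x = 0}" and s: "sign_pattern s Z ?g" and Z2: "Z = {x\<in>{-1..1}. ?g x = 0}"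
    and g1: "?g (-1) \<noteq> 0" and l: "lam m > 0"
    by (rule eigenfun_nodal[OF a g[OF order_refl] x0]) (rule that; assumption)
  have Zf: "finite Z" and s0: "s \<noteq> 0" and sg: "\<And>x. x \<in> {-1..1} \<Longrightarrow> 0 \<le> s * ?g x * (\<Prod>y\<in>Z. x - y)"
    using s by (auto simp: sign_pattern_def)
  have Zsub: "Z \<subseteq> {-1<..<1}" unfolding Z by auto
  have gZ: "?g z = 0" if "z \<in> Z" for z using that unfolding Z by simp
  have gnZ: "?g x \<noteq> 0" if "x \<in> {-1..1}" "x \<notin> Z" for x using that unfolding Z2 by simp
  have "card Z \<le> m"
  proof (rule ccontr)
    assume "\<not> card Z \<le> m"
    then have cardZ: "m < card Z" by simp
    \<comment> \<open>Cutting at a zero of \<open>?g\<close> keeps the function continuous.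
      Combinations of these are \<open>?g\<close> times a step function.\<close>
    define h where "h z = (\<lambda>x. if x \<le> z then 0 else ?g x)" for z
    have hC: "h z \<in> C11" if "z \<in> Z" for z
      using continuous_on_cut[OF gc gZ[OF that]] by (simp add: h_def)
    \<comment> \<open>There is one unknown for each zero, more than the m orthogonality
      conditions.\<close>
    obtain b where b: "\<exists>z\<in>Z. b z \<noteq> 0" "\<And>i. i < m \<Longrightarrow> (\<Sum>z\<in>Z. b z * ip (h z) (g i)) = 0"
      using homogeneous_system_nontrivial[OF Zf cardZ, of "\<lambda>i z. ip (h z) (g i)"] by blast
    define beta where "beta x = (\<Sum>z\<in>{z\<in>Z. z < x}. b z)" for x
    define F0 where "F0 = (\<lambda>x. \<Sum>z\<in>Z. b z * h z x)"
    have F0C: "F0 \<in> C11" unfolding F0_def by (rule C11_sum[OF Zf hC])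
    have F0: "F0 x = beta x * ?g x" for x
    proof -
      have "F0 x = (\<Sum>z\<in>Z. if z < x then b z * ?g x else 0)"
        unfolding F0_def h_def by (intro sum.cong) auto
      also have "\<dots> = (\<Sum>z\<in>{z\<in>Z. z < x}. b z * ?g x)" using Zf by (intro sum.inter_filter[symmetric])
      finally show ?thesis by (simp add: beta_def sum_distrib_right)
    qed
    have F0i: "ip F0 (g i) = 0" if "i < m" for i
      unfolding F0_def using b(2)[OF that] ip_sum[OF Zf hC gC[of i]] that by simp
    obtain e where e: "e > 0" "\<And>z. z \<in> Z \<Longrightarrow> -1 < z - e \<and> z + e < 1"
      "\<And>z z'. z \<in> Z \<Longrightarrow> z' \<in> Z \<Longrightarrow> z \<noteq> z' \<Longrightarrow> 2 * e < \<bar>z - z'\<bar>"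
      using separation_exists[OF Zf Zsub] by blast
    have near: "z - e \<in> {-1..1}" "z + e \<in> {-1..1}" "z - e \<notin> Z" "z + e \<notin> Z" if z: "z \<in> Z" for z
      using e(1) e(2)[OF z] e(3)[OF z, of "z - e"] e(3)[OF z, of "z + e"] by auto
    define z1 where "z1 = Min {z\<in>Z. b z \<noteq> 0}"
    have z1: "z1 \<in> Z" "b z1 \<noteq> 0"
      using Min_in[of "{z\<in>Z. b z \<noteq> 0}"] Zf b(1) by (auto simp: z1_def)
    have z1le: "z1 \<le> z" if "z \<in> Z" "b z \<noteq> 0" for z
      unfolding z1_def using that Zf by (intro Min_le) auto
    have beta1: "beta (z1 + e) = b z1"
    proof -
      have "beta (z1 + e) = (\<Sum>z\<in>{z1}. b z)"
        unfolding beta_def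
      proof (rule sum.mono_neutral_right)
        show "\<forall>z\<in>{z \<in> Z. z < z1 + e} - {z1}. b z = 0"
        proof
          fix z assume z: "z \<in> {z \<in> Z. z < z1 + e} - {z1}"
          then have "2 * e < \<bar>z1 - z\<bar>" using e(3)[OF z1(1), of z] by auto
          then have "z < z1" using z e(1) by auto
          then show "b z = 0" using z1le[of z] z by force
        qed
      qed (use Zf z1 e in auto)
      then show ?thesis by simp
    qed
    have "{z\<in>Z. z < -1} = {}" using Zsub by auto
    then have beta0: "beta (-1) = 0" unfolding beta_def by (simp only: sum.empty)
    have bfin: "finite (range beta)"
    proof (rule finite_subset)
      show "range beta \<subseteq> sum b ` Pow Z" unfolding beta_def by auto
    qed (use Zf in simp)
    \<comment> \<open>Three demands on the shift: the component of F along \<open>?g\<close> is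
      nonzero, the step function \<open>beta + t\<close> has no zero, and it has opposite signs at
      -1 and just after the first jump \<open>z1\<close>.\<close>
    obtain t where t: "t \<notin> insert (- ip F0 ?g) (uminus ` range beta)" "t * (b z1 + t) < 0"
      using avoid_finite_between[of "insert (- ip F0 ?g) (uminus ` range beta)" "b z1"] bfin z1(2) by auto
    have bt: "beta x + t \<noteq> 0" for x
    proof
      assume "beta x + t = 0"
      then have "t = - beta x" by simp
      then show False using t(1) by auto
    qed
    define F where "F = (\<lambda>x. 1 * F0 x + t * ?g x)"
    have FC: "F \<in> C11" unfolding F_def by (intro C11_lincomb F0C gC) simp
    have Fx: "F x = (beta x + t) * ?g x" for x by (simp add: F_def F0 algebra_simps)
    have Fi: "ip F (g i) = ip F0 (g i) + t * ip ?g (g i)" if "i \<le> m" for i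
      unfolding F_def using ip_lincomb[OF F0C gC[OF order_refl] gC[OF that], of 1 t] by simp
    have Fi0: "ip F (g i) = 0" if "i < m" for i
      using Fi[of i] F0i[OF that] that orth[of m i] by simp
    have Fm: "ip F ?g \<noteq> 0" using Fi[of m] orth[of m m] t(1) by auto
    have FZ: "{x\<in>{-1<..<1}. F x = 0} = Z" unfolding Z by (simp add: Fx bt)
    have Fc: "continuous_on {-1..1} F" using FC by simp
    obtain s' Y where Y: "sign_pattern s' Y F" "Y \<subseteq> Z"
      using sign_pattern_exists[OF Fc] Zf unfolding FZ by blast
    have "Y \<noteq> Z"
    proof
      assume "Y = Z"
      then have s': "s' \<noteq> 0" "\<And>x. x \<in> {-1..1} \<Longrightarrow> 0 \<le> s' * F x * (\<Prod>y\<in>Z. x - y)"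
        using Y(1) by (auto simp: sign_pattern_def)
      \<comment> \<open>If \<open>F\<close> and \<open>?g\<close> shared the sign pattern on
        \<open>Z\<close>, their quotient \<open>beta + t\<close> would keep one sign off
        \<open>Z\<close>, contrary to the choice of t.\<close>
      have key: "0 < s * s' * (beta x + t)" if x: "x \<in> {-1..1}" "x \<notin> Z" for x
      proof -
        have "0 \<le> (s * ?g x * (\<Prod>y\<in>Z. x - y)) * (s' * F x * (\<Prod>y\<in>Z. x - y))"
          using sg[OF x(1)] s'(2)[OF x(1)] by (rule mult_nonneg_nonneg)
        also have "\<dots> = (s * s' * (beta x + t)) * (?g x * (\<Prod>y\<in>Z. x - y))\<^sup>2"
          by (simp add: Fx power2_eq_square)
        finally have "0 \<le> (s * s' * (beta x + t)) * (?g x * (\<Prod>y\<in>Z. x - y))\<^sup>2" .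
        moreover have "?g x * (\<Prod>y\<in>Z. x - y) \<noteq> 0" using gnZ[OF x] x(2) Zf by auto
        then have "0 < (?g x * (\<Prod>y\<in>Z. x - y))\<^sup>2" by simp
        ultimately have "0 \<le> s * s' * (beta x + t)"
          using zero_le_mult_iff[of "s * s' * (beta x + t)" "(?g x * (\<Prod>y\<in>Z. x - y))\<^sup>2"] by linarith
        moreover have "s * s' * (beta x + t) \<noteq> 0" using s0 s'(1) bt[of x] by simp
        ultimately show ?thesis by linarith
      qed
      have "0 < s * s' * (beta (-1) + t)" using Zsub by (intro key) auto
      moreover have "0 < s * s' * (beta (z1 + e) + t)" using near[OF z1(1)] by (intro key) auto
      ultimately have "0 < (s * s' * t) * (s * s' * (b z1 + t))" by (simp only: beta0 beta1 add_0 mult_pos_pos)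
      also have "\<dots> = (s * s')\<^sup>2 * (t * (b z1 + t))" by (simp add: power2_eq_square)
      finally have "0 < t * (b z1 + t)" using s0 s'(1) by (simp add: zero_less_mult_iff)
      then show False using t(2) by simp
    qed
    then have cardY: "card Y < card Z" using Y(2) Zf by (intro psubset_card_mono) auto
    define P where "P n x = (?S ^^ n) F x / lam m ^ n" for n x
    have lim: "(\<lambda>n. P n x) \<longlonglongrightarrow> ip F ?g * ?g x" if "x \<in> {-1..1}" for x
      unfolding P_def
    proof (rule power_iteration[OF a])
      show "eigenfun a (lam i) (g i)" if "i \<le> m" for i by (rule g[OF that])
      show "ip (g i) (g j) = (if i = j then 1 else 0)" if "i \<le> m" "j \<le> m" for i j by (rule orth[OF that])
      show "N < lam m" if "eigenfun a N p" "x \<in> {-1..1}" "p x \<noteq> 0" "\<And>i. i \<le> m \<Longrightarrow> ip p (g i) = 0" for N p x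
        by (rule top[OF that])
      show "F \<in> C11" by (rule FC)
      show "ip F (g i) = 0" if "i < m" for i by (rule Fi0[OF that])
    qed (rule that)
    \<comment> \<open>\<open>?g\<close> truly changes sign at each of its interior zeros, so the
      change is inherited by all late iterates, which converge to a nonzero multiple of
      \<open>?g\<close>.\<close>
    have neg: "?g (z - e) * ?g (z + e) < 0" if z: "z \<in> Z" for z
    proof -
      let ?P = "\<lambda>x. \<Prod>y\<in>Z. x - y"
      have "0 \<le> (s * ?g (z - e) * ?P (z - e)) * (s * ?g (z + e) * ?P (z + e))"
        using near[OF z] by (intro mult_nonneg_nonneg sg)
      also have "\<dots> = (?g (z - e) * ?g (z + e)) * (s\<^sup>2 * (?P (z - e) * ?P (z + e)))"
        by (simp add: power2_eq_square)
      finally have "0 \<le> (?g (z - e) * ?g (z + e)) * (s\<^sup>2 * (?P (z - e) * ?P (z + e)))" .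
      moreover have "s\<^sup>2 * (?P (z - e) * ?P (z + e)) < 0"
        by (rule mult_pos_neg[OF _ prod_symmetric_points[OF Zf z e(1) e(3)[OF z]]]) (use s0 in simp)
      ultimately have "?g (z - e) * ?g (z + e) \<le> 0"
        by (metis mult_pos_neg not_le)
      moreover have "?g (z - e) * ?g (z + e) \<noteq> 0" using gnZ near[OF z] by simp
      ultimately show ?thesis by linarith
    qed
    have "\<forall>z\<in>Z. eventually (\<lambda>n. P n (z - e) * P n (z + e) < 0) sequentially"
    proof
      fix z assume z: "z \<in> Z"
      have "(\<lambda>n. P n (z - e) * P n (z + e)) \<longlonglongrightarrow> (ip F ?g * ?g (z - e)) * (ip F ?g * ?g (z + e))"
        using near[OF z] by (intro tendsto_mult lim)
      moreover have "(ip F ?g * ?g (z - e)) * (ip F ?g * ?g (z + e)) < 0"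
      proof -
        have "(ip F ?g * ?g (z - e)) * (ip F ?g * ?g (z + e)) = (ip F ?g)\<^sup>2 * (?g (z - e) * ?g (z + e))"
          by (simp add: power2_eq_square)
        moreover have "(ip F ?g)\<^sup>2 * (?g (z - e) * ?g (z + e)) < 0"
          by (rule mult_pos_neg[OF _ neg[OF z]]) (use Fm in simp)
        ultimately show ?thesis by (simp only:)
      qed
      ultimately show "eventually (\<lambda>n. P n (z - e) * P n (z + e) < 0) sequentially"
        by (rule order_tendstoD(2))
    qed
    then have "eventually (\<lambda>n. \<forall>z\<in>Z. P n (z - e) * P n (z + e) < 0) sequentially"
      using Zf by (simp add: eventually_ball_finite)
    then have "eventually (\<lambda>n. n > 0 \<and> (\<forall>z\<in>Z. P n (z - e) * P n (z + e) < 0)) sequentially"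
      by (intro eventually_conj eventually_gt_at_top)
    then obtain n where n: "n > 0" "\<And>z. z \<in> Z \<Longrightarrow> P n (z - e) * P n (z + e) < 0"
      by (auto simp: eventually_sequentially)
    let ?f = "(?S ^^ n) F"
    have F0x: "F x0 \<noteq> 0" using x0(2) by (simp add: Fx bt)
    have fc: "continuous_on {-1..1} ?f" and ff: "finite {x. ?f x = 0}" "card {x. ?f x = 0} \<le> card Y"
      using iterated_zeros[OF a Fc x0(1) F0x Y(1), of n] n(1) by auto
    \<comment> \<open>The intermediate value theorem puts a zero of the iterate near every point of
      \<open>Z\<close>. The intervals are disjoint, which gives \<open>card Z\<close> zeros against
      the bound \<open>card Y < card Z\<close>.\<close>
    have "\<exists>x. z - e < x \<and> x < z + e \<and> ?f x = 0" if z: "z \<in> Z" for z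
    proof -
      have "?f (z - e) * ?f (z + e) < 0"
      proof -
        have "P n (z - e) * P n (z + e) = (?f (z - e) * ?f (z + e)) / (lam m ^ n)\<^sup>2"
          by (simp add: P_def power2_eq_square)
        then show ?thesis using n(2)[OF z] l by (simp add: divide_less_0_iff)
      qed
      have "0 \<in> ?f ` {z - e..z + e}"
      proof -
        have "connected (?f ` {z - e..z + e})"
          by (intro connected_continuous_image continuous_on_subset[OF fc]) (use near[OF z] in auto)
        moreover have "?f (z - e) \<in> ?f ` {z - e..z + e}" "?f (z + e) \<in> ?f ` {z - e..z + e}" using e(1) by auto
        moreover have "?f (z - e) \<le> 0 \<and> 0 \<le> ?f (z + e) \<or> ?f (z + e) \<le> 0 \<and> 0 \<le> ?f (z - e)"
          using \<open>?f (z - e) * ?f (z + e) < 0\<close> by (auto simp: mult_less_0_iff)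
        ultimately show ?thesis by (meson atLeastAtMost_iff connected_contains_Icc subsetD)
      qed
      then obtain x where x: "x \<in> {z - e..z + e}" "?f x = 0" by auto
      then have "x \<noteq> z - e" "x \<noteq> z + e" using \<open>?f (z - e) * ?f (z + e) < 0\<close> by auto
      then show ?thesis using x by (intro exI[of _ x]) auto
    qed
    then obtain r where r: "\<And>z. z \<in> Z \<Longrightarrow> z - e < r z \<and> r z < z + e \<and> ?f (r z) = 0" by metis
    have "inj_on r Z"
    proof (rule inj_onI, rule ccontr)
      fix z z' assume z: "z \<in> Z" "z' \<in> Z" "r z = r z'" "z \<noteq> z'"
      have "\<bar>z - z'\<bar> < 2 * e" using r[OF z(1)] r[OF z(2)] z(3) by linarith
      then show False using e(3)[OF z(1,2,4)] by linarith
    qed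
    then have "card Z = card (r ` Z)" by (simp add: card_image)
    also have "\<dots> \<le> card {x. ?f x = 0}" using r by (intro card_mono ff) auto
    finally show False using ff(2) cardY by simp
  qed
  then show ?thesis using Zf unfolding Z by blast
qed

section \<open>The commuting differential operator\<close>

definition pk :: "real \<Rightarrow> real \<Rightarrow> real"
  where "pk k x = cosh k - cosh (k * x)"

definition qk :: "real \<Rightarrow> real \<Rightarrow> real"
  where "qk k x = 3 * k\<^sup>2 / 16 * cosh (k * x)"

lemma DERIV_pk [derivative_intros]: "(pk k has_real_derivative - (k * sinh (k * x))) (at x)"
  unfolding pk_def[abs_def] by (auto intro!: derivative_eq_intros)

lemma pk_ends [simp]: "pk k 1 = 0" "pk k (-1) = 0"
  by (simp_all add: pk_def)

text \<open>The differential operator in y and the one in x act alike on the kernel. In w = 2a(x +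
  y) and v = 2a(x - y) the difference has the common factor sinh w, and what remains is a
  second-order equation satisfied by sech (a z). It dictates k = 4a and the constant 3 k^2 /
  16.\<close>

lemma sech_kernel_commutes:
  fixes a x y :: real
  defines "k \<equiv> 4 * a" and "z \<equiv> x - y"
  shows "- (k * sinh (k * y)) * sech' a z - pk k y * sech'' a z + qk k y * sech (a * z)
    = - pk k x * sech'' a z + k * sinh (k * x) * sech' a z + qk k x * sech (a * z)"
proof -
  define w v C S where "w = 2 * a * (x + y)" and "v = 2 * a * z" and "C = cosh (a * z)" and "S = sinh (a * z)"
  have C: "C \<noteq> 0" and S2: "S\<^sup>2 = C\<^sup>2 - 1" by (simp_all add: C_def S_def sinh_square_eq)
  have kx: "k * x = w + v" and ky: "k * y = w - v" by (simp_all add: k_def w_def v_def z_def algebra_simps)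
  have v: "sinh v = 2 * S * C" "cosh v = 2 * C\<^sup>2 - 1"
  proof -
    have e: "v = a * z + a * z" by (simp add: v_def)
    show "sinh v = 2 * S * C" unfolding e sinh_add by (simp add: S_def C_def)
    have "cosh v = C\<^sup>2 + S\<^sup>2" unfolding e cosh_add by (simp add: S_def C_def power2_eq_square)
    then show "cosh v = 2 * C\<^sup>2 - 1" using S2 by simp
  qed
  have d: "cosh (k * x) - cosh (k * y) = 2 * sinh w * sinh v" "sinh (k * x) + sinh (k * y) = 2 * sinh w * cosh v"
    unfolding kx ky by (simp_all add: cosh_add cosh_diff sinh_add sinh_diff)
  have key: "sinh v * (sech'' a z + 3 * a\<^sup>2 * sech (a * z)) + 4 * a * cosh v * sech' a z = 0"
    unfolding v sech''_def sech'_def sech_def C_def[symmetric] S_def[symmetric] using C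
    by (simp add: field_simps power2_eq_square power3_eq_cube)
  have "(- (k * sinh (k * y)) * sech' a z - pk k y * sech'' a z + qk k y * sech (a * z))
    - (- pk k x * sech'' a z + k * sinh (k * x) * sech' a z + qk k x * sech (a * z))
    = - (cosh (k * x) - cosh (k * y)) * (sech'' a z + 3 * a\<^sup>2 * sech (a * z)) - k * (sinh (k * x) + sinh (k * y)) * sech' a z"
    by (simp add: pk_def qk_def k_def power2_eq_square algebra_simps)
  also have "\<dots> = - (2 * sinh w) * (sinh v * (sech'' a z + 3 * a\<^sup>2 * sech (a * z)) + 4 * a * cosh v * sech' a z)"
    unfolding d by (simp add: k_def algebra_simps)
  finally show ?thesis using key by simp
qed

text \<open>By commutation L g is an eigenfunction for the same eigenvalue, so simplicity makes it a
  multiple \<open>chi\<close> of g. The functions returned live on the whole line, since the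
  convolution extends the eigenfunction.\<close>

lemma eigenfun_ode:
  assumes a: "a > 0" and e: "eigenfun a l f" and x0: "x0 \<in> {-1..1}" "f x0 \<noteq> 0"
  obtains chi g g1 g2 where "\<And>x. (g has_real_derivative g1 x) (at x)" "\<And>x. (g1 has_real_derivative g2 x) (at x)"
    "\<And>x. x \<in> {-1..1} \<Longrightarrow> g x = f x"
    "\<And>x. x \<in> {-1..1} \<Longrightarrow> pk (4 * a) x * g2 x = 4 * a * sinh (4 * a * x) * g1 x + (qk (4 * a) x - chi) * g x"
proof -
  have f: "continuous_on {-1..1} f" and l: "l \<noteq> 0" and fl: "\<And>x. x \<in> {-1..1} \<Longrightarrow> sech_conv a f x = l * f x"
    using e by (auto simp: eigenfun_def)
  define k where "k = 4 * a"
  define g g1 g2 where "g x = sech_conv a f x / l"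
    and "g1 x = integral {-1..1} (\<lambda>y. f y * sech' a (x - y)) / l"
    and "g2 x = integral {-1..1} (\<lambda>y. f y * sech'' a (x - y)) / l" for x
  have dg: "(g has_real_derivative g1 x) (at x)" for x
    unfolding g_def g1_def by (intro DERIV_cdivide sech_conv_deriv1 f)
  have dg1: "(g1 has_real_derivative g2 x) (at x)" for x
    unfolding g1_def g2_def by (intro DERIV_cdivide sech_conv_deriv2 f)
  have gf: "g x = f x" if "x \<in> {-1..1}" for x using fl[OF that] l by (simp add: g_def)
  have c: "continuous_on A g" "continuous_on A g1" for A
    by (rule DERIV_continuous_on[OF has_field_derivative_at_within], rule dg dg1)+
  have cx: "continuous_on {-1..1} (\<lambda>y. x - y)" for x :: real by (intro continuous_intros)
  have cK: "continuous_on {-1..1} (\<lambda>y. sech' a (x - y))" "continuous_on {-1..1} (\<lambda>y. sech'' a (x - y))" for x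
    using continuous_on_compose2[OF continuous_on_sech' cx] continuous_on_compose2[OF continuous_on_sech'' cx] by auto
  have c2: "continuous_on {-1..1} g2"
  proof -
    have "continuous_on (cbox (-1) 1) (\<lambda>x. integral (cbox (-1) 1) (\<lambda>y. f y * sech'' a (x - y)))"
    proof (rule integral_continuous_on_param)
      have 1: "continuous_on (cbox (-1) 1 \<times> cbox (-1) 1) (\<lambda>p::real \<times> real. snd p)"
        "continuous_on (cbox (-1) 1 \<times> cbox (-1) 1) (\<lambda>p::real \<times> real. fst p - snd p)" by (intro continuous_intros)+
      have 2: "continuous_on (cbox (-1) 1 \<times> cbox (-1) 1) (\<lambda>p::real \<times> real. f (snd p))"
        by (rule continuous_on_compose2[OF f 1(1)]) auto
      have 3: "continuous_on (cbox (-1) 1 \<times> cbox (-1) 1) (\<lambda>p::real \<times> real. sech'' a (fst p - snd p))"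
        by (rule continuous_on_compose2[OF continuous_on_sech'' 1(2)]) auto
      show "continuous_on (cbox (-1) 1 \<times> cbox (-1) 1) (\<lambda>(x, y). f y * sech'' a (x - y))"
        unfolding case_prod_unfold by (rule continuous_on_mult[OF 2 3])
    qed
    then show ?thesis unfolding g2_def box_real using l by (intro continuous_on_divide continuous_on_const) auto
  qed
  define L where "L x = - (pk k x * g2 x - k * sinh (k * x) * g1 x) + qk k x * g x" for x
  have cL: "continuous_on {-1..1} L"
    unfolding L_def pk_def qk_def by (intro continuous_intros c c2)
  have "sech_conv a L x = l * L x" for x
  proof -
    \<comment> \<open>Lagrange's bilinear form p (g' K - g K_y) of g and the kernel K. Its
      derivative is g L K - K L g, and it vanishes at the end points because p does.\<close>
    define Phi where "Phi y = pk k y * (g1 y * sech (a * (x - y)) + g y * sech' a (x - y))" for y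
    define M where "M y = - (k * sinh (k * y)) * sech' a (x - y) - pk k y * sech'' a (x - y) + qk k y * sech (a * (x - y))" for y
    have dK: "((\<lambda>y. sech (a * (x - y))) has_real_derivative - sech' a (x - y)) (at y)"
      "((\<lambda>y. sech' a (x - y)) has_real_derivative - sech'' a (x - y)) (at y)" for y
    proof -
      have d: "((\<lambda>y. x - y) has_real_derivative -1) (at y)" by (auto intro!: derivative_eq_intros)
      show "((\<lambda>y. sech (a * (x - y))) has_real_derivative - sech' a (x - y)) (at y)"
        using DERIV_chain2[OF DERIV_sech d] by simp
      show "((\<lambda>y. sech' a (x - y)) has_real_derivative - sech'' a (x - y)) (at y)"
        using DERIV_chain2[OF DERIV_sech' d] by simp
    qed
    have dPhi: "(Phi has_real_derivative (g y * M y - L y * sech (a * (x - y)))) (at y)" for y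
    proof -
      have "(Phi has_real_derivative (- (k * sinh (k * y)) * (g1 y * sech (a * (x - y)) + g y * sech' a (x - y))
          + (g2 y * sech (a * (x - y)) + - sech' a (x - y) * g1 y + (g1 y * sech' a (x - y) + - sech'' a (x - y) * g y)) * pk k y)) (at y)"
        unfolding Phi_def by (intro DERIV_mult DERIV_add DERIV_pk dg dg1 dK)
      then show ?thesis
        by (rule DERIV_cong) (simp add: M_def L_def algebra_simps)
    qed
    have "((\<lambda>y. g y * M y - L y * sech (a * (x - y))) has_integral (Phi 1 - Phi (-1))) {-1..1}"
      by (intro fundamental_theorem_of_calculus)
        (auto intro: has_field_derivative_at_within[OF dPhi] simp flip: has_real_derivative_iff_has_vector_derivative)
    then have I0: "integral {-1..1} (\<lambda>y. g y * M y - L y * sech (a * (x - y))) = 0"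
      by (simp add: integral_unique Phi_def)
    have cM: "continuous_on {-1..1} M"
      unfolding M_def pk_def qk_def by (intro continuous_intros cK)
    have "integral {-1..1} (\<lambda>y. g y * M y - L y * sech (a * (x - y)))
        = integral {-1..1} (\<lambda>y. g y * M y) - sech_conv a L x"
      unfolding sech_conv_def
      by (intro integral_diff integrable_continuous_real continuous_on_mult c cM integrable_sech_conv[unfolded] continuous_intros cL)
    then have "sech_conv a L x = integral {-1..1} (\<lambda>y. g y * M y)" using I0 by simp
    also have "\<dots> = integral {-1..1} (\<lambda>y. - pk k x * (f y * sech'' a (x - y)) + (k * sinh (k * x) * (f y * sech' a (x - y)) + qk k x * (f y * sech (a * (x - y)))))"
    proof (intro integral_cong)
      fix y :: real assume y: "y \<in> {-1..1}"
      have "M y = - pk k x * sech'' a (x - y) + k * sinh (k * x) * sech' a (x - y) + qk k x * sech (a * (x - y))"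
        unfolding M_def k_def by (rule sech_kernel_commutes)
      note m = this
      show "g y * M y = - pk k x * (f y * sech'' a (x - y)) + (k * sinh (k * x) * (f y * sech' a (x - y)) + qk k x * (f y * sech (a * (x - y))))"
        unfolding gf[OF y] m by (simp add: algebra_simps)
    qed
    also have "\<dots> = - pk k x * (l * g2 x) + (k * sinh (k * x) * (l * g1 x) + qk k x * (l * g x))"
    proof -
      have i: "(\<lambda>y. f y * sech'' a (x - y)) integrable_on {-1..1}" "(\<lambda>y. f y * sech' a (x - y)) integrable_on {-1..1}"
        by (intro integrable_continuous_real continuous_on_mult f cK)+
      show ?thesis
        using l unfolding g2_def g1_def g_def sech_conv_def
        by (simp only: integral_add integrable_add integrable_on_mult_right integral_mult_right i integrable_sech_conv[OF f]) simp
    qed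
    also have "\<dots> = l * L x" by (simp add: L_def algebra_simps)
    finally show ?thesis .
  qed
  then have eL: "eigenfun a l L" using cL l by (simp add: eigenfun_def)
  define chi where "chi = L 1 / f 1"
  have Lf: "L x = chi * f x" if "x \<in> {-1..1}" for x
    unfolding chi_def by (rule bspec[OF conjunct2[OF eigenfun_simple[OF a e eL x0]] that])
  show thesis
  proof (rule that[OF dg dg1 gf])
    fix x :: real assume x: "x \<in> {-1..1}"
    show "pk (4 * a) x * g2 x = 4 * a * sinh (4 * a * x) * g1 x + (qk (4 * a) x - chi) * g x"
      using Lf[OF x] gf[OF x] unfolding L_def k_def by (simp add: algebra_simps)
  qed
qed

text \<open>The reflected function belongs to the same simple eigenvalue, so it is t f with t^2 = 1.
  Squares treat the even and the odd case at once.\<close>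

lemma eigenfun_parity:
  assumes a: "a > 0" and e: "eigenfun a l f" and x0: "x0 \<in> {-1..1}" "f x0 \<noteq> 0" and x: "x \<in> {-1..1}"
  shows "(f (- x))\<^sup>2 = (f x)\<^sup>2"
proof -
  define h where "h x = f (- x)" for x
  have c: "continuous_on {-1..1} f" using e by (simp add: eigenfun_def)
  have "continuous_on {-1..1} h"
    unfolding h_def by (rule continuous_on_compose2[OF c]) (auto intro: continuous_intros)
  moreover have "sech_conv a h x = l * h x" if "x \<in> {-1..1}" for x
  proof -
    have "sech_conv a h x = integral {- 1..- (- 1)} (\<lambda>y. f (- y) * sech (a * (- x - - y)))"
      unfolding sech_conv_def h_def
    proof (simp, intro integral_cong)
      fix y
      have "sech (a * (x - y)) = sech (a * (y - x))"
        using cosh_minus[of "a * (y - x)"] by (simp add: sech_def minus_mult_right)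
      then show "f (- y) * sech (a * (x - y)) = f (- y) * sech (a * (y - x))" by simp
    qed
    also have "\<dots> = sech_conv a f (- x)"
      using Henstock_Kurzweil_Integration.integral_reflect_real[of 1 "-1" "\<lambda>y. f y * sech (a * (- x - y))"] by (simp add: sech_conv_def)
    finally show ?thesis using e that by (simp add: eigenfun_def h_def)
  qed
  ultimately have h: "eigenfun a l h" using e by (simp add: eigenfun_def)
  define t where "t = h 1 / f 1"
  note simple = eigenfun_simple[OF a e h x0]
  have f1: "f 1 \<noteq> 0" using simple by (rule conjunct1)
  have ht: "f (- x) = t * f x" if "x \<in> {-1..1}" for x
    using bspec[OF conjunct2[OF simple] that] unfolding t_def by (simp only: h_def)
  have "f 1 = t * (t * f 1)" using ht[of 1] ht[of "-1"] by simp
  then have "t\<^sup>2 = 1" using f1 by (simp add: power2_eq_square)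
  then show ?thesis using ht[OF x] by (simp add: power_mult_distrib)
qed

section \<open>Eigenfunctions of the differential operator\<close>

text \<open>The points of \<open>Y\<close> cut the interval into at most \<open>card Y + 1\<close>
  gaps. It adds up the angle that is available between consecutive zeros.\<close>

lemma increment_le_gaps:
  fixes h :: "real \<Rightarrow> real"
  assumes "finite Y" "a \<le> b"
    and "\<And>u v. a \<le> u \<Longrightarrow> u \<le> v \<Longrightarrow> v \<le> b \<Longrightarrow> {u<..<v} \<inter> Y = {} \<Longrightarrow> h v - h u \<le> L"
  shows "h b - h a \<le> (real (card Y) + 1) * L"
  using assms
proof (induction Y arbitrary: b rule: finite_linorder_max_induct)
  case empty
  then show ?case by simp
next
  case (insert y Y)
  have L: "0 \<le> L" using insert.prems(2)[of a a] insert.prems(1) by simp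
  have yY: "y \<notin> Y" using insert.hyps by auto
  show ?case
  proof (cases "a \<le> y \<and> y \<le> b")
    case True
    have "h y - h a \<le> (real (card Y) + 1) * L"
    proof (rule insert.IH)
      show "h v - h u \<le> L" if "a \<le> u" "u \<le> v" "v \<le> y" "{u<..<v} \<inter> Y = {}" for u v
        using that True by (intro insert.prems(2)) auto
    qed (use True in simp)
    moreover have "h b - h y \<le> L"
      using True insert.hyps(2) by (intro insert.prems(2)) force+
    ultimately show ?thesis using insert.hyps yY by (simp add: algebra_simps)
  next
    case False
    have "h b - h a \<le> (real (card Y) + 1) * L"
    proof (rule insert.IH)
      show "h v - h u \<le> L" if "a \<le> u" "u \<le> v" "v \<le> b" "{u<..<v} \<inter> Y = {}" for u v
        using that False by (intro insert.prems(2)) auto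
    qed (use insert.prems in simp)
    then show ?thesis using insert.hyps yY L by (simp add: algebra_simps)
  qed
qed

text \<open>5/6 is the lower bound for the inner end of the edge zone. The estimate comes from the
  Taylor polynomial of sin at 49/50.\<close>

lemma arcsin_five_sixths: "49 / 50 \<le> arcsin (5 / 6 :: real)"
proof -
  have "\<bar>sin (49 / 50 :: real) - (\<Sum>m<7. sin_coeff m * (49 / 50) ^ m)\<bar> \<le> inverse (fact 7) * \<bar>49 / 50\<bar> ^ 7"
    by (rule Maclaurin_sin_bound)
  then have "sin (49 / 50 :: real) \<le> (\<Sum>m<7. sin_coeff m * (49 / 50) ^ m) + inverse (fact 7) * \<bar>49 / 50\<bar> ^ 7"
    by linarith
  also have "\<dots> \<le> 5 / 6"
    by (simp add: sin_coeff_def lessThan_nat_numeral fact_numeral power_divide)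
  finally have "sin (49 / 50 :: real) \<le> 5 / 6" .
  moreover have "arcsin (sin (49 / 50 :: real)) = 49 / 50"
    using pi_gt3 by (intro arcsin_sin) auto
  ultimately show ?thesis
    using arcsin_le_arcsin[of "sin (49 / 50)" "5 / 6"] by simp
qed

section \<open>The coefficients of the Sturm-Liouville equation\<close>

locale sl_coefficient =
  fixes k :: real
  assumes k: "k > 0"
begin

definition "A = cosh k"
text \<open>Minus the slope of p at 1: near that end point p(x) behaves like kap (1 - x).\<close>

definition "kap = k * sinh k"

lemma A_ge_1: "A \<ge> 1" by (simp add: A_def cosh_real_ge_1)
lemma kap_pos: "kap > 0" using k by (simp add: kap_def)

lemma kap_le: "kap \<le> k\<^sup>2 * A"
proof -
  have "sinh k - k * cosh k \<le> sinh 0 - 0 * cosh 0"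
  proof (rule DERIV_nonpos_imp_nonincreasing[where f = "\<lambda>x. sinh x - x * cosh x"])
    fix x :: real assume "0 \<le> x"
    then have "x * sinh x \<ge> 0" by simp
    then show "\<exists>y. ((\<lambda>x. sinh x - x * cosh x) has_real_derivative y) (at x) \<and> y \<le> 0"
      by (intro exI[of _ "- (x * sinh x)"]) (auto intro!: derivative_eq_intros)
  qed (use k in simp)
  then have "k * sinh k \<le> k * (k * cosh k)" using k by (intro mult_left_mono) auto
  then show ?thesis by (simp add: kap_def A_def power2_eq_square)
qed

lemma cosh_le_A: "x \<in> {-1..1} \<Longrightarrow> cosh (k * x) \<le> A"
proof -
  assume x: "x \<in> {-1..1}"
  have "\<bar>k * x\<bar> \<le> k" using x k by (auto simp: abs_mult mult_le_cancel_left1)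
  then have "cosh \<bar>k * x\<bar> \<le> cosh k" by (subst cosh_real_nonneg_le_iff) (use k in auto)
  then show ?thesis by (simp add: A_def)
qed

lemma pk_pos: "x \<in> {-1<..<1} \<Longrightarrow> 0 < pk k x"
proof -
  assume x: "x \<in> {-1<..<1}"
  have "\<bar>k * x\<bar> < k" using x k by (auto simp: abs_mult abs_less_iff)
  then have "cosh \<bar>k * x\<bar> < cosh k" by (subst cosh_real_nonneg_less_iff) (use k in auto)
  then show ?thesis by (simp add: pk_def)
qed

lemma pk_even: "pk k (- x) = pk k x"
  by (simp add: pk_def)

lemma sinh_convex_bound: "x \<in> {0..1} \<Longrightarrow> k * sinh (k * x) \<le> kap * x"
proof -
  assume x: "x \<in> {0..1}"
  have "convex_on {0..} (sinh :: real \<Rightarrow> real)"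
    by (rule f''_ge0_imp_convex[where f' = cosh and f'' = sinh])
      (auto intro!: derivative_eq_intros simp: sinh_real_nonneg_iff)
  from convex_onD[OF this, of x 0 k] x k have "sinh (k * x) \<le> x * sinh k" by (simp add: mult.commute)
  then have "k * sinh (k * x) \<le> k * (x * sinh k)" using k by (intro mult_left_mono) auto
  then show ?thesis by (simp add: kap_def mult_ac)
qed

text \<open>Both sides agree at 1, and convexity of sinh gives k sinh (k x) <= kap x, so their
  difference decreases towards 1. The bound is the parabola with the same zeros and end slopes as
  p.\<close>

lemma pk_le_pos: "x \<in> {0..1} \<Longrightarrow> pk k x \<le> kap / 2 * (1 - x\<^sup>2)"
proof -
  assume x: "x \<in> {0..1}"
  have "kap / 2 * (1 - x\<^sup>2) - pk k x \<ge> kap / 2 * (1 - 1\<^sup>2) - pk k 1"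
  proof (rule DERIV_nonpos_imp_nonincreasing[where f = "\<lambda>x. kap / 2 * (1 - x\<^sup>2) - pk k x"])
    fix t assume t: "x \<le> t" "t \<le> 1"
    show "\<exists>y. ((\<lambda>x. kap / 2 * (1 - x\<^sup>2) - pk k x) has_real_derivative y) (at t) \<and> y \<le> 0"
      using sinh_convex_bound[of t] t x
      by (intro exI[of _ "k * sinh (k * t) - kap * t"]) (auto intro!: derivative_eq_intros)
  qed (use x in simp)
  then show ?thesis by simp
qed

lemma pk_le: "x \<in> {-1..1} \<Longrightarrow> pk k x \<le> kap / 2 * (1 - x\<^sup>2)"
  using pk_le_pos[of x] pk_le_pos[of "- x"] by (cases "x \<ge> 0") (auto simp: pk_even)

lemma sinh_lower: "x \<in> {0..1} \<Longrightarrow> kap - k\<^sup>2 * A * (1 - x) \<le> k * sinh (k * x)"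
proof -
  assume x: "x \<in> {0..1}"
  have "k * sinh (k * x) - (kap - k\<^sup>2 * A * (1 - x)) \<ge> k * sinh (k * 1) - (kap - k\<^sup>2 * A * (1 - 1))"
  proof (rule DERIV_nonpos_imp_nonincreasing[where f = "\<lambda>x. k * sinh (k * x) - (kap - k\<^sup>2 * A * (1 - x))"])
    fix t assume t: "x \<le> t" "t \<le> 1"
    then have "cosh (k * t) \<le> A" using x by (intro cosh_le_A) auto
    then have "k\<^sup>2 * cosh (k * t) \<le> k\<^sup>2 * A" by (intro mult_left_mono) auto
    then show "\<exists>y. ((\<lambda>x. k * sinh (k * x) - (kap - k\<^sup>2 * A * (1 - x))) has_real_derivative y) (at t) \<and> y \<le> 0"
      by (intro exI[of _ "k\<^sup>2 * cosh (k * t) - k\<^sup>2 * A"])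
        (auto intro!: derivative_eq_intros simp: power2_eq_square)
  qed (use x in simp)
  then show ?thesis by (simp add: kap_def)
qed

text \<open>Taylor expansion at 1, where the second derivative -k^2 cosh (k x) of p is at least -k^2
  A.\<close>

lemma pk_lower: "x \<in> {0..1} \<Longrightarrow> kap * (1 - x) - k\<^sup>2 * A / 2 * (1 - x)\<^sup>2 \<le> pk k x"
proof -
  assume x: "x \<in> {0..1}"
  have "pk k x - (kap * (1 - x) - k\<^sup>2 * A / 2 * (1 - x)\<^sup>2) \<ge> pk k 1 - (kap * (1 - 1) - k\<^sup>2 * A / 2 * (1 - 1)\<^sup>2)"
  proof (rule DERIV_nonpos_imp_nonincreasing[where f = "\<lambda>x. pk k x - (kap * (1 - x) - k\<^sup>2 * A / 2 * (1 - x)\<^sup>2)"])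
    fix t assume t: "x \<le> t" "t \<le> 1"
    show "\<exists>y. ((\<lambda>x. pk k x - (kap * (1 - x) - k\<^sup>2 * A / 2 * (1 - x)\<^sup>2)) has_real_derivative y) (at t) \<and> y \<le> 0"
      using sinh_lower[of t] t x
      by (intro exI[of _ "- (k * sinh (k * t)) + kap - k\<^sup>2 * A * (1 - t)"])
        (auto intro!: derivative_eq_intros simp: field_simps)
  qed (use x in simp)
  then show ?thesis by simp
qed

lemma qk_bounds: "x \<in> {-1..1} \<Longrightarrow> 0 \<le> qk k x \<and> qk k x \<le> 3 * k\<^sup>2 / 16 * A"
  using mult_left_mono[OF cosh_le_A[of x], of "3 * k\<^sup>2 / 16"] by (simp add: qk_def)

lemma cont_pk [continuous_intros]: "continuous_on B (pk k)"
  by (rule DERIV_continuous_on[OF has_field_derivative_at_within], rule DERIV_pk)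

lemma cont_qk [continuous_intros]: "continuous_on B (qk k)"
  unfolding qk_def[abs_def] by (intro continuous_intros)

lemma sqrt_2_kap: "sqrt (2 / kap) = inverse (sqrt (kap / 2))"
  by (simp only: real_sqrt_inverse[symmetric] inverse_divide)

text \<open>The Liouville variable grows at least as fast as sqrt (2 / kap) arcsin x, which stands
  in for it in everything that follows.\<close>

lemma inverse_sqrt_pk_ge:
  assumes x: "x \<in> {-1<..<1}"
  shows "1 / (sqrt (kap / 2) * sqrt (1 - x\<^sup>2)) \<le> 1 / sqrt (pk k x)"
proof (rule divide_left_mono)
  have "sqrt (pk k x) \<le> sqrt (kap / 2 * (1 - x\<^sup>2))"
    using pk_le[of x] x by (intro real_sqrt_le_mono) auto
  then show "sqrt (pk k x) \<le> sqrt (kap / 2) * sqrt (1 - x\<^sup>2)" by (simp only: real_sqrt_mult)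
  have "x\<^sup>2 < 1" using x by (simp add: power2_less_1_iff abs_less_iff)
  then show "0 < sqrt (kap / 2) * sqrt (1 - x\<^sup>2) * sqrt (pk k x)"
    using pk_pos[OF x] kap_pos by (intro mult_pos_pos) auto
qed simp

lemma pk_antimono:
  assumes "0 \<le> x" "x \<le> y" "y \<le> 1"
  shows "pk k y \<le> pk k x"
proof -
  have "cosh (k * x) \<le> cosh (k * y)"
    using assms k by (subst cosh_real_nonneg_le_iff) (auto intro: mult_left_mono)
  then show ?thesis by (simp add: pk_def)
qed

end

section \<open>Energy, Liouville's form and the oscillation count\<close>

locale sl_eigenfunction = sl_coefficient k for k :: real +
  fixes chi :: real and g g1 g2 :: "real \<Rightarrow> real"
  assumes dg: "\<And>x. (g has_real_derivative g1 x) (at x)"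
    and dg1: "\<And>x. (g1 has_real_derivative g2 x) (at x)"
    and ode: "\<And>x. x \<in> {-1..1} \<Longrightarrow> pk k x * g2 x = k * sinh (k * x) * g1 x + (qk k x - chi) * g x"
    and normalized: "integral {-1..1} (\<lambda>x. (g x)\<^sup>2) = 1"
    and parity: "\<And>x. x \<in> {-1..1} \<Longrightarrow> (g (- x))\<^sup>2 = (g x)\<^sup>2"
begin

lemma cont_g [continuous_intros]: "continuous_on B g" "continuous_on B g1"
  by (rule DERIV_continuous_on[OF has_field_derivative_at_within], rule dg dg1)+

text \<open>The equation in divergence form. The flux p g' vanishes at both end points with p, which
  acts as the boundary condition.\<close>

lemma DERIV_flux:
  "x \<in> {-1..1} \<Longrightarrow> ((\<lambda>x. pk k x * g1 x) has_real_derivative (qk k x - chi) * g x) (at x)"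
proof -
  assume x: "x \<in> {-1..1}"
  have "((\<lambda>x. pk k x * g1 x) has_real_derivative - (k * sinh (k * x)) * g1 x + g2 x * pk k x) (at x)"
    by (rule DERIV_mult[OF DERIV_pk dg1])
  then show ?thesis
    by (rule DERIV_cong) (use ode[OF x] in \<open>simp add: algebra_simps\<close>)
qed

lemma half_mass: "integral {0..1} (\<lambda>x. (g x)\<^sup>2) = 1 / 2"
proof -
  have i: "(\<lambda>x. (g x)\<^sup>2) integrable_on {u..v}" for u v
    by (intro integrable_continuous_real continuous_intros)
  have "integral {-1..0} (\<lambda>x. (g x)\<^sup>2) = integral {-1..- 0} (\<lambda>x. (g (- x))\<^sup>2)"
    using parity by (auto intro!: integral_cong)
  also have "\<dots> = integral {0..1} (\<lambda>x. (g x)\<^sup>2)"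
    using Henstock_Kurzweil_Integration.integral_reflect_real[of 1 0 "\<lambda>x. (g x)\<^sup>2"] by simp
  finally show ?thesis
    using Henstock_Kurzweil_Integration.integral_combine[of "-1" 0 1 "\<lambda>x. (g x)\<^sup>2"] i normalized by simp
qed

lemma g_g1_odd: "x \<in> {-1<..<1} \<Longrightarrow> g (- x) * g1 (- x) = - (g x * g1 x)"
proof -
  assume x: "x \<in> {-1<..<1}"
  have d1: "((\<lambda>x. (g x)\<^sup>2) has_real_derivative 2 * g x * g1 x) (at x)" for x
    by (auto intro!: derivative_eq_intros dg)
  have "((\<lambda>x. (g (- x))\<^sup>2) has_real_derivative 2 * g (- x) * g1 (- x) * (- 1)) (at x)"
    by (rule DERIV_chain2[OF d1]) (auto intro!: derivative_eq_intros)
  moreover have "((\<lambda>x. (g (- x))\<^sup>2) has_real_derivative 2 * g x * g1 x) (at x)"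
  proof (rule has_field_derivative_transform_within_open[OF d1[of x], of "{-1<..<1}"])
    show "(g y)\<^sup>2 = (g (- y))\<^sup>2" if "y \<in> {-1<..<1}" for y using parity[of y] that by auto
  qed (use x in auto)
  ultimately have "2 * g (- x) * g1 (- x) * (- 1) = 2 * g x * g1 x" by (rule DERIV_unique)
  then show ?thesis by simp
qed

text \<open>For either parity one of the two factors vanishes at the centre, so integration by parts
  over [0, 1] leaves no boundary term there.\<close>

lemma g_g1_0: "g 0 * g1 0 = 0"
  using g_g1_odd[of 0] by simp

lemma energy: "integral {0..1} (\<lambda>x. pk k x * (g1 x)\<^sup>2) \<le> chi / 2" "0 \<le> chi"
proof -
  let ?e = "\<lambda>x. (qk k x - chi) * (g x)\<^sup>2 + pk k x * (g1 x)\<^sup>2"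
  have d: "((\<lambda>x. (pk k x * g1 x) * g x) has_real_derivative ?e x) (at x)" if "x \<in> {-1..1}" for x
    using DERIV_mult[OF DERIV_flux[OF that] dg] by (rule DERIV_cong) (simp add: power2_eq_square algebra_simps)
  have "(?e has_integral ((pk k 1 * g1 1) * g 1 - (pk k 0 * g1 0) * g 0)) {0..1}"
    by (intro fundamental_theorem_of_calculus)
      (auto intro!: has_field_derivative_at_within[OF d] simp flip: has_real_derivative_iff_has_vector_derivative)
  moreover have "(pk k 1 * g1 1) * g 1 - (pk k 0 * g1 0) * g 0 = 0" using g_g1_0 by auto
  ultimately have "(?e has_integral 0) {0..1}" by (simp only:)
  then have 0: "integral {0..1} ?e = 0" by (rule integral_unique)
  have ints: "(\<lambda>x. qk k x * (g x)\<^sup>2) integrable_on {0..1}" "(\<lambda>x. chi * (g x)\<^sup>2) integrable_on {0..1}"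
    "(\<lambda>x. pk k x * (g1 x)\<^sup>2) integrable_on {0..1}"
    by (intro integrable_continuous_real continuous_intros)+
  have "integral {0..1} ?e = integral {0..1} (\<lambda>x. (qk k x * (g x)\<^sup>2 - chi * (g x)\<^sup>2) + pk k x * (g1 x)\<^sup>2)"
    by (simp add: algebra_simps)
  also have "\<dots> = integral {0..1} (\<lambda>x. qk k x * (g x)\<^sup>2) - chi * (1 / 2) + integral {0..1} (\<lambda>x. pk k x * (g1 x)\<^sup>2)"
    by (simp only: integral_add integral_diff integrable_diff ints integral_mult_right half_mass)
  finally have *: "chi / 2 = integral {0..1} (\<lambda>x. qk k x * (g x)\<^sup>2) + integral {0..1} (\<lambda>x. pk k x * (g1 x)\<^sup>2)"
    using 0 by simp
  have q: "0 \<le> integral {0..1} (\<lambda>x. qk k x * (g x)\<^sup>2)"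
    using qk_bounds by (intro integral_nonneg ints) auto
  have p: "0 \<le> pk k x" if "x \<in> {0..1}" for x using cosh_le_A[of x] that by (simp add: pk_def A_def)
  have p: "0 \<le> integral {0..1} (\<lambda>x. pk k x * (g1 x)\<^sup>2)"
    using p by (intro integral_nonneg ints) auto
  show "integral {0..1} (\<lambda>x. pk k x * (g1 x)\<^sup>2) \<le> chi / 2" "0 \<le> chi" using * p q by linarith+
qed

text \<open>The minimum of \<open>phi\<close> on the open interval, attained at 0.\<close>

definition "omega2 = chi + k\<^sup>2 / 16"
definition "phi x = chi + k\<^sup>2 / 16 * ((A * cosh (k * x) - 1) / pk k x)"

lemma omega2_pos: "omega2 > 0"
  using energy(2) k by (simp add: omega2_def add_nonneg_pos)

lemma phi_ge: "x \<in> {-1<..<1} \<Longrightarrow> omega2 \<le> phi x"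
proof -
  assume x: "x \<in> {-1<..<1}"
  have "0 \<le> (A + 1) * (cosh (k * x) - 1)" using A_ge_1 cosh_real_ge_1[of "k * x"] by simp
  then have "pk k x \<le> A * cosh (k * x) - 1" by (simp add: pk_def A_def algebra_simps)
  then have "1 \<le> (A * cosh (k * x) - 1) / pk k x" using pk_pos[OF x] by simp
  then have "k\<^sup>2 / 16 * 1 \<le> k\<^sup>2 / 16 * ((A * cosh (k * x) - 1) / pk k x)" by (intro mult_left_mono) auto
  then show ?thesis by (simp add: omega2_def phi_def)
qed

lemma phi_0: "phi 0 = omega2"
  using A_ge_1 k by (simp add: phi_def omega2_def pk_def A_def cosh_real_one_iff)

lemma phi_alt: "x \<in> {-1<..<1} \<Longrightarrow> phi x = chi - qk k x + k\<^sup>2 / 4 * cosh (k * x) + (k * sinh (k * x))\<^sup>2 / (16 * pk k x)"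
proof -
  assume x: "x \<in> {-1<..<1}"
  have S: "(sinh (k * x))\<^sup>2 = (cosh (k * x))\<^sup>2 - 1" by (simp add: sinh_square_eq)
  have p: "pk k x \<noteq> 0" "A = pk k x + cosh (k * x)" using pk_pos[OF x] by (linarith, simp add: pk_def A_def)
  show ?thesis
    unfolding phi_def p(2) qk_def power_mult_distrib S using p(1)
    by (simp add: field_simps power2_eq_square)
qed

text \<open>
  With \<open>v = p\<^sup>1\<^sup>/\<^sup>4 g\<close> and \<open>z = \<integral> p\<^sup>-\<^sup>1\<^sup>/\<^sup>2\<close> the equation becomes \<open>v\<^sub>z\<^sub>z + \<phi> v = 0\<close>; the Riccati
  variable is \<open>v\<^sub>z / v\<close>.
\<close>

definition "ricc x = sqrt (pk k x) * (g1 x / g x) - k * sinh (k * x) / (4 * sqrt (pk k x))"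

text \<open>The Riccati equation of v_zz + phi v = 0; the factor 1 / sqrt p is dz / dx.\<close>

lemma DERIV_ricc:
  assumes x: "x \<in> {-1<..<1}" and g0: "g x \<noteq> 0"
  shows "(ricc has_real_derivative - (phi x + (ricc x)\<^sup>2) / sqrt (pk k x)) (at x)"
proof -
  define p r S C u where "p = pk k x" and "r = sqrt p" and "S = sinh (k * x)" and "C = cosh (k * x)" and "u = g1 x / g x"
  have p: "p > 0" using pk_pos[OF x] by (simp add: p_def)
  have r: "r > 0" "r * r = p" using p by (simp_all add: r_def)
  have dr: "((\<lambda>x. sqrt (pk k x)) has_real_derivative - (k * S) / (2 * r)) (at x)"
    using DERIV_chain2[OF DERIV_real_sqrt[OF p[unfolded p_def]] DERIV_pk]
    by (rule DERIV_cong) (simp add: r_def p_def S_def field_simps)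
  have du: "((\<lambda>x. g1 x / g x) has_real_derivative g2 x / g x - u * u) (at x)"
    using DERIV_divide[OF dg1 dg g0] by (rule DERIV_cong) (use g0 in \<open>simp add: u_def field_simps\<close>)
  have dS: "((\<lambda>x. k * sinh (k * x)) has_real_derivative k\<^sup>2 * C) (at x)"
    by (auto intro!: derivative_eq_intros simp: C_def power2_eq_square)
  have d4: "((\<lambda>x. 4 * sqrt (pk k x)) has_real_derivative 4 * (- (k * S) / (2 * r))) (at x)"
    by (rule DERIV_cmult[OF dr])
  have r0: "4 * sqrt (pk k x) \<noteq> 0" using r(1) by (simp add: r_def p_def)
  have "(ricc has_real_derivative
      (- (k * S) / (2 * r) * u + (g2 x / g x - u * u) * r)
      - (k\<^sup>2 * C * (4 * r) - k * S * (4 * (- (k * S) / (2 * r)))) / ((4 * r) * (4 * r))) (at x)"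
    using DERIV_diff[OF DERIV_mult[OF dr du] DERIV_divide[OF dS d4 r0]]
    unfolding ricc_def[abs_def] by (simp add: r_def p_def S_def u_def)
  moreover have "(- (k * S) / (2 * r) * u + (g2 x / g x - u * u) * r)
      - (k\<^sup>2 * C * (4 * r) - k * S * (4 * (- (k * S) / (2 * r)))) / ((4 * r) * (4 * r))
      = - (phi x + (ricc x)\<^sup>2) / sqrt (pk k x)"
  proof -
    have g2: "g2 x / g x = (k * S * u + (qk k x - chi)) / p"
      using ode[of x] x g0 p unfolding p_def S_def u_def by (simp add: field_simps)
    have ric: "ricc x = r * u - k * S / (4 * r)" by (simp add: ricc_def r_def p_def S_def u_def)
    have ph: "phi x = chi - qk k x + k\<^sup>2 / 4 * C + (k * S)\<^sup>2 / (16 * p)"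
      using phi_alt[OF x] by (simp add: C_def S_def p_def)
    have "((- (k * S) / (2 * r) * u + (g2 x / g x - u * u) * r)
      - (k\<^sup>2 * C * (4 * r) - k * S * (4 * (- (k * S) / (2 * r)))) / ((4 * r) * (4 * r))) * r
      = - (phi x + (ricc x)\<^sup>2)"
      unfolding g2 ric ph r(2)[symmetric] using r(1)
      by (simp add: field_simps power2_eq_square)
    then show ?thesis unfolding p_def[symmetric] r_def[symmetric] using r(1) by (simp add: eq_divide_eq)
  qed
  ultimately show ?thesis by simp
qed

text \<open>Between zeros the angle arctan (ricc / w) with w^2 = \<open>omega2\<close> falls at
  least at rate w in the Liouville variable, since phi >= w^2. Its total range is pi.\<close>

lemma arcsin_increment_le:
  assumes u: "-1 < u" "u \<le> v" "v < 1" and nz: "\<And>x. x \<in> {u..v} \<Longrightarrow> g x \<noteq> 0"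
  shows "sqrt omega2 * sqrt (2 / kap) * (arcsin v - arcsin u) \<le> pi"
proof -
  define w where "w = sqrt omega2"
  have w: "w > 0" "w\<^sup>2 = omega2" using omega2_pos by (simp_all add: w_def)
  \<comment> \<open>The comparison function grows no faster than the angle falls, so the sum does
    not increase.\<close>
  let ?B = "\<lambda>x. arctan (ricc x / w) + w * sqrt (2 / kap) * arcsin x"
  have "?B v \<le> ?B u"
  proof (rule DERIV_nonpos_imp_nonincreasing[OF u(2)])
    fix x assume "u \<le> x" "x \<le> v"
    then have x: "x \<in> {-1<..<1}" and gx: "g x \<noteq> 0" using u nz by auto
    define y r t where "y = ricc x" and "r = sqrt (pk k x)" and "t = sqrt (1 - x\<^sup>2)"
    have r: "r > 0" using pk_pos[OF x] by (simp add: r_def)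
    have "x\<^sup>2 < 1" using x by (simp add: power2_less_1_iff abs_less_iff)
    then have t: "t > 0" by (simp add: t_def)
    have dr: "(ricc has_real_derivative - (phi x + y\<^sup>2) / r) (at x)"
      using DERIV_ricc[OF x gx] by (simp add: y_def r_def)
    have "((\<lambda>x. arctan (ricc x / w)) has_real_derivative inverse (1 + (ricc x / w)\<^sup>2) * (- (phi x + y\<^sup>2) / r / w)) (at x)"
      by (rule DERIV_chain2[OF DERIV_arctan DERIV_cdivide[OF dr]])
    moreover have "((\<lambda>x. w * sqrt (2 / kap) * arcsin x) has_real_derivative w * sqrt (2 / kap) * inverse t) (at x)"
      unfolding t_def using x by (intro DERIV_cmult DERIV_arcsin) auto
    ultimately have d: "(?B has_real_derivative inverse (1 + (y / w)\<^sup>2) * (- (phi x + y\<^sup>2) / r / w) + w * sqrt (2 / kap) * inverse t) (at x)"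
      unfolding y_def by (rule DERIV_add)
    have "inverse (1 + (y / w)\<^sup>2) * (- (phi x + y\<^sup>2) / r / w) \<le> - (w / r)"
    proof -
      have p: "0 < w\<^sup>2 + y\<^sup>2" using w(1) by (simp add: add_pos_nonneg)
      have e: "1 + (y / w)\<^sup>2 = (w\<^sup>2 + y\<^sup>2) / w\<^sup>2" using w(1) by (simp add: field_simps)
      have "inverse (1 + (y / w)\<^sup>2) * (- (phi x + y\<^sup>2) / r / w) = - (w / r) * ((phi x + y\<^sup>2) / (w\<^sup>2 + y\<^sup>2))"
      proof -
        have "w\<^sup>2 / q * (- F / r / w) = - (w / r) * (F / q)" if "q \<noteq> 0" for q F
          using w(1) r that by (simp add: field_simps power2_eq_square)
        then show ?thesis unfolding e inverse_divide using p by (metis less_irrefl)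
      qed
      also have "\<dots> \<le> - (w / r) * 1"
      proof (rule mult_left_mono_neg)
        show "1 \<le> (phi x + y\<^sup>2) / (w\<^sup>2 + y\<^sup>2)" using p phi_ge[OF x] w by (simp add: le_divide_eq)
      qed (use w r in simp)
      finally show ?thesis by simp
    qed
    moreover have "w * sqrt (2 / kap) * inverse t \<le> w / r"
    proof -
      have "1 / (sqrt (kap / 2) * t) \<le> 1 / r" unfolding r_def t_def by (rule inverse_sqrt_pk_ge[OF x])
      then have "w * (1 / (sqrt (kap / 2) * t)) \<le> w * (1 / r)" using w(1) by (intro mult_left_mono) auto
      then show ?thesis
        unfolding sqrt_2_kap by (simp only: divide_inverse inverse_mult_distrib mult_1_left mult.assoc)
    qed
    ultimately show "\<exists>y. (?B has_real_derivative y) (at x) \<and> y \<le> 0" using d by (intro exI conjI) auto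
  qed
  then have "w * sqrt (2 / kap) * (arcsin v - arcsin u) \<le> arctan (ricc u / w) - arctan (ricc v / w)"
    by (simp add: algebra_simps)
  also have "\<dots> \<le> pi" using arctan_bounded[of "ricc u / w"] arctan_bounded[of "ricc v / w"] by linarith
  finally show ?thesis by (simp add: w_def)
qed

text \<open>Over [-1, 1] arcsin gains pi, and each of the at most m + 1 gaps between zeros can take
  only a share of at most pi / (sqrt omega2 sqrt (2 / kap)).\<close>

lemma omega_le_zeros:
  assumes Z: "finite {x\<in>{-1<..<1}. g x = 0}" "card {x\<in>{-1<..<1}. g x = 0} \<le> m"
  shows "sqrt omega2 \<le> (real m + 1) * sqrt (kap / 2)"
proof -
  let ?Z = "{x\<in>{-1<..<1}. g x = 0}" and ?c = "sqrt omega2 * sqrt (2 / kap)"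
  have "?c * arcsin 1 - ?c * arcsin (-1) \<le> (real (card ?Z) + 1) * pi"
  proof (rule increment_le_gaps[OF Z(1), where h = "\<lambda>x. ?c * arcsin x"])
    fix u v :: real assume uv: "-1 \<le> u" "u \<le> v" "v \<le> 1" "{u<..<v} \<inter> ?Z = {}"
    show "?c * arcsin v - ?c * arcsin u \<le> pi"
    proof (cases "u = v")
      case True
      then show ?thesis by simp
    next
      case False
      define d where "d = (v - u) / 3"
      have d: "d > 0" using uv False by (simp add: d_def)
      \<comment> \<open>A gap may end at a zero of g or at 1 or -1, where the Riccati variable is
        undefined. The estimate is applied on a shrunken gap and e tends to 0.\<close>
      let ?f = "\<lambda>e. ?c * arcsin (v - e) - ?c * arcsin (u + e)"
      have cf: "continuous_on {0..d} ?f"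
        using uv by (intro continuous_intros) (auto simp: d_def field_simps)
      have "?f e \<le> pi" if "e \<in> {0<..<d}" for e
      proof -
        have e: "0 < e" "u + e \<le> v - e" using that by (auto simp: d_def field_simps)
        have "?c * (arcsin (v - e) - arcsin (u + e)) \<le> pi"
        proof (rule arcsin_increment_le)
          fix x assume x: "x \<in> {u + e..v - e}"
          then have "x \<in> {u<..<v}" "x \<in> {-1<..<1}" using e uv by auto
          then show "g x \<noteq> 0" using uv(4) by blast
        qed (use e uv in auto)
        then show ?thesis by (simp add: algebra_simps)
      qed
      then have "?f 0 \<le> pi"
        using continuous_le_on_closure[of "{0<..<d}" ?f 0 pi] cf d by (simp add: closure_greaterThanLessThan)
      then show ?thesis by simp
    qed
  qed simp
  also have "\<dots> \<le> (real m + 1) * pi" using Z(2) by (intro mult_right_mono) auto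
  finally have "?c * pi \<le> (real m + 1) * pi" by (simp add: arcsin_1 arcsin_minus_1)
  then have "?c \<le> real m + 1" by simp
  then have "?c * sqrt (kap / 2) \<le> (real m + 1) * sqrt (kap / 2)" using kap_pos by (intro mult_right_mono) auto
  moreover have "sqrt (2 / kap) * sqrt (kap / 2) = 1" using kap_pos by (simp flip: real_sqrt_mult)
  ultimately show ?thesis by (simp add: mult.assoc)
qed

text \<open>
  The edge zone \<open>[x\<^sub>e, 1]\<close> is so short that \<open>g\<close> cannot vary much in it, and so long that \<open>p x\<^sub>e\<close> is
  of the order \<open>\<kappa>\<^sup>2 / \<mu>\<close>. The constants \<open>3/4\<close> and \<open>1/8\<close> balance the high and low energy estimates
  below and make \<open>(p\<^sup>1\<^sup>/\<^sup>2 g\<^sup>2)'\<close> nonpositive at \<open>x\<^sub>e\<close>.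
\<close>

lemma edge:
  assumes mu: "3 / 4 * k\<^sup>2 * A \<le> mu" "\<And>x. x \<in> {-1..1} \<Longrightarrow> \<bar>qk k x - chi\<bar> \<le> mu"
  defines "xe \<equiv> 1 - kap / (8 * mu)"
  shows "5 / 6 \<le> xe" "xe < 1" "11 / 12 * kap * (1 - xe) \<le> pk k xe" "5 / 6 * kap \<le> k * sinh (k * xe)"
    "\<And>x. x \<in> {xe..1} \<Longrightarrow> \<bar>g x\<bar> \<le> 22 / 19 * \<bar>g xe\<bar>"
    "\<bar>pk k xe * g1 xe\<bar> \<le> 11 / 76 * kap * \<bar>g xe\<bar>"
proof -
  have kA: "0 < k\<^sup>2 * A" using k A_ge_1 by simp
  then have mu0: "mu > 0" using mu(1) by linarith
  \<comment> \<open>Because kap <= k^2 A <= 4 mu / 3.\<close>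
  have s: "kap / (8 * mu) \<le> 1 / 6" using mu(1) kap_le mu0 by (simp add: field_simps)
  show xe: "5 / 6 \<le> xe" "xe < 1" using s kap_pos mu0 by (simp_all add: xe_def)
  have ks: "k\<^sup>2 * A * (1 - x) \<le> kap / 6" if "xe \<le> x" "x \<le> 1" for x
  proof -
    have "k\<^sup>2 * A * (1 - x) \<le> (4 / 3 * mu) * (kap / (8 * mu))"
      using that mu(1) kA mu0 kap_pos by (rule_tac mult_mono) (simp_all add: xe_def)
    then show ?thesis using mu0 by simp
  qed
  \<comment> \<open>The quadratic Taylor term costs half of kap / 6 times 1 - x, hence 11/12 = 1 -
    1/12.\<close>
  have pl: "11 / 12 * kap * (1 - x) \<le> pk k x" if "xe \<le> x" "x \<le> 1" for x
  proof -
    have "k\<^sup>2 * A * (1 - x) * (1 - x) \<le> kap / 6 * (1 - x)" using ks[OF that] that by (intro mult_right_mono) auto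
    moreover have "k\<^sup>2 * A / 2 * (1 - x)\<^sup>2 = k\<^sup>2 * A * (1 - x) * (1 - x) / 2" by (simp add: power2_eq_square)
    moreover have "kap * (1 - x) - k\<^sup>2 * A / 2 * (1 - x)\<^sup>2 \<le> pk k x" using that xe by (intro pk_lower) auto
    moreover have "11 / 12 * kap * (1 - x) = 11 / 12 * (kap * (1 - x))" "kap / 6 * (1 - x) = kap * (1 - x) / 6" by simp_all
    ultimately show ?thesis by linarith
  qed
  show "11 / 12 * kap * (1 - xe) \<le> pk k xe" using pl xe by simp
  show "5 / 6 * kap \<le> k * sinh (k * xe)" using sinh_lower[of xe] ks[of xe] xe by simp
  have "\<exists>x\<in>{xe..1}. \<forall>y\<in>{xe..1}. \<bar>g y\<bar> \<le> \<bar>g x\<bar>"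
    using xe by (intro continuous_attains_sup) (auto intro!: continuous_intros)
  then obtain xs where xs: "xs \<in> {xe..1}" "\<And>y. y \<in> {xe..1} \<Longrightarrow> \<bar>g y\<bar> \<le> \<bar>g xs\<bar>" by blast
  define X where "X = \<bar>g xs\<bar>"
  \<comment> \<open>The flux vanishes at 1 and its derivative is at most mu X, where X is the
    maximum of |g| in the edge zone. Division by p, of order kap (1 - x), then bounds g' up to the
    end.\<close>
  have flux: "\<bar>pk k x * g1 x\<bar> \<le> mu * X * (1 - x)" if x: "x \<in> {xe..1}" for x
  proof (cases "x = 1")
    case False
    then obtain z where z: "x < z" "z < 1" "pk k 1 * g1 1 - pk k x * g1 x = (1 - x) * ((qk k z - chi) * g z)"
      using MVT2[of x 1 "\<lambda>x. pk k x * g1 x" "\<lambda>z. (qk k z - chi) * g z"] DERIV_flux x xe by force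
    have "\<bar>(qk k z - chi) * g z\<bar> \<le> mu * X"
      unfolding abs_mult X_def using mu(2)[of z] xs(2)[of z] z x xe mu0 by (intro mult_mono) auto
    then have "(1 - x) * \<bar>(qk k z - chi) * g z\<bar> \<le> (1 - x) * (mu * X)" using x by (intro mult_left_mono) auto
    moreover have "\<bar>pk k x * g1 x\<bar> = (1 - x) * \<bar>(qk k z - chi) * g z\<bar>"
    proof -
      have "pk k x * g1 x = - ((1 - x) * ((qk k z - chi) * g z))" using z(3) by simp
      then have "\<bar>pk k x * g1 x\<bar> = \<bar>1 - x\<bar> * \<bar>(qk k z - chi) * g z\<bar>" by (simp only: abs_minus_cancel abs_mult)
      then show ?thesis using x by simp
    qed
    ultimately show ?thesis by (simp add: mult_ac)
  qed simp
  have g1b: "\<bar>g1 x\<bar> \<le> 12 / 11 * (mu * X / kap)" if x: "xe \<le> x" "x < 1" for x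
  proof -
    have "(11 / 12 * kap * (1 - x)) * \<bar>g1 x\<bar> \<le> pk k x * \<bar>g1 x\<bar>" using pl[of x] x by (intro mult_right_mono) auto
    also have "\<dots> = \<bar>pk k x * g1 x\<bar>" using pk_pos[of x] x xe by (simp add: abs_mult)
    also have "\<dots> \<le> mu * X * (1 - x)" using flux[of x] x by simp
    finally have "(1 - x) * (11 / 12 * kap * \<bar>g1 x\<bar>) \<le> (1 - x) * (mu * X)" by (simp add: mult_ac)
    then have "11 / 12 * kap * \<bar>g1 x\<bar> \<le> mu * X" using x by simp
    then show ?thesis using kap_pos by (simp add: field_simps)
  qed
  \<comment> \<open>3/22 = 1/8 * 12/11 is the zone length times the slope bound. Absorbing it leaves
    the factor 22/19.\<close>
  have "X \<le> \<bar>g xe\<bar> + 3 / 22 * X"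
  proof (cases "xs = xe")
    case True
    then show ?thesis by (simp add: X_def)
  next
    case False
    then obtain z where z: "xe < z" "z < xs" "g xs - g xe = (xs - xe) * g1 z"
      using MVT2[of xe xs g g1] dg xs(1) by force
    have "\<bar>(xs - xe) * g1 z\<bar> \<le> kap / (8 * mu) * (12 / 11 * (mu * X / kap))"
      unfolding abs_mult using g1b[of z] z xs(1) mu0 kap_pos by (intro mult_mono) (auto simp: xe_def)
    also have "\<dots> = 3 / 22 * X" using mu0 kap_pos by simp
    finally show ?thesis using z(3) by (simp add: X_def)
  qed
  then have XX: "X \<le> 22 / 19 * \<bar>g xe\<bar>" by simp
  show "\<bar>g x\<bar> \<le> 22 / 19 * \<bar>g xe\<bar>" if "x \<in> {xe..1}" for x using xs(2)[OF that] XX by (simp add: X_def)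
  have "\<bar>pk k xe * g1 xe\<bar> \<le> mu * X * (kap / (8 * mu))" using flux[of xe] xe by (simp add: xe_def)
  also have "\<dots> = kap / 8 * X" using mu0 by simp
  also have "\<dots> \<le> kap / 8 * (22 / 19 * \<bar>g xe\<bar>)" using XX kap_pos by (intro mult_left_mono) auto
  finally show "\<bar>pk k xe * g1 xe\<bar> \<le> 11 / 76 * kap * \<bar>g xe\<bar>" by simp
qed

text \<open>\<open>W = p\<^sup>1\<^sup>/\<^sup>4 v\<^sub>z\<close>, so that \<open>g W = v v\<^sub>z\<close> and \<open>W\<^sup>2 / p\<^sup>1\<^sup>/\<^sup>2 = v\<^sub>z\<^sup>2\<close>.\<close>

definition "W x = pk k x * g1 x - k * sinh (k * x) / 4 * g x"

lemma DERIV_W: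
  assumes x: "x \<in> {-1<..<1}"
  shows "(W has_real_derivative - phi x * g x - k * sinh (k * x) / (4 * pk k x) * W x) (at x)"
proof -
  have p: "pk k x \<noteq> 0" using pk_pos[OF x] by simp
  have x': "x \<in> {-1..1}" using x by auto
  have ds: "((\<lambda>x. k * sinh (k * x) / 4) has_real_derivative k\<^sup>2 / 4 * cosh (k * x)) (at x)"
    by (auto intro!: derivative_eq_intros simp: power2_eq_square)
  have "(W has_real_derivative (qk k x - chi) * g x - (k\<^sup>2 / 4 * cosh (k * x) * g x + g1 x * (k * sinh (k * x) / 4))) (at x)"
    unfolding W_def[abs_def] by (rule DERIV_diff[OF DERIV_flux[OF x'] DERIV_mult[OF ds dg]])
  then show ?thesis
    by (rule DERIV_cong) (use p in \<open>simp add: phi_alt[OF x] W_def field_simps power2_eq_square\<close>)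
qed

section \<open>Sonin's monotone quantities\<close>

lemma DERIV_sqrt_pk:
  assumes x: "x \<in> {-1<..<1}"
  shows "((\<lambda>x. sqrt (pk k x)) has_real_derivative - (k * sinh (k * x)) / (2 * sqrt (pk k x))) (at x)"
  using DERIV_chain2[OF DERIV_real_sqrt[OF pk_pos[OF x]] DERIV_pk]
  by (rule DERIV_cong) (simp add: field_simps)

text \<open>The derivatives of v^2 and of v_z^2 are multiples of the same product v v_z, with ratio
  -phi. In both Sonin combinations these terms cancel and only the derivative of \<open>phi\<close>
  is left.\<close>

lemma DERIV_amplitude:
  assumes x: "x \<in> {-1<..<1}"
  shows "((\<lambda>x. sqrt (pk k x) * (g x)\<^sup>2) has_real_derivative 2 * (g x * W x / sqrt (pk k x))) (at x)"
    "((\<lambda>x. (W x)\<^sup>2 / sqrt (pk k x)) has_real_derivative - 2 * phi x * (g x * W x / sqrt (pk k x))) (at x)"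
proof -
  define r where "r = sqrt (pk k x)"
  have r: "r > 0" "pk k x = r * r" using pk_pos[OF x] by (simp_all add: r_def)
  have dg2: "((\<lambda>x. (g x)\<^sup>2) has_real_derivative 2 * g x * g1 x) (at x)"
    by (auto intro!: derivative_eq_intros dg)
  show "((\<lambda>x. sqrt (pk k x) * (g x)\<^sup>2) has_real_derivative 2 * (g x * W x / sqrt (pk k x))) (at x)"
    using DERIV_mult[OF DERIV_sqrt_pk[OF x] dg2] unfolding r_def[symmetric]
    by (rule DERIV_cong) (use r in \<open>simp add: W_def field_simps power2_eq_square\<close>)
  have dW: "((\<lambda>x. (W x)\<^sup>2) has_real_derivative 2 * W x * (- phi x * g x - k * sinh (k * x) / (4 * pk k x) * W x)) (at x)"
    by (auto intro!: derivative_eq_intros DERIV_W[OF x])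
  show "((\<lambda>x. (W x)\<^sup>2 / sqrt (pk k x)) has_real_derivative - 2 * phi x * (g x * W x / sqrt (pk k x))) (at x)"
    using DERIV_divide[OF dW DERIV_sqrt_pk[OF x]] r unfolding r_def[symmetric]
    by (rule_tac DERIV_cong, simp) (use r in \<open>simp add: field_simps power2_eq_square\<close>)
qed

definition "phi' x = k\<^sup>2 / 16 * ((A\<^sup>2 - 1) * (k * sinh (k * x)) / (pk k x)\<^sup>2)"

lemma DERIV_phi:
  assumes x: "x \<in> {-1<..<1}"
  shows "(phi has_real_derivative phi' x) (at x)"
proof -
  have p: "pk k x \<noteq> 0" using pk_pos[OF x] by simp
  have dn: "((\<lambda>x. A * cosh (k * x) - 1) has_real_derivative A * (k * sinh (k * x))) (at x)"
    by (auto intro!: derivative_eq_intros)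
  have "(phi has_real_derivative 0 + k\<^sup>2 / 16 * ((A * (k * sinh (k * x)) * pk k x - (A * cosh (k * x) - 1) * - (k * sinh (k * x))) / (pk k x * pk k x))) (at x)"
    unfolding phi_def[abs_def] by (intro DERIV_add DERIV_const DERIV_cmult DERIV_divide dn DERIV_pk p)
  moreover have "A * (k * sinh (k * x)) * pk k x - (A * cosh (k * x) - 1) * - (k * sinh (k * x)) = (A\<^sup>2 - 1) * (k * sinh (k * x))"
    by (simp add: pk_def A_def power2_eq_square algebra_simps)
  ultimately show ?thesis by (simp add: phi'_def power2_eq_square)
qed

lemma phi'_nonneg: "x \<in> {0..<1} \<Longrightarrow> 0 \<le> phi' x"
  unfolding phi'_def using A_ge_1 k by (intro mult_nonneg_nonneg divide_nonneg_nonneg) (auto simp: power2_eq_square mult_ge1_I)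

lemma phi_mono: "0 \<le> x \<Longrightarrow> x \<le> y \<Longrightarrow> y < 1 \<Longrightarrow> phi x \<le> phi y"
proof (rule DERIV_nonneg_imp_nondecreasing[where f = phi])
  fix t assume "0 \<le> x" "x \<le> t" "t \<le> y" "y < 1"
  then show "\<exists>z. (phi has_real_derivative z) (at t) \<and> 0 \<le> z"
    using DERIV_phi[of t] phi'_nonneg[of t] by (intro exI[of _ "phi' t"]) auto
qed

text \<open>The value at \<open>0\<close> of \<open>v\<^sup>2 + v\<^sub>z\<^sup>2 / \<phi>\<close>.\<close>

definition "S0 = sqrt (pk k 0) * (g 0)\<^sup>2 + (W 0)\<^sup>2 / sqrt (pk k 0) / omega2"

text \<open>v^2 + v_z^2 / phi has derivative -v_z^2 phi' / phi^2, so it decreases from its value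
  \<open>S0\<close> at the centre.\<close>

lemma amplitude_le:
  assumes x: "0 \<le> x" "x < 1"
  shows "sqrt (pk k x) * (g x)\<^sup>2 \<le> S0"
proof -
  let ?S = "\<lambda>x. sqrt (pk k x) * (g x)\<^sup>2 + ((W x)\<^sup>2 / sqrt (pk k x)) / phi x"
  have "?S x \<le> ?S 0"
  proof (rule DERIV_nonpos_imp_nonincreasing[OF x(1)])
    fix t assume t: "0 \<le> t" "t \<le> x"
    then have t': "t \<in> {-1<..<1}" using x by auto
    have ph: "phi t > 0" using phi_ge[OF t'] omega2_pos by linarith
    let ?Z = "g t * W t / sqrt (pk k t)"
    have "(?S has_real_derivative (2 * ?Z + (- 2 * phi t * ?Z * phi t - (W t)\<^sup>2 / sqrt (pk k t) * phi' t) / (phi t * phi t))) (at t)"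
      using ph by (intro DERIV_add DERIV_divide DERIV_amplitude t' DERIV_phi) auto
    moreover have "2 * ?Z + (- 2 * phi t * ?Z * phi t - (W t)\<^sup>2 / sqrt (pk k t) * phi' t) / (phi t * phi t)
        = - ((W t)\<^sup>2 / sqrt (pk k t) * phi' t / (phi t * phi t))"
      using ph by (simp add: field_simps)
    moreover have "0 \<le> (W t)\<^sup>2 / sqrt (pk k t) * phi' t / (phi t * phi t)"
      using phi'_nonneg[of t] t x pk_pos[OF t'] ph by (intro divide_nonneg_nonneg mult_nonneg_nonneg) auto
    ultimately show "\<exists>y. (?S has_real_derivative y) (at t) \<and> y \<le> 0" by (intro exI conjI) auto
  qed
  moreover have "0 \<le> ((W x)\<^sup>2 / sqrt (pk k x)) / phi x"
    using phi_ge[of x] omega2_pos pk_pos[of x] x by (intro divide_nonneg_nonneg) auto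
  ultimately show ?thesis by (simp add: S0_def phi_0)
qed

text \<open>phi v^2 + v_z^2 has derivative phi' v^2, so it increases from
  \<open>omega2 * S0\<close>.\<close>

lemma energy_ge:
  assumes x: "0 \<le> x" "x < 1"
  shows "omega2 * S0 \<le> phi x * (sqrt (pk k x) * (g x)\<^sup>2) + (W x)\<^sup>2 / sqrt (pk k x)"
proof -
  let ?T = "\<lambda>x. phi x * (sqrt (pk k x) * (g x)\<^sup>2) + (W x)\<^sup>2 / sqrt (pk k x)"
  have "?T 0 \<le> ?T x"
  proof (rule DERIV_nonneg_imp_nondecreasing[OF x(1)])
    fix t assume t: "0 \<le> t" "t \<le> x"
    then have t': "t \<in> {-1<..<1}" using x by auto
    let ?Z = "g t * W t / sqrt (pk k t)"
    have "(?T has_real_derivative (phi' t * (sqrt (pk k t) * (g t)\<^sup>2) + 2 * ?Z * phi t) + - 2 * phi t * ?Z) (at t)"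
      by (intro DERIV_add DERIV_mult DERIV_amplitude t' DERIV_phi)
    moreover have "0 \<le> phi' t * (sqrt (pk k t) * (g t)\<^sup>2)"
      using phi'_nonneg[of t] t x pk_pos[OF t'] by (intro mult_nonneg_nonneg) auto
    ultimately show "\<exists>y. (?T has_real_derivative y) (at t) \<and> 0 \<le> y" by (intro exI conjI) auto
  qed
  moreover have "?T 0 = omega2 * S0" using omega2_pos by (simp add: S0_def phi_0 algebra_simps)
  ultimately show ?thesis by simp
qed

text \<open>In Liouville's form, (v v_z)_z = v_z^2 - phi v^2. It trades the kinetic term for the
  potential one under the integral.\<close>

lemma DERIV_gW:
  assumes x: "x \<in> {-1<..<1}"
  shows "((\<lambda>x. g x * W x) has_real_derivative (W x)\<^sup>2 / pk k x - phi x * (g x)\<^sup>2) (at x)"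
  using DERIV_mult[OF dg DERIV_W[OF x]]
  by (rule DERIV_cong) (use pk_pos[OF x] in \<open>simp add: W_def field_simps power2_eq_square\<close>)

lemma S0_nonneg: "0 \<le> S0"
  unfolding S0_def using pk_pos[of 0] omega2_pos
  by (intro add_nonneg_nonneg mult_nonneg_nonneg divide_nonneg_nonneg) auto

text \<open>Integrate \<open>energy_ge\<close> against 1 / sqrt p up to \<open>xe\<close>. By
  \<open>DERIV_gW\<close> the right side becomes twice the integral of phi g^2 plus the boundary
  term g W, which is 0 at the centre and nonpositive at \<open>xe\<close>. Finally phi <= phi(xe),
  and g has at most mass 1/2 there.\<close>

lemma S0_le:
  assumes xe: "0 < xe" "xe < 1" and gW: "g xe * W xe \<le> 0"
  shows "omega2 * S0 * sqrt (2 / kap) * arcsin xe \<le> phi xe"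
proof -
  let ?c = "omega2 * S0 * sqrt (2 / kap)"
  have h1: "((\<lambda>x. (W x)\<^sup>2 / pk k x - phi x * (g x)\<^sup>2) has_integral (g xe * W xe - g 0 * W 0)) {0..xe}"
    using xe by (intro fundamental_theorem_of_calculus)
      (auto intro!: has_field_derivative_at_within[OF DERIV_gW] simp flip: has_real_derivative_iff_has_vector_derivative)
  have h2: "((\<lambda>x. inverse (sqrt (1 - x\<^sup>2))) has_integral (arcsin xe - arcsin 0)) {0..xe}"
    using xe by (intro fundamental_theorem_of_calculus)
      (auto intro!: has_field_derivative_at_within[OF DERIV_arcsin] simp flip: has_real_derivative_iff_has_vector_derivative)
  define J where "J = integral {0..xe} (\<lambda>x. (g x)\<^sup>2)"
  have h3: "((\<lambda>x. (g x)\<^sup>2) has_integral J) {0..xe}"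
    unfolding J_def by (intro integrable_integral integrable_continuous_real continuous_intros)
  have J: "J \<le> 1 / 2"
    unfolding J_def half_mass[symmetric] using xe
    by (intro integral_subset_le integrable_continuous_real continuous_intros) auto
  have h4: "((\<lambda>x. ?c * inverse (sqrt (1 - x\<^sup>2)) - (2 * phi xe) * (g x)\<^sup>2) has_integral (?c * (arcsin xe - arcsin 0) - (2 * phi xe) * J)) {0..xe}"
    by (intro has_integral_diff has_integral_mult_right h2 h3)
  have "?c * (arcsin xe - arcsin 0) - (2 * phi xe) * J \<le> g xe * W xe - g 0 * W 0"
  proof (rule has_integral_le[OF h4 h1])
    fix x assume "x \<in> {0..xe}"
    then have x: "0 \<le> x" "x \<le> xe" "x < 1" "x \<in> {-1<..<1}" using xe by auto
    define r where "r = sqrt (pk k x)"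
    have r: "r > 0" "pk k x = r * r" using pk_pos[OF x(4)] by (simp_all add: r_def)
    have "sqrt (2 / kap) * inverse (sqrt (1 - x\<^sup>2)) \<le> 1 / r"
      using inverse_sqrt_pk_ge[OF x(4)] unfolding sqrt_2_kap r_def
      by (simp only: divide_inverse inverse_mult_distrib mult_1_left)
    then have "(omega2 * S0) * (sqrt (2 / kap) * inverse (sqrt (1 - x\<^sup>2))) \<le> (omega2 * S0) * (1 / r)"
      using omega2_pos S0_nonneg by (intro mult_left_mono) auto
    also have "\<dots> \<le> (phi x * (r * (g x)\<^sup>2) + (W x)\<^sup>2 / r) * (1 / r)"
      using energy_ge[OF x(1,3)] r unfolding r_def[symmetric] by (intro mult_right_mono) auto
    also have "\<dots> = phi x * (g x)\<^sup>2 + (W x)\<^sup>2 / pk k x" using r by (simp add: field_simps)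
    finally have 1: "?c * inverse (sqrt (1 - x\<^sup>2)) \<le> phi x * (g x)\<^sup>2 + (W x)\<^sup>2 / pk k x" by (simp add: mult_ac)
    have "phi x * (g x)\<^sup>2 \<le> phi xe * (g x)\<^sup>2" using phi_mono[OF x(1,2)] xe by (intro mult_right_mono) auto
    then show "?c * inverse (sqrt (1 - x\<^sup>2)) - (2 * phi xe) * (g x)\<^sup>2 \<le> (W x)\<^sup>2 / pk k x - phi x * (g x)\<^sup>2"
      using 1 by linarith
  qed
  moreover have "g 0 * W 0 = 0" using g_g1_0 by (auto simp: W_def)
  moreover have "(2 * phi xe) * J \<le> (2 * phi xe) * (1 / 2)"
    using J phi_ge[of xe] omega2_pos xe by (intro mult_left_mono) auto
  ultimately show ?thesis using gW by simp
qed

section \<open>Sup-norm bounds for large and for small \<chi>\<close>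

lemma sup_from_edge:
  assumes mu: "3 / 4 * k\<^sup>2 * A \<le> mu" "\<And>x. x \<in> {-1..1} \<Longrightarrow> \<bar>qk k x - chi\<bar> \<le> mu"
    and b: "\<And>y. 0 \<le> y \<Longrightarrow> y \<le> 1 - kap / (8 * mu) \<Longrightarrow> (g y)\<^sup>2 \<le> B"
    and x: "x \<in> {-1..1}"
  shows "(g x)\<^sup>2 \<le> 484 / 361 * B"
proof -
  define xe where "xe = 1 - kap / (8 * mu)"
  note e = edge[OF mu, folded xe_def]
  have B: "(g xe)\<^sup>2 \<le> B" using e(1,2) by (intro b) (auto simp: xe_def)
  then have B0: "0 \<le> B" using zero_le_power2[of "g xe"] by linarith
  have "(g y)\<^sup>2 \<le> 484 / 361 * B" if y: "0 \<le> y" "y \<le> 1" for y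
  proof (cases "y \<le> xe")
    case True
    then have "(g y)\<^sup>2 \<le> B" using y by (intro b) (auto simp: xe_def)
    then show ?thesis using B0 by linarith
  next
    case False
    then have "\<bar>g y\<bar> \<le> 22 / 19 * \<bar>g xe\<bar>" using y by (intro e(5)) auto
    then have "\<bar>g y\<bar>\<^sup>2 \<le> (22 / 19 * \<bar>g xe\<bar>)\<^sup>2" by (intro power_mono) auto
    then have "(g y)\<^sup>2 \<le> 484 / 361 * (g xe)\<^sup>2" by (simp add: power_mult_distrib power_divide)
    then show ?thesis using B by linarith
  qed
  from this[of "\<bar>x\<bar>"] show ?thesis using x parity[OF x] by (cases "x \<ge> 0") auto
qed

lemma pk_edge_ge:
  assumes mu: "3 / 4 * k\<^sup>2 * A \<le> mu" "\<And>x. x \<in> {-1..1} \<Longrightarrow> \<bar>qk k x - chi\<bar> \<le> mu"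
  shows "11 / 96 * kap\<^sup>2 \<le> pk k (1 - kap / (8 * mu)) * mu" "0 < mu"
proof -
  have "0 < k\<^sup>2 * A" using k A_ge_1 by simp
  then show mu0: "mu > 0" using mu(1) by linarith
  have "11 / 12 * kap * (kap / (8 * mu)) * mu \<le> pk k (1 - kap / (8 * mu)) * mu"
    using edge(3)[OF mu] mu0 by (intro mult_right_mono) auto
  then show "11 / 96 * kap\<^sup>2 \<le> pk k (1 - kap / (8 * mu)) * mu"
    using mu0 by (simp add: power2_eq_square)
qed

text \<open>Split A cosh (k x) - 1 into p and (A + 1)(cosh (k x) - 1). The second part is at most
  A^2 - 1 = (sinh k)^2, which yields kap^2.\<close>

lemma phi_le:
  assumes x: "x \<in> {-1<..<1}"
  shows "phi x \<le> omega2 + kap\<^sup>2 / 16 / pk k x"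
proof -
  have p: "pk k x > 0" using pk_pos[OF x] .
  have "cosh (k * x) \<le> A" using x by (intro cosh_le_A) auto
  then have "k\<^sup>2 * ((A + 1) * (cosh (k * x) - 1)) \<le> k\<^sup>2 * ((A + 1) * (A - 1))"
    using A_ge_1 by (intro mult_left_mono) auto
  also have "(A + 1) * (A - 1) = (sinh k)\<^sup>2"
    unfolding sinh_square_eq[of k] by (simp add: A_def power2_eq_square algebra_simps)
  finally have le: "k\<^sup>2 * ((A + 1) * (cosh (k * x) - 1)) \<le> kap\<^sup>2" by (simp add: kap_def power_mult_distrib)
  have "A * cosh (k * x) - 1 = pk k x + (A + 1) * (cosh (k * x) - 1)" by (simp add: pk_def A_def algebra_simps)
  then have "phi x = omega2 + k\<^sup>2 * ((A + 1) * (cosh (k * x) - 1)) / 16 / pk k x"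
    using p by (simp add: phi_def omega2_def field_simps)
  also have "\<dots> \<le> omega2 + kap\<^sup>2 / 16 / pk k x" using le p by (intro add_left_mono divide_right_mono) auto
  finally show ?thesis .
qed

text \<open>Up to \<open>xe\<close> Sonin's quantity gives g^2 <= S0 / sqrt P. With u = sqrt (kap /
  2) and w = sqrt chi one has S0 <= 1.578 u, sqrt P >= 0.676 u^2 / w and w <= (m + 1) u, hence g^2
  <= 2.335 (m + 1). The edge zone costs the factor 484/361 = (22/19)^2.\<close>

lemma sup_high_energy:
  assumes chi: "3 / 4 * k\<^sup>2 * A \<le> chi"
    and Z: "finite {x\<in>{-1<..<1}. g x = 0}" "card {x\<in>{-1<..<1}. g x = 0} \<le> m"
    and x: "x \<in> {-1..1}"
  shows "(g x)\<^sup>2 \<le> 314 / 100 * (real m + 1)"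
proof -
  have mu: "\<bar>qk k x - chi\<bar> \<le> chi" if "x \<in> {-1..1}" for x
    using qk_bounds[OF that] chi A_ge_1 by (simp add: abs_le_iff)
  define xe P where "xe = 1 - kap / (8 * chi)" and "P = pk k xe"
  note e = edge[OF chi mu, folded xe_def]
  have P: "11 / 96 * kap\<^sup>2 \<le> P * chi" "0 < chi" using pk_edge_ge[OF chi mu] by (simp_all add: P_def xe_def)
  have xe: "xe \<in> {-1<..<1}" "0 < xe" "xe < 1" using e(1,2) by auto
  have P0: "P > 0" using pk_pos[OF xe(1)] by (simp add: P_def)
  \<comment> \<open>The flux contributes at most 11/76, less than the 5/24 = (5/6) / 4 of the other
    term of \<open>W\<close>.\<close>
  have gW: "g xe * W xe \<le> 0"
  proof -
    have "g xe * (pk k xe * g1 xe) \<le> \<bar>g xe\<bar> * \<bar>pk k xe * g1 xe\<bar>" by (metis abs_ge_self abs_mult)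
    also have "\<dots> \<le> \<bar>g xe\<bar> * (11 / 76 * kap * \<bar>g xe\<bar>)" using e(6) by (intro mult_left_mono) auto
    also have "\<dots> = 11 / 76 * (kap * (g xe)\<^sup>2)" by (simp add: power2_eq_square)
    finally have 1: "g xe * (pk k xe * g1 xe) \<le> 11 / 76 * (kap * (g xe)\<^sup>2)" .
    have "5 / 6 * kap * (g xe)\<^sup>2 \<le> k * sinh (k * xe) * (g xe)\<^sup>2" using e(4) by (intro mult_right_mono) auto
    moreover have "g xe * W xe = g xe * (pk k xe * g1 xe) - k * sinh (k * xe) * (g xe)\<^sup>2 / 4"
      by (simp add: W_def power2_eq_square algebra_simps)
    moreover have "0 \<le> kap * (g xe)\<^sup>2" using kap_pos by simp
    moreover have "5 / 6 * kap * (g xe)\<^sup>2 = 5 / 6 * (kap * (g xe)\<^sup>2)" by simp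
    ultimately show ?thesis using 1 by linarith
  qed
  \<comment> \<open>6/11 = (1/16) / (11/96): with chi above the threshold, the singular part of phi
    at \<open>xe\<close> is still comparable with chi.\<close>
  have "phi xe \<le> 17 / 11 * omega2"
  proof -
    have "kap\<^sup>2 / 16 / P \<le> 6 / 11 * chi" using P P0 by (simp add: field_simps)
    moreover have "chi \<le> omega2" by (simp add: omega2_def)
    ultimately show ?thesis using phi_le[OF xe(1)] unfolding P_def[symmetric] by linarith
  qed
  then have "omega2 * (S0 * sqrt (2 / kap) * arcsin xe) \<le> omega2 * (17 / 11)"
    using S0_le[OF xe(2,3) gW] by (simp add: mult_ac)
  then have 1: "S0 * sqrt (2 / kap) * arcsin xe \<le> 17 / 11" using omega2_pos by simp
  have "arcsin (5 / 6) \<le> arcsin xe" using e(1,2) by (intro arcsin_le_arcsin) auto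
  then have "49 / 50 \<le> arcsin xe" using arcsin_five_sixths by linarith
  then have "S0 * sqrt (2 / kap) * (49 / 50) \<le> S0 * sqrt (2 / kap) * arcsin xe"
    using S0_nonneg kap_pos by (intro mult_left_mono) auto
  then have 2: "S0 * sqrt (2 / kap) \<le> 1578 / 1000" using 1 by linarith
  define u where "u = sqrt (kap / 2)"
  have u: "u > 0" "kap = 2 * u\<^sup>2" using kap_pos by (simp_all add: u_def)
  have "S0 * sqrt (2 / kap) * u \<le> 1578 / 1000 * u" using 2 u by (intro mult_right_mono) auto
  then have S: "S0 \<le> 1578 / 1000 * u" using u(1) unfolding sqrt_2_kap u_def[symmetric] by (simp add: field_simps)
  define w where "w = sqrt chi"
  have w: "w > 0" "w\<^sup>2 = chi" using P(2) by (simp_all add: w_def)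
  have wu: "w \<le> (real m + 1) * u"
  proof -
    have "w \<le> sqrt omega2" unfolding w_def omega2_def by (intro real_sqrt_le_mono) simp
    then show ?thesis using omega_le_zeros[OF Z] by (simp add: u_def)
  qed
  have rP: "676 / 1000 * u\<^sup>2 \<le> sqrt P * w"
  proof -
    have "(676 / 1000 * u\<^sup>2)\<^sup>2 = 456976 / 1000000 * (u\<^sup>2)\<^sup>2" "11 / 96 * kap\<^sup>2 = 11 / 24 * (u\<^sup>2)\<^sup>2"
      unfolding u(2) by (simp_all add: power_mult_distrib power_divide)
    then have "(676 / 1000 * u\<^sup>2)\<^sup>2 \<le> 11 / 96 * kap\<^sup>2" using zero_le_power2[of "u\<^sup>2"] by linarith
    also have "\<dots> \<le> (sqrt P * w)\<^sup>2" using P(1) P0 w(2) by (simp add: power_mult_distrib)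
    finally show ?thesis by (rule power2_le_imp_le) (use P0 w(1) in simp)
  qed
  have B: "(g y)\<^sup>2 \<le> 2335 / 1000 * (real m + 1)" if y: "0 \<le> y" "y \<le> 1 - kap / (8 * chi)" for y
  proof -
    have y': "y \<le> xe" using y by (simp add: xe_def)
    have "sqrt P * (g y)\<^sup>2 \<le> sqrt (pk k y) * (g y)\<^sup>2"
      unfolding P_def using y' y xe by (intro mult_right_mono real_sqrt_le_mono pk_antimono) auto
    also have "\<dots> \<le> 1578 / 1000 * u" using amplitude_le[of y] S y y' xe by simp
    finally have "sqrt P * (g y)\<^sup>2 * w \<le> 1578 / 1000 * u * ((real m + 1) * u)"
      using wu w(1) u(1) by (rule_tac mult_mono) auto
    moreover have "676 / 1000 * u\<^sup>2 * (g y)\<^sup>2 \<le> sqrt P * w * (g y)\<^sup>2" using rP by (intro mult_right_mono) auto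
    ultimately have "u\<^sup>2 * (676 / 1000 * (g y)\<^sup>2) \<le> u\<^sup>2 * (1578 / 1000 * (real m + 1))"
      by (simp add: power2_eq_square mult_ac)
    then have "676 / 1000 * (g y)\<^sup>2 \<le> 1578 / 1000 * (real m + 1)" using u(1) by simp
    then show ?thesis by simp
  qed
  have "(g x)\<^sup>2 \<le> 484 / 361 * (2335 / 1000 * (real m + 1))"
    by (rule sup_from_edge[OF chi mu B x])
  also have "\<dots> \<le> 314 / 100 * (real m + 1)" by simp
  finally show ?thesis .
qed

text \<open>Here the threshold value \<open>mu\<close> sets the edge zone in place of chi. The
  oscillation of g^2 up to \<open>xe\<close> is at most the integral of |2 g g'|, bounded by mass
  and energy, and the minimum of g^2 there is small because the mass is at most 1/2.\<close>

lemma sup_low_energy: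
  assumes chi: "chi \<le> 3 / 4 * k\<^sup>2 * A" and x: "x \<in> {-1..1}"
  shows "(g x)\<^sup>2 \<le> 81 / 100 + 298 / 100 * sqrt (1 + k\<^sup>2)"
proof -
  define mu where "mu = 3 / 4 * k\<^sup>2 * A"
  have m1: "3 / 4 * k\<^sup>2 * A \<le> mu" by (simp add: mu_def)
  have m2: "\<bar>qk k x - chi\<bar> \<le> mu" if "x \<in> {-1..1}" for x
  proof -
    have "0 \<le> k\<^sup>2 * A" using A_ge_1 by simp
    then show ?thesis using qk_bounds[OF that] chi energy(2) unfolding mu_def abs_le_iff by linarith
  qed
  define xe P where "xe = 1 - kap / (8 * mu)" and "P = pk k xe"
  note e = edge[OF m1 m2, folded xe_def]
  have P: "11 / 96 * kap\<^sup>2 \<le> P * mu" "0 < mu" using pk_edge_ge[OF m1 m2] by (simp_all add: P_def xe_def)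
  have xe: "xe \<in> {-1<..<1}" "0 < xe" "xe < 1" using e(1,2) by auto
  have P0: "P > 0" using pk_pos[OF xe(1)] by (simp add: P_def)
  \<comment> \<open>The weight in 2 |g g'| <= tau g^2 + g'^2 / tau that makes the mass and the
    energy contribute tau / 2 each.\<close>
  define tau where "tau = sqrt (mu / P)"
  have tau: "tau > 0" "tau\<^sup>2 = mu / P" using P(2) P0 by (simp_all add: tau_def)
  \<comment> \<open>From k <= sinh k follows (k cosh k)^2 <= (1 + k^2) (sinh k)^2, and 2.216^2
    exceeds 9/16 * 96/11.\<close>
  have tau_le: "tau \<le> 2216 / 1000 * sqrt (1 + k\<^sup>2)"
  proof -
    have "sinh 0 - 0 \<le> sinh k - k"
    proof (rule DERIV_nonneg_imp_nondecreasing[where f = "\<lambda>x. sinh x - x"])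
      show "\<exists>y. ((\<lambda>x. sinh x - x) has_real_derivative y) (at x) \<and> 0 \<le> y" for x :: real
        using cosh_real_ge_1[of x] by (intro exI[of _ "cosh x - 1"]) (auto intro!: derivative_eq_intros)
    qed (use k in simp)
    then have "k \<le> sinh k" by simp
    then have "k\<^sup>2 \<le> (sinh k)\<^sup>2" using k by (intro power_mono) auto
    then have "k\<^sup>2 * A\<^sup>2 \<le> (1 + k\<^sup>2) * (sinh k)\<^sup>2" by (simp add: A_def cosh_square_eq algebra_simps)
    then have "k\<^sup>2 * (k\<^sup>2 * A\<^sup>2) \<le> k\<^sup>2 * ((1 + k\<^sup>2) * (sinh k)\<^sup>2)" by (intro mult_left_mono) auto
    moreover have "mu * mu = 9 / 16 * (k\<^sup>2 * (k\<^sup>2 * A\<^sup>2))" by (simp add: mu_def power2_eq_square)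
    moreover have "k\<^sup>2 * ((1 + k\<^sup>2) * (sinh k)\<^sup>2) = (1 + k\<^sup>2) * kap\<^sup>2"
      by (simp add: kap_def power_mult_distrib)
    moreover have "(9 / 16 * (96 / 11)) * (1 + k\<^sup>2) * (11 / 96 * kap\<^sup>2) = 9 / 16 * ((1 + k\<^sup>2) * kap\<^sup>2)"
      by simp
    ultimately have "mu * mu \<le> (9 / 16 * (96 / 11)) * (1 + k\<^sup>2) * (11 / 96 * kap\<^sup>2)" by linarith
    also have "\<dots> \<le> (9 / 16 * (96 / 11)) * (1 + k\<^sup>2) * (P * mu)" using P(1) by (intro mult_left_mono) auto
    finally have "mu * mu \<le> ((9 / 16 * (96 / 11)) * (1 + k\<^sup>2) * P) * mu" by (simp add: mult_ac)
    then have "mu \<le> (9 / 16 * (96 / 11)) * (1 + k\<^sup>2) * P" using P(2) by simp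
    then have "tau\<^sup>2 \<le> (9 / 16 * (96 / 11)) * (1 + k\<^sup>2)" using P0 tau(2) by (simp add: divide_le_eq)
    also have "\<dots> \<le> (2216 / 1000 * sqrt (1 + k\<^sup>2))\<^sup>2"
      by (simp add: power_mult_distrib) (simp add: power2_eq_square)
    finally show ?thesis by (rule power2_le_imp_le) simp
  qed
  let ?E = "\<lambda>x. tau * (g x)\<^sup>2 + 1 / (tau * P) * (pk k x * (g1 x)\<^sup>2)"
  have iE: "?E integrable_on {a..b}" for a b
    by (intro integrable_continuous_real continuous_intros)
  have i2: "(\<lambda>x. (g x)\<^sup>2) integrable_on {a..b}" "(\<lambda>x. pk k x * (g1 x)\<^sup>2) integrable_on {a..b}" for a b
    by (intro integrable_continuous_real continuous_intros)+
  have pk0: "0 \<le> pk k x" if "x \<in> {0..1}" for x using cosh_le_A[of x] that by (simp add: pk_def A_def)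
  have Etot: "integral {0..xe} ?E \<le> tau"
  proof -
    have "integral {0..xe} ?E = tau * integral {0..xe} (\<lambda>x. (g x)\<^sup>2) + 1 / (tau * P) * integral {0..xe} (\<lambda>x. pk k x * (g1 x)\<^sup>2)"
      by (simp only: integral_add integrable_on_mult_right i2 integral_mult_right)
    also have "\<dots> \<le> tau * (1 / 2) + 1 / (tau * P) * (mu / 2)"
    proof (intro add_mono mult_left_mono)
      show "integral {0..xe} (\<lambda>x. (g x)\<^sup>2) \<le> 1 / 2"
        unfolding half_mass[symmetric] using xe by (intro integral_subset_le i2) auto
      have "integral {0..xe} (\<lambda>x. pk k x * (g1 x)\<^sup>2) \<le> integral {0..1} (\<lambda>x. pk k x * (g1 x)\<^sup>2)"
        using xe pk0 by (intro integral_subset_le i2) auto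
      then show "integral {0..xe} (\<lambda>x. pk k x * (g1 x)\<^sup>2) \<le> mu / 2"
        using energy(1) chi by (simp add: mu_def)
    qed (use tau P0 in auto)
    also have "1 / (tau * P) * (mu / 2) = tau * (1 / 2)"
      using tau P0 by (simp add: field_simps power2_eq_square)
    finally show ?thesis by simp
  qed
  have gg1: "\<bar>2 * g t * g1 t\<bar> \<le> ?E t" if "t \<in> {0..xe}" for t
  proof -
    have "P \<le> pk k t" unfolding P_def using that xe by (intro pk_antimono) auto
    then have "1 / (tau * P) * (P * (g1 t)\<^sup>2) \<le> 1 / (tau * P) * (pk k t * (g1 t)\<^sup>2)"
      using tau P0 by (intro mult_left_mono mult_right_mono) auto
    moreover have "1 / (tau * P) * (P * (g1 t)\<^sup>2) = (g1 t)\<^sup>2 / tau" using P0 by simp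
    moreover have "\<bar>2 * g t * g1 t\<bar> \<le> tau * (g t)\<^sup>2 + (g1 t)\<^sup>2 / tau"
    proof -
      have "0 \<le> (tau * \<bar>g t\<bar> - \<bar>g1 t\<bar>)\<^sup>2" by simp
      then have "2 * \<bar>g t\<bar> * \<bar>g1 t\<bar> * tau \<le> (tau * (g t)\<^sup>2 + (g1 t)\<^sup>2 / tau) * tau"
        using tau by (simp add: power2_diff power2_eq_square algebra_simps)
      then show ?thesis using tau by (simp add: abs_mult)
    qed
    ultimately show ?thesis by linarith
  qed
  have dg2: "((\<lambda>x. (g x)\<^sup>2) has_real_derivative 2 * g x * g1 x) (at x)" for x
    by (auto intro!: derivative_eq_intros dg)
  have osc: "\<bar>(g v)\<^sup>2 - (g u)\<^sup>2\<bar> \<le> tau" if uv: "0 \<le> u" "u \<le> v" "v \<le> xe" for u v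
  proof -
    have "((\<lambda>x. 2 * g x * g1 x) has_integral ((g v)\<^sup>2 - (g u)\<^sup>2)) {u..v}"
      using uv by (intro fundamental_theorem_of_calculus)
        (auto intro!: has_field_derivative_at_within[OF dg2] simp flip: has_real_derivative_iff_has_vector_derivative)
    then have "(g v)\<^sup>2 - (g u)\<^sup>2 = integral {u..v} (\<lambda>x. 2 * g x * g1 x)" by (simp add: integral_unique)
    moreover have "norm (integral {u..v} (\<lambda>x. 2 * g x * g1 x)) \<le> integral {u..v} ?E"
      using gg1 uv by (intro integral_norm_bound_integral iE integrable_continuous_real continuous_intros) auto
    moreover have "integral {u..v} ?E \<le> integral {0..xe} ?E"
    proof (rule integral_subset_le)
      show "\<forall>t\<in>{0..xe}. 0 \<le> ?E t" using gg1 order_trans[OF abs_ge_zero] by blast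
    qed (use uv iE in auto)
    ultimately show ?thesis using Etot by simp
  qed
  have "\<exists>y\<in>{0..xe}. \<forall>t\<in>{0..xe}. (g y)\<^sup>2 \<le> (g t)\<^sup>2"
    using xe by (intro continuous_attains_inf) (auto intro!: continuous_intros)
  then obtain y where y: "y \<in> {0..xe}" "\<And>t. t \<in> {0..xe} \<Longrightarrow> (g y)\<^sup>2 \<le> (g t)\<^sup>2" by blast
  have "integral {0..xe} (\<lambda>t. (g y)\<^sup>2) \<le> integral {0..xe} (\<lambda>x. (g x)\<^sup>2)"
    using y(2) by (intro integral_le i2 integrable_continuous_real continuous_intros) auto
  also have "\<dots> \<le> 1 / 2"
    unfolding half_mass[symmetric] using xe by (intro integral_subset_le i2) auto
  finally have "xe * (g y)\<^sup>2 \<le> 1 / 2" using xe by simp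
  moreover have "5 / 6 * (g y)\<^sup>2 \<le> xe * (g y)\<^sup>2" using e(1) by (intro mult_right_mono) auto
  ultimately have y2: "(g y)\<^sup>2 \<le> 3 / 5" by linarith
  have B: "(g t)\<^sup>2 \<le> 3 / 5 + 2216 / 1000 * sqrt (1 + k\<^sup>2)" if t: "0 \<le> t" "t \<le> 1 - kap / (8 * mu)" for t
  proof -
    have t': "t \<le> xe" using t by (simp add: xe_def)
    have "\<bar>(g t)\<^sup>2 - (g y)\<^sup>2\<bar> \<le> tau"
    proof (cases "t \<le> y")
      case True
      then show ?thesis using osc[of t y] t y(1) by (simp add: abs_minus_commute)
    next
      case False
      then show ?thesis using osc[of y t] t' y(1) by simp
    qed
    then show ?thesis using y2 tau_le by linarith
  qed
  have "(g x)\<^sup>2 \<le> 484 / 361 * (3 / 5 + 2216 / 1000 * sqrt (1 + k\<^sup>2))"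
    by (rule sup_from_edge[OF m1 m2 B x])
  moreover have "484 / 361 * (3 / 5 + 2216 / 1000 * r) \<le> 81 / 100 + 298 / 100 * r" if "0 \<le> r" for r :: real
    using that by (simp add: field_simps)
  ultimately show ?thesis by (rule order_trans) simp
qed

end

section \<open>The constants of the theorem\<close>

text \<open>Compare sin (pi / 6) = 1/2 with Taylor bounds for sin at 0.52 and 0.525.\<close>

lemma pi_bounds: "312 / 100 \<le> pi" "pi \<le> 315 / 100"
proof -
  have s: "\<bar>sin x - (\<Sum>m<5. sin_coeff m * x ^ m)\<bar> \<le> inverse (fact 5) * \<bar>x\<bar> ^ 5" for x
    by (rule Maclaurin_sin_bound)
  have "sin (52 / 100) \<le> (\<Sum>m<5. sin_coeff m * (52 / 100) ^ m) + inverse (fact 5) * \<bar>52 / 100\<bar> ^ 5"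
    using s[of "52 / 100"] by linarith
  also have "\<dots> \<le> 1 / 2" by (simp add: sin_coeff_def lessThan_nat_numeral fact_numeral power_divide)
  finally have "sin (52 / 100) \<le> sin (pi / 6)" by (simp add: sin_30)
  then show "312 / 100 \<le> pi"
    using sin_monotone_2pi[of "pi / 6" "52 / 100"] pi_gt3 pi_less_4 by (cases "pi / 6 < 52 / 100") auto
  have "1 / 2 \<le> (\<Sum>m<5. sin_coeff m * (525 / 1000) ^ m) - inverse (fact 5) * \<bar>525 / 1000 :: real\<bar> ^ 5"
    by (simp add: sin_coeff_def lessThan_nat_numeral fact_numeral power_divide)
  also have "\<dots> \<le> sin (525 / 1000)" using s[of "525 / 1000"] by linarith
  finally have "sin (pi / 6) \<le> sin (525 / 1000)" by (simp add: sin_30)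
  then show "pi \<le> 315 / 100"
    using sin_monotone_2pi[of "525 / 1000" "pi / 6"] pi_gt3 pi_less_4 by (cases "525 / 1000 < pi / 6") auto
qed

definition "prefactor c = pi / exp (2 * c) * (1 + 4 * c\<^sup>2 / 3) powr (1/2) * (sinh (4 * c) / (4 * c)) powr (1/4)
      * cosh (2 * c) powr (1/2)"

text \<open>The difference of the two sides has derivative (x / 3)(x cosh x - sinh x), which is
  nonnegative.\<close>

lemma tanh_lower:
  fixes x :: real
  assumes "x \<ge> 0"
  shows "x * cosh x \<le> (1 + x\<^sup>2 / 3) * sinh x"
proof -
  have 1: "sinh x \<le> x * cosh x" if "x \<ge> 0" for x :: real
  proof -
    have "0 * cosh 0 - sinh 0 \<le> x * cosh x - sinh x"
    proof (rule DERIV_nonneg_imp_nondecreasing[where f = "\<lambda>x. x * cosh x - sinh x", OF that])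
      fix t :: real assume "0 \<le> t"
      then show "\<exists>y. ((\<lambda>x. x * cosh x - sinh x) has_real_derivative y) (at t) \<and> 0 \<le> y"
        by (intro exI[of _ "t * sinh t"]) (auto intro!: derivative_eq_intros)
    qed
    then show ?thesis by simp
  qed
  have "(1 + 0\<^sup>2 / 3) * sinh 0 - 0 * cosh 0 \<le> (1 + x\<^sup>2 / 3) * sinh x - x * cosh x"
  proof (rule DERIV_nonneg_imp_nondecreasing[where f = "\<lambda>x. (1 + x\<^sup>2 / 3) * sinh x - x * cosh x", OF assms])
    fix t :: real assume t: "0 \<le> t"
    have "((\<lambda>x. (1 + x\<^sup>2 / 3) * sinh x - x * cosh x) has_real_derivative t / 3 * (t * cosh t - sinh t)) (at t)"
      by (auto intro!: derivative_eq_intros simp: power2_eq_square field_simps)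
    then show "\<exists>y. ((\<lambda>x. (1 + x\<^sup>2 / 3) * sinh x - x * cosh x) has_real_derivative y) (at t) \<and> 0 \<le> y"
      using 1[OF t] t by (intro exI[of _ "t / 3 * (t * cosh t - sinh t)"] conjI) auto
  qed
  then show ?thesis by simp
qed

lemma quadratic_exp_lower:
  fixes y :: real
  assumes y: "y \<ge> 0"
  shows "196 / 100 \<le> (1 + y\<^sup>2 / 12) * (1 + exp (- y)) ^ 4"
proof (cases "y \<le> 34 / 10")
  case False
  then have "(34 / 10)\<^sup>2 \<le> y\<^sup>2" by (intro power_mono) auto
  then have 1: "196 / 100 \<le> 1 + y\<^sup>2 / 12" by (simp add: power2_eq_square)
  have "1 ^ 4 \<le> (1 + exp (- y)) ^ 4" by (intro power_mono) auto
  then have "(196 / 100) * 1 \<le> (1 + y\<^sup>2 / 12) * (1 + exp (- y)) ^ 4" using 1 by (intro mult_mono) auto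
  then show ?thesis by simp
next
  case True
  \<comment> \<open>A lower bound for the tangent of exp (-y) at 13/5, using exp (13/5) <=
    13.5.\<close>
  define v where "v = (36 / 10 - y) / (135 / 10)"
  have v0: "v \<ge> 0" using True by (simp add: v_def)
  have uv: "v \<le> exp (- y)"
  proof -
    have "exp (13 / 5 :: real) ^ Suc 4 = exp 1 ^ 13" by (simp flip: exp_of_nat_mult)
    also have "\<dots> \<le> (272 / 100) ^ 13" using e_less_272 by (intro power_mono) auto
    also have "\<dots> \<le> (135 / 10) ^ Suc 4" by (simp add: power_divide)
    finally have "exp (13 / 5 :: real) \<le> 135 / 10" by (rule power_le_imp_le_base) simp
    then have "1 / (135 / 10) \<le> 1 / exp (13 / 5 :: real)" by (intro divide_left_mono) auto
    then have "1 / (135 / 10) \<le> exp (- (13 / 5) :: real)" by (simp only: exp_minus inverse_eq_divide)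
    then have "(36 / 10 - y) * (1 / (135 / 10)) \<le> (36 / 10 - y) * exp (- (13 / 5) :: real)"
      using True by (intro mult_left_mono) auto
    also have "\<dots> \<le> exp (13 / 5 - y) * exp (- (13 / 5))"
      using exp_ge_add_one_self[of "13 / 5 - y"] by (intro mult_right_mono) auto
    also have "\<dots> = exp (- y)" by (simp flip: exp_add)
    finally show ?thesis by (simp add: v_def)
  qed
  have "(1 + v) ^ 4 \<le> (1 + exp (- y)) ^ 4" using uv v0 by (intro power_mono) auto
  moreover have "(1 + v) ^ 4 = 1 + 4 * v + 6 * v\<^sup>2 + v\<^sup>2 * (4 * v + v\<^sup>2)"
    by (simp add: power2_eq_square eval_nat_numeral algebra_simps)
  moreover have "0 \<le> v\<^sup>2 * (4 * v + v\<^sup>2)" using v0 by simp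
  ultimately have p4: "1 + 4 * v + 6 * v\<^sup>2 \<le> (1 + exp (- y)) ^ 4" by linarith
  have "196 / 100 \<le> (1 + y\<^sup>2 / 12) * (1 + 4 * v + 6 * v\<^sup>2)"
  proof -
    \<comment> \<open>For y <= 1 the second factor suffices. Otherwise the convex factors are
      replaced by linear minorants: 1 + y^2/12 by its tangent at 2 or 3, the polynomial in v by its
      tangent at 14/100 or by 1 + 4 v. The product of an increasing and a decreasing linear function
      is concave, so its values at the ends of the range decide.\<close>
    consider "y \<le> 1" | "1 \<le> y" "y \<le> 24 / 10" | "24 / 10 \<le> y" by linarith
    then show ?thesis
    proof cases
      case 1
      then have v: "26 / 135 \<le> v" by (simp add: v_def)
      then have "(26 / 135)\<^sup>2 \<le> v\<^sup>2" by (intro power_mono) auto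
      then have "196 / 100 \<le> 1 + 4 * v + 6 * v\<^sup>2" using v by (simp add: power2_eq_square)
      then have "1 * (196 / 100) \<le> (1 + y\<^sup>2 / 12) * (1 + 4 * v + 6 * v\<^sup>2)" by (intro mult_mono) auto
      then show ?thesis by simp
    next
      case 2
      have y2: "2 / 3 + y / 3 \<le> 1 + y\<^sup>2 / 12" using zero_le_power2[of "y - 2"] by (simp add: power2_diff)
      have v2: "8824 / 10000 + 568 / 100 * v \<le> 1 + 4 * v + 6 * v\<^sup>2"
      proof -
        have "0 \<le> 6 * (v - 14 / 100)\<^sup>2" by simp
        also have "\<dots> = 1 + 4 * v + 6 * v\<^sup>2 - (8824 / 10000 + 568 / 100 * v)"
          by (simp add: power2_eq_square field_simps)
        finally show ?thesis by simp
      qed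
      have "0 \<le> (y - 1) * (24 / 10 - y)" using 2 by (intro mult_nonneg_nonneg) auto
      then have "196 / 100 \<le> (2 / 3 + y / 3) * (8824 / 10000 + 568 / 100 * v)"
        using 2 unfolding v_def by (simp add: field_simps)
      also have "\<dots> \<le> (1 + y\<^sup>2 / 12) * (1 + 4 * v + 6 * v\<^sup>2)" using y2 v2 y v0 by (intro mult_mono) auto
      finally show ?thesis .
    next
      case 3
      have y2: "1 / 4 + y / 2 \<le> 1 + y\<^sup>2 / 12" using zero_le_power2[of "y - 3"] by (simp add: power2_diff)
      have "0 \<le> (y - 24 / 10) * (34 / 10 - y)" using 3 True by (intro mult_nonneg_nonneg) auto
      then have "196 / 100 \<le> (1 / 4 + y / 2) * (1 + 4 * v)"
        using 3 True unfolding v_def by (simp add: field_simps)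
      also have "\<dots> \<le> (1 + y\<^sup>2 / 12) * (1 + 4 * v + 6 * v\<^sup>2)" using y2 y v0 by (intro mult_mono) auto
      finally show ?thesis .
    qed
  qed
  also have "\<dots> \<le> (1 + y\<^sup>2 / 12) * (1 + exp (- y)) ^ 4" using p4 by (intro mult_left_mono) auto
  finally show ?thesis .
qed

text \<open>The fourth power removes all roots. With x = 2c, \<open>tanh_lower\<close> absorbs sinh
  x / x and leaves pi^4 / 16 (1 + x^2 / 3)(1 + exp (-2x))^4.\<close>

lemma prefactor_lower:
  assumes c: "c > 0"
  shows "prefactor c > 0" "34 / 10 \<le> (prefactor c)\<^sup>2"
proof -
  define x where "x = 2 * c"
  have x: "x > 0" using c by (simp add: x_def)
  have s4: "sinh (4 * c) = 2 * sinh x * cosh x" using sinh_add[of x x] by (simp add: x_def)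
  have q: "sinh (4 * c) / (4 * c) > 0" using c by simp
  have q2: "1 + 4 * c\<^sup>2 / 3 > 0" by (simp add: add_pos_nonneg)
  show pos: "prefactor c > 0" unfolding prefactor_def using c less_imp_neq[OF q] less_imp_neq[OF q2]
    by (intro mult_pos_pos divide_pos_pos) auto
  have pw: "(b powr (1/2)) ^ 4 = b\<^sup>2" "(b powr (1/4)) ^ 4 = b" if "b > 0" for b :: real
    using that by (simp_all add: powr_power)
  have e: "prefactor c ^ 4 = pi ^ 4 * (1 + x\<^sup>2 / 3)\<^sup>2 * (sinh x / x) * cosh x ^ 3 / exp x ^ 4"
  proof -
    have "prefactor c ^ 4 = pi ^ 4 / exp x ^ 4 * (1 + 4 * c\<^sup>2 / 3)\<^sup>2 * (sinh (4 * c) / (4 * c)) * (cosh x)\<^sup>2"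
      unfolding prefactor_def x_def[symmetric] power_mult_distrib power_divide
      by (simp only: pw(1)[OF q2] pw(1)[OF cosh_real_pos] pw(2)[OF q])
    also have "4 * c\<^sup>2 / 3 = x\<^sup>2 / 3" by (simp add: x_def)
    also have "sinh (4 * c) / (4 * c) = sinh x / x * cosh x" unfolding s4 using c by (simp add: x_def)
    finally show ?thesis by (simp add: power2_eq_square power3_eq_cube mult_ac)
  qed
  have E: "cosh x / exp x = (1 + exp (- (2 * x))) / 2"
  proof -
    have "exp (- (2 * x)) * exp x = exp (- x)" by (simp flip: exp_add)
    then show ?thesis by (simp add: cosh_field_def field_simps)
  qed
  have "cosh x \<le> (1 + x\<^sup>2 / 3) * (sinh x / x)" using tanh_lower[of x] x by (simp add: field_simps)
  then have "(pi ^ 4 * (1 + x\<^sup>2 / 3) * cosh x ^ 3 / exp x ^ 4) * cosh x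
      \<le> (pi ^ 4 * (1 + x\<^sup>2 / 3) * cosh x ^ 3 / exp x ^ 4) * ((1 + x\<^sup>2 / 3) * (sinh x / x))"
    by (intro mult_left_mono) auto
  also have "\<dots> = prefactor c ^ 4" unfolding e by (simp add: power2_eq_square mult_ac)
  finally have "pi ^ 4 * (1 + x\<^sup>2 / 3) * (cosh x / exp x) ^ 4 \<le> prefactor c ^ 4"
    by (simp add: power_divide eval_nat_numeral mult_ac)
  then have 1: "pi ^ 4 / 16 * ((1 + x\<^sup>2 / 3) * (1 + exp (- (2 * x))) ^ 4) \<le> prefactor c ^ 4"
    unfolding E by (simp add: power_divide mult_ac)
  have "(1 + (2 * x)\<^sup>2 / 12) = 1 + x\<^sup>2 / 3" by (simp add: power2_eq_square)
  then have 2: "196 / 100 \<le> (1 + x\<^sup>2 / 3) * (1 + exp (- (2 * x))) ^ 4"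
    using quadratic_exp_lower[of "2 * x"] x by simp
  have "(312 / 100) ^ 4 \<le> pi ^ 4" using pi_bounds by (intro power_mono) auto
  then have "(312 / 100) ^ 4 / 16 * (196 / 100) \<le> pi ^ 4 / 16 * ((1 + x\<^sup>2 / 3) * (1 + exp (- (2 * x))) ^ 4)"
    using 2 by (intro mult_mono) auto
  moreover have "(34 / 10)\<^sup>2 \<le> (312 / 100) ^ 4 / 16 * (196 / 100 :: real)" by (simp add: power_divide)
  ultimately have "(34 / 10)\<^sup>2 \<le> prefactor c ^ 4" using 1 by linarith
  then have "(34 / 10)\<^sup>2 \<le> ((prefactor c)\<^sup>2)\<^sup>2" by (simp flip: power_mult)
  then show "34 / 10 \<le> (prefactor c)\<^sup>2" by (rule power2_le_imp_le) simp
qed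

section \<open>Lower bounds for \<open>U\<close> and \<open>R\<close>\<close>

lemma arcsine_integrable:
  "integrable I11 (\<lambda>x. inverse (sqrt (1 - x\<^sup>2)))" "(LINT x|I11. inverse (sqrt (1 - x\<^sup>2))) = pi"
proof -
  let ?f = "\<lambda>x::real. inverse (sqrt (1 - x\<^sup>2))"
  have "(?f has_integral (arcsin 1 - arcsin (-1))) {-1..1}"
  proof (rule fundamental_theorem_of_calculus_interior)
    show "(arcsin has_vector_derivative ?f x) (at x)" if "x \<in> {-1<..<1}" for x
      using DERIV_arcsin[of x] that by (simp add: has_real_derivative_iff_has_vector_derivative)
  qed (auto intro: continuous_on_arcsin' continuous_intros)
  then have h: "(?f has_integral pi) {-1<..<1}"
    by (simp add: has_integral_Icc_iff_Ioo)
  have "?f absolutely_integrable_on {-1<..<1}"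
    using h by (intro nonnegative_absolutely_integrable_1) (auto simp: integrable_on_def abs_square_le_1 abs_le_iff)
  then show i: "integrable I11 ?f" by (intro absolutely_integrable_imp_integrable) auto
  show "(LINT x|I11. ?f x) = pi"
    using lebesgue_integral_eq_integral[OF i] h by (simp add: integral_unique)
qed

text \<open>The chord of the convex cosh on [0, k]. It yields an integrable majorant for the
  integrand of \<open>U\<close>.\<close>

lemma (in sl_coefficient) pk_lower_coarse:
  assumes x: "x \<in> {-1..1}"
  shows "(A - 1) / 2 * (1 - x\<^sup>2) \<le> pk k x"
proof -
  have "convex_on UNIV (cosh :: real \<Rightarrow> real)"
    by (rule f''_ge0_imp_convex[where f' = sinh and f'' = cosh]) (auto intro!: derivative_eq_intros)
  from convex_onD[OF this, of "\<bar>x\<bar>" 0 k] x have "cosh (k * \<bar>x\<bar>) \<le> (1 - \<bar>x\<bar>) + \<bar>x\<bar> * cosh k"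
    by (simp add: mult.commute abs_le_iff)
  moreover have "cosh (k * \<bar>x\<bar>) = cosh (k * x)" by (cases "x \<ge> 0") auto
  ultimately have "(A - 1) * (1 - \<bar>x\<bar>) \<le> pk k x" by (simp add: pk_def A_def algebra_simps)
  moreover have "(A - 1) * ((1 - x\<^sup>2) / 2) \<le> (A - 1) * (1 - \<bar>x\<bar>)"
    using A_ge_1 zero_le_power2[of "1 - \<bar>x\<bar>"] by (intro mult_left_mono) (auto simp: power2_diff)
  ultimately show ?thesis by simp
qed

text \<open>The integrand is p^(-1/2) with k = 4c, so the coefficient estimates apply with this
  other value of k and the parabola above p gives an arcsine integral.\<close>

lemma U_lower:
  assumes c: "c > 0"
  shows "pi * sqrt (2 / (4 * c * sinh (4 * c))) \<le> U c"
proof -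
  interpret sl_coefficient "4 * c" by unfold_locales (use c in simp)
  let ?k = "4 * c"
  let ?s = "\<lambda>x::real. inverse (sqrt (1 - x\<^sup>2))"
  define f where "f x = (cosh ?k - cosh (?k * x)) powr (-1/2)" for x
  have fx: "f x = 1 / sqrt (pk ?k x)" if "x \<in> {-1<..<1}" for x
    using pk_pos[OF that] by (simp add: f_def pk_def powr_minus_divide powr_half_sqrt)
  have "continuous_on {-1<..<1} (\<lambda>x. 1 / sqrt (pk ?k x))"
    using pk_pos by (intro continuous_intros) force
  then have "continuous_on {-1<..<1} f" by (rule continuous_on_eq) (simp add: fx)
  then have fm: "f \<in> borel_measurable I11" by (intro continuous_imp_measurable_on_sets_lebesgue) auto
  define M where "M = sqrt (2 / (A - 1))"
  have A1: "A > 1" using pk_pos[of 0] by (simp add: pk_def A_def)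
  have up: "1 / sqrt (pk ?k x) \<le> M * ?s x" if x: "x \<in> {-1<..<1}" for x
  proof -
    have t: "0 < 1 - x\<^sup>2" using x by (simp add: power2_less_1_iff abs_less_iff)
    have "sqrt ((A - 1) / 2 * (1 - x\<^sup>2)) \<le> sqrt (pk ?k x)"
      using pk_lower_coarse[of x] x by (intro real_sqrt_le_mono) auto
    then have "1 / sqrt (pk ?k x) \<le> 1 / sqrt ((A - 1) / 2 * (1 - x\<^sup>2))"
      using A1 t pk_pos[OF x] by (intro divide_left_mono) auto
    also have "\<dots> = inverse (sqrt ((A - 1) / 2)) * ?s x" by (simp only: real_sqrt_mult divide_inverse inverse_mult_distrib mult_1_left)
    also have "inverse (sqrt ((A - 1) / 2)) = M" unfolding M_def by (simp only: real_sqrt_inverse[symmetric] inverse_divide)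
    finally show ?thesis .
  qed
  have sp: "space I11 = {-1<..<1}" by simp
  \<comment> \<open>Indispensable for a lower bound, since the integral of a nonintegrable function
    is 0 by default.\<close>
  have fi: "integrable I11 f"
  proof (rule Bochner_Integration.integrable_bound[OF _ fm])
    show "integrable I11 (\<lambda>x. M * ?s x)" by (intro integrable_mult_right arcsine_integrable)
    show "AE x in I11. norm (f x) \<le> norm (M * ?s x)"
    proof (rule AE_I2)
      fix x assume "x \<in> space I11"
      then have x: "x \<in> {-1<..<1}" by (simp add: sp)
      have "0 \<le> f x" by (simp add: f_def)
      then show "norm (f x) \<le> norm (M * ?s x)" using up[OF x] fx[OF x] by simp
    qed
  qed
  have "sqrt (2 / kap) * pi = (LINT x|I11. sqrt (2 / kap) * ?s x)"
    by (simp only: integral_mult_right_zero arcsine_integrable(2))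
  also have "\<dots> \<le> (LINT x|I11. f x)"
  proof (rule integral_mono[OF _ fi])
    show "integrable I11 (\<lambda>x. sqrt (2 / kap) * ?s x)" by (intro integrable_mult_right arcsine_integrable)
    fix x assume "x \<in> space I11"
    then have x: "x \<in> {-1<..<1}" by (simp add: sp)
    show "sqrt (2 / kap) * ?s x \<le> f x"
      using inverse_sqrt_pk_ge[OF x] unfolding fx[OF x] sqrt_2_kap
      by (simp only: divide_inverse inverse_mult_distrib mult_1_left)
  qed
  also have "\<dots> = U c" by (simp add: U_def f_def mult.assoc)
  finally show ?thesis unfolding kap_def by (simp only: mult.commute[of pi])
qed

text \<open>With s = sinh (4c), coth >= 1 and cosh (4c) >= max s 1 bound the bracket below by (1/3 +
  2) c s, while \<open>U_lower\<close> gives the factor c / (2 s). The product is 7/6 c^2.\<close>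

lemma R_lower:
  assumes c: "c > 0"
  shows "2 / pi\<^sup>2 + 7 / 6 * c\<^sup>2 \<le> R c"
proof -
  define s where "s = sinh (4 * c)"
  have s: "s > 0" using c by (simp add: s_def)
  have ct: "1 \<le> coth (2 * c)" using c sinh_less_cosh_real[of "2 * c"] by (simp add: coth_def)
  have sc: "s \<le> cosh (4 * c)" using sinh_less_cosh_real[of "4 * c"] by (simp add: s_def)
  have "c / 3 * s * 1 \<le> c / 3 * cosh (4 * c) * coth (2 * c)"
    using sc ct c s by (intro mult_mono) auto
  then have X: "7 / 3 * c * s \<le> (cosh (4 * c) * (1 + c / 3 * coth (2 * c)) - 1) + 2 * c * s"
    using cosh_real_ge_1[of "4 * c"] by (simp add: algebra_simps)
  have "(pi * sqrt (2 / (4 * c * s)))\<^sup>2 \<le> (U c)\<^sup>2"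
    using U_lower[OF c] c s by (intro power_mono) (auto simp: s_def)
  then have "pi\<^sup>2 / (2 * c * s) \<le> (U c)\<^sup>2" using c s by (simp add: power_mult_distrib)
  then have "(c / pi)\<^sup>2 * (pi\<^sup>2 / (2 * c * s)) \<le> (c / pi)\<^sup>2 * (U c)\<^sup>2" by (intro mult_left_mono) auto
  then have V: "c / (2 * s) \<le> (U c * c / pi)\<^sup>2" using c s by (simp add: power_divide power_mult_distrib power2_eq_square field_simps)
  have "c / (2 * s) * (7 / 3 * c * s) \<le> (U c * c / pi)\<^sup>2 * ((cosh (4 * c) * (1 + c / 3 * coth (2 * c)) - 1) + 2 * c * s)"
    using V X c s by (intro mult_mono) auto
  moreover have "c / (2 * s) * (7 / 3 * c * s) = 7 / 6 * c\<^sup>2" using s by (simp add: power2_eq_square)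
  ultimately show ?thesis unfolding R_def s_def by linarith
qed

section \<open>Comparison with the claimed bound\<close>

definition "bound_factor c M = 2 * R c / M + (1 + sqrt (2/3) * (R c / M)) * sqrt M"

lemma bound_factor_square:
  assumes "c > 0" "M > 0"
  shows "0 \<le> bound_factor c M"
    "M + 1632 / 1000 * R c + 4 * R c / sqrt M \<le> (bound_factor c M)\<^sup>2"
proof -
  have R0: "R c \<ge> 0"
  proof -
    have "0 \<le> 2 / pi\<^sup>2 + 7 / 6 * c\<^sup>2" by simp
    then show ?thesis using R_lower[OF assms(1)] by linarith
  qed
  define s where "s = sqrt M"
  have s: "s > 0" "M = s\<^sup>2" using assms(2) by (simp_all add: s_def)
  have a: "816 / 1000 \<le> sqrt (2/3)" by (rule real_le_rsqrt) (simp add: power2_eq_square)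
  define X where "X = 2 * R c / s\<^sup>2 + sqrt (2/3) * (R c / s)"
  have bf: "bound_factor c M = s + X"
    unfolding bound_factor_def s_def[symmetric] X_def using s(1)
    by (simp add: s(2) field_simps power2_eq_square)
  have X0: "0 \<le> X" unfolding X_def using R0 s(1) by simp
  show "0 \<le> bound_factor c M" using s(1) X0 by (simp add: bf)
  have "816 / 1000 * (R c / s) \<le> sqrt (2/3) * (R c / s)" using a R0 s(1) by (intro mult_right_mono) auto
  then have "2 * s * (2 * R c / s\<^sup>2 + 816 / 1000 * (R c / s)) \<le> 2 * s * X"
    unfolding X_def using s(1) by (intro mult_left_mono) auto
  moreover have "2 * s * (2 * R c / s\<^sup>2 + 816 / 1000 * (R c / s)) = 4 * R c / s + 1632 / 1000 * R c"
    using s(1) by (simp add: field_simps power2_eq_square)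
  moreover have "(s + X)\<^sup>2 = s\<^sup>2 + 2 * s * X + X\<^sup>2" by (simp add: power2_sum)
  moreover have "0 \<le> X\<^sup>2" by simp
  ultimately have "s\<^sup>2 + 1632 / 1000 * R c + 4 * R c / s \<le> (s + X)\<^sup>2" by linarith
  then show "M + 1632 / 1000 * R c + 4 * R c / sqrt M \<le> (bound_factor c M)\<^sup>2"
    unfolding bf s_def[symmetric] using s(2) by linarith
qed

lemma R_ge_numeric: "c > 0 \<Longrightarrow> 2015 / 10000 + 7 / 6 * c\<^sup>2 \<le> R c"
proof -
  assume c: "c > 0"
  have "pi\<^sup>2 \<le> (315 / 100)\<^sup>2" using pi_bounds by (intro power_mono) auto
  then have "2015 / 10000 * pi\<^sup>2 \<le> 2" by (simp add: power2_eq_square)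
  then have "2015 / 10000 \<le> 2 / pi\<^sup>2" by (simp add: le_divide_eq)
  then show ?thesis using R_lower[OF c] by linarith
qed

lemma high_energy_bound:
  assumes c: "c > 0"
  shows "314 / 100 * (real m + 1) \<le> (prefactor c * bound_factor c (real m + 1/2))\<^sup>2"
proof -
  define M where "M = real m + 1/2"
  define s where "s = sqrt M"
  have M: "M \<ge> 1/2" by (simp add: M_def)
  have s: "s > 0" "M = s\<^sup>2" using M by (simp_all add: s_def)
  have R2: "2015 / 10000 \<le> R c" using R_ge_numeric[OF c] zero_le_power2[of c] by linarith
  have "4 * (2015 / 10000) / s \<le> 4 * R c / s" using R2 s(1) by (intro divide_right_mono) auto
  then have b: "M + 328 / 1000 + 806 / 1000 / s \<le> (bound_factor c M)\<^sup>2"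
    using bound_factor_square(2)[OF c, of M] R2 M unfolding s_def[symmetric] by simp
  have "314 / 100 * (M + 1/2) \<le> 34 / 10 * (M + 328 / 1000 + 806 / 1000 / s)"
  \<comment> \<open>For small M the term in 1 / sqrt M covers the deficit. From M = 25 on, the
    larger slope 3.4 > 3.14 does.\<close>
  proof (cases "s \<le> 5")
    case True
    then have "806 / 1000 / 5 \<le> 806 / 1000 / s" using s(1) by (intro divide_left_mono) auto
    then show ?thesis using M by simp
  next
    case False
    then have "5\<^sup>2 \<le> s\<^sup>2" by (intro power_mono) auto
    then have "25 \<le> M" by (simp add: s(2))
    moreover have "0 \<le> 806 / 1000 / s" using s(1) by simp
    ultimately show ?thesis unfolding distrib_left by linarith
  qed
  also have "\<dots> \<le> (prefactor c)\<^sup>2 * (bound_factor c M)\<^sup>2"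
    using prefactor_lower(2)[OF c] b M s(1) by (intro mult_mono) (auto intro: add_nonneg_nonneg)
  finally show ?thesis by (simp add: M_def power_mult_distrib)
qed

text \<open>The arithmetic-geometric mean inequality for s^2, t^3 / s, t^3 / s. It removes M from M
  + 4 R / sqrt M, as a comparison with an estimate independent of m requires.\<close>

lemma cubic_AMGM:
  fixes s t :: real
  assumes "s > 0" "t \<ge> 0"
  shows "3 * t\<^sup>2 \<le> s\<^sup>2 + 2 * t ^ 3 / s"
proof -
  have "0 \<le> (s - t)\<^sup>2 * (s + 2 * t)" using assms by simp
  also have "\<dots> = s * (s\<^sup>2 + 2 * t ^ 3 / s - 3 * t\<^sup>2)"
    using assms by (simp add: field_simps power2_eq_square power3_eq_cube)
  finally show ?thesis using assms(1) by (simp add: zero_le_mult_iff)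
qed

lemma low_energy_bound:
  assumes c: "c > 0" and M: "M > 0"
  shows "81 / 100 + 298 / 100 * sqrt (1 + (2 * pi * c)\<^sup>2) \<le> (prefactor c * bound_factor c M)\<^sup>2"
proof -
  define s where "s = sqrt M"
  have s: "s > 0" "M = s\<^sup>2" using M by (simp_all add: s_def)
  have R2: "2015 / 10000 + 7 / 6 * c\<^sup>2 \<le> R c" by (rule R_ge_numeric[OF c])
  have key: "34 / 10 * (3 * t\<^sup>2 + 1632 / 1000 * (2015 / 10000 + 7 / 6 * c\<^sup>2)) \<le> (prefactor c * bound_factor c M)\<^sup>2"
    if t: "t \<ge> 0" "t ^ 3 \<le> 2 * (2015 / 10000 + 7 / 6 * c\<^sup>2)" for t
  proof -
    have "2 * t ^ 3 / s \<le> 4 * R c / s" using t(2) R2 s(1) by (intro divide_right_mono) auto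
    then have "3 * t\<^sup>2 + 1632 / 1000 * (2015 / 10000 + 7 / 6 * c\<^sup>2) \<le> (bound_factor c M)\<^sup>2"
      using cubic_AMGM[OF s(1) t(1)] bound_factor_square(2)[OF c M, folded s_def] R2 s(2)
      unfolding distrib_left by linarith
    then have "34 / 10 * (3 * t\<^sup>2 + 1632 / 1000 * (2015 / 10000 + 7 / 6 * c\<^sup>2)) \<le> (prefactor c)\<^sup>2 * (bound_factor c M)\<^sup>2"
      using prefactor_lower(2)[OF c] by (intro mult_mono) auto
    then show ?thesis by (simp add: power_mult_distrib)
  qed
  have p2: "2 * pi * c \<le> 63 / 10 * c" using pi_bounds c by simp
  show ?thesis
  proof (cases "c \<le> 1")
    case True
    \<comment> \<open>A linear substitute for the cube root of 2 (0.2015 + 7/6 c^2), so that the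
      comparison becomes polynomial in c.\<close>
    define t where "t = 6 / 10 + 6 / 10 * c"
    have c3: "c ^ 3 \<le> c\<^sup>2" using c True by (simp add: power3_eq_cube power2_eq_square)
    have t3: "t ^ 3 = 27 / 125 + 81 / 125 * c + 81 / 125 * c\<^sup>2 + 27 / 125 * c ^ 3"
      unfolding t_def by (simp add: power3_eq_cube power2_eq_square algebra_simps)
    have tt: "t\<^sup>2 = 36 / 100 + 72 / 100 * c + 36 / 100 * c\<^sup>2"
      unfolding t_def by (simp add: power2_eq_square algebra_simps)
    have "0 \<le> (c - 22 / 100)\<^sup>2" by simp
    also have "\<dots> = c\<^sup>2 - 44 / 100 * c + 484 / 10000" by (simp add: power2_eq_square algebra_simps)
    finally have "t ^ 3 \<le> 2 * (2015 / 10000 + 7 / 6 * c\<^sup>2)"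
      unfolding t3 distrib_left using c3 c True by linarith
    then have k1: "34 / 10 * (3 * t\<^sup>2 + 1632 / 1000 * (2015 / 10000 + 7 / 6 * c\<^sup>2)) \<le> (prefactor c * bound_factor c M)\<^sup>2"
      using c by (intro key) (auto simp: t_def)
    have t2: "34 / 10 * (3 * t\<^sup>2 + 1632 / 1000 * (2015 / 10000 + 7 / 6 * c\<^sup>2)) \<ge> 479 / 100 + 734 / 100 * c + 1014 / 100 * c\<^sup>2"
      using c zero_le_power2[of c] unfolding tt distrib_left by linarith
    define V where "V = 398 / 100 + 734 / 100 * c + 1014 / 100 * c\<^sup>2"
    have "298 / 100 * sqrt (1 + (2 * pi * c)\<^sup>2) \<le> V"
    proof (rule power2_le_imp_le)
      have "(2 * pi * c)\<^sup>2 \<le> (63 / 10 * c)\<^sup>2" using p2 c by (intro power_mono) auto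
      moreover have "(sqrt (1 + (2 * pi * c)\<^sup>2))\<^sup>2 = 1 + (2 * pi * c)\<^sup>2" by (rule real_sqrt_pow2) simp
      ultimately have "(298 / 100 * sqrt (1 + (2 * pi * c)\<^sup>2))\<^sup>2 \<le> (298 / 100)\<^sup>2 * (1 + (63 / 10 * c)\<^sup>2)"
        unfolding power_mult_distrib[of "298 / 100"] by (intro mult_left_mono) simp_all
      also have "\<dots> = 88804 / 10000 * (1 + 3969 / 100 * c\<^sup>2)" by (simp add: power2_eq_square)
      also have "\<dots> \<le> V\<^sup>2"
      proof -
        have 1: "c ^ 3 \<ge> c\<^sup>2 - c / 4"
        proof -
          have "0 \<le> c * (c - 1/2)\<^sup>2" using c by simp
          then show ?thesis by (simp add: power2_eq_square power3_eq_cube algebra_simps)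
        qed
        have 2: "c ^ 4 \<ge> c\<^sup>2 / 2 - 1 / 16"
        proof -
          have "0 \<le> (c\<^sup>2 - 1/4)\<^sup>2" by simp
          then show ?thesis by (simp add: power2_eq_square eval_nat_numeral algebra_simps)
        qed
        have 3: "0 \<le> c * (1 - c)" using c True by simp
        have "V\<^sup>2 = 158404 / 10000 + 584264 / 10000 * c + 1345900 / 10000 * c\<^sup>2 + 1488552 / 10000 * c ^ 3 + 1028196 / 10000 * c ^ 4"
          unfolding V_def by (simp add: power2_eq_square eval_nat_numeral algebra_simps)
        moreover have "0 \<le> c - c\<^sup>2" using 3 by (simp add: power2_eq_square algebra_simps)
        ultimately show ?thesis using 1 2 c zero_le_power2[of c] unfolding distrib_left by linarith
      qed
      finally show "(298 / 100 * sqrt (1 + (2 * pi * c)\<^sup>2))\<^sup>2 \<le> V\<^sup>2" .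
      show "0 \<le> V" using c by (simp add: V_def)
    qed
    then show ?thesis using k1 t2 unfolding V_def by linarith
  next
    case False
    then have c1: "c > 1" by simp
    then have "1\<^sup>2 \<le> c\<^sup>2" by (intro power_mono) auto
    \<comment> \<open>For c > 1 the constant t = 13/10 is admissible, and the quadratic term in c
      does the rest.\<close>
    then have k1: "34 / 10 * (3 * (13 / 10)\<^sup>2 + 1632 / 1000 * (2015 / 10000 + 7 / 6 * c\<^sup>2)) \<le> (prefactor c * bound_factor c M)\<^sup>2"
      by (intro key) (simp_all add: power3_eq_cube)
    have "sqrt (1 + (2 * pi * c)\<^sup>2) \<le> 1 + 2 * pi * c"
      using c by (intro real_le_lsqrt) (auto simp: power2_eq_square algebra_simps)
    then have "81 / 100 + 298 / 100 * sqrt (1 + (2 * pi * c)\<^sup>2) \<le> 379 / 100 + 1878 / 100 * c"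
      using p2 c by linarith
    also have "\<dots> \<le> 34 / 10 * (3 * (13 / 10)\<^sup>2 + 1632 / 1000 * (2015 / 10000 + 7 / 6 * c\<^sup>2))"
    proof -
      have "0 \<le> (c - 146 / 100)\<^sup>2" by simp
      also have "\<dots> = c\<^sup>2 - 292 / 100 * c + 21316 / 10000" by (simp add: power2_eq_square algebra_simps)
      moreover have "(13 / 10 :: real)\<^sup>2 = 169 / 100" by (simp add: power2_eq_square)
      ultimately show ?thesis using c unfolding distrib_left by linarith
    qed
    finally show ?thesis using k1 by linarith
  qed
qed

section \<open>The bound for the eigenfunctions of the operator\<close>

lemma LINT_I11:
  fixes f :: "real \<Rightarrow> real"
  assumes "continuous_on {-1..1} f"
  shows "integrable I11 f" "(LINT x|I11. f x) = integral {-1..1} f"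
proof -
  have "f absolutely_integrable_on {-1..1}" by (rule absolutely_integrable_continuous_real[OF assms])
  then have "f absolutely_integrable_on {-1<..<1}"
    by (rule set_integrable_subset) auto
  then show i: "integrable I11 f" by (intro absolutely_integrable_imp_integrable) auto
  show "(LINT x|I11. f x) = integral {-1..1} f"
    using lebesgue_integral_eq_integral[OF i] by (simp add: integral_open_interval_real)
qed

lemma AE_I11_zero:
  fixes f :: "real \<Rightarrow> real"
  assumes f: "continuous_on {-1..1} f" and ae: "AE x in I11. f x = 0" and x: "x \<in> {-1..1}"
  shows "f x = 0"
proof -
  have c: "continuous_on {-1..1} (\<lambda>x. \<bar>f x\<bar>)" by (intro continuous_intros f)
  have "(LINT x|I11. \<bar>f x\<bar>) = 0"
    using ae by (intro integral_eq_zero_AE) auto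
  then have "integral {-1..1} (\<lambda>x. \<bar>f x\<bar>) = 0" using LINT_I11(2)[OF c] by simp
  then have "\<forall>x\<in>{-1..1}. \<bar>f x\<bar> = 0" using integral_eq_0_iff[OF c] by simp
  then show ?thesis using x by simp
qed

lemma Qop_of_real:
  assumes "continuous_on {-1..1} f"
  shows "Qop c (\<lambda>x. complex_of_real (f x)) x = complex_of_real (pi * c * sech_conv (pi * c / 2) f x)"
proof -
  let ?h = "\<lambda>y. pi * c * (f y * sech (pi * c / 2 * (x - y)))"
  have h: "continuous_on {-1..1} ?h" by (intro continuous_intros assms)
  have "Qop c (\<lambda>x. complex_of_real (f x)) x = (LINT y|I11. complex_of_real (?h y))"
    unfolding Qop_def by (simp add: mult_ac)
  also have "\<dots> = complex_of_real (integral {-1..1} ?h)"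
    by (simp only: integral_complex_of_real LINT_I11(2)[OF h])
  finally show ?thesis by (simp only: integral_mult_right sech_conv_def)
qed

text \<open>Both sides of the eigenvalue equation are continuous, so equality almost everywhere is
  equality at every point of the closed interval.\<close>

lemma eigenspace_of_real:
  assumes c: "c > 0" and f: "continuous_on {-1..1} f"
  shows "(\<lambda>x. complex_of_real (f x)) \<in> eigenspace c l \<longleftrightarrow>
    (\<forall>x\<in>{-1..1}. pi * c * sech_conv (pi * c / 2) f x = l * f x)"
proof -
  let ?d = "\<lambda>x. pi * c * sech_conv (pi * c / 2) f x - l * f x"
  have d: "continuous_on {-1..1} ?d" by (intro continuous_intros f continuous_on_sech_conv)
  have "(\<lambda>x. complex_of_real (f x)) \<in> L2"
  proof -
    have "f \<in> borel_measurable I11"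
      using LINT_I11(1)[OF f] by (rule borel_measurable_integrable)
    moreover have "integrable I11 (\<lambda>x. (f x)\<^sup>2)" by (intro LINT_I11 continuous_intros f)
    ultimately show ?thesis by (simp add: L2_def)
  qed
  then have "(\<lambda>x. complex_of_real (f x)) \<in> eigenspace c l \<longleftrightarrow> (AE x in I11. ?d x = 0)"
    by (simp add: eigenspace_def Qop_of_real[OF f] flip: of_real_mult)
  also have "\<dots> \<longleftrightarrow> (\<forall>x\<in>{-1..1}. ?d x = 0)"
  proof
    assume "AE x in I11. ?d x = 0"
    then show "\<forall>x\<in>{-1..1}. ?d x = 0" using AE_I11_zero[OF d] by blast
  next
    assume a: "\<forall>x\<in>{-1..1}. ?d x = 0"
    show "AE x in I11. ?d x = 0" by (rule AE_I2) (use a in auto)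
  qed
  finally show ?thesis by simp
qed

theorem theorem13:
  fixes c :: real and \<rho> :: "nat \<Rightarrow> real" and g :: "nat \<Rightarrow> real \<Rightarrow> real" and m :: nat
  assumes "c > 0"
    and "positive_eigenvalue_sequence c \<rho>"
    and "orthonormal_eigenfunctions c \<rho> g"
  shows "sup_norm (g m) \<le>
    pi / exp (2 * c) * (1 + 4 * c\<^sup>2 / 3) powr (1/2) * (sinh (4 * c) / (4 * c)) powr (1/4)
      * cosh (2 * c) powr (1/2)
      * (2 * R c / (real m + 1/2)
         + (1 + sqrt (2/3) * (R c / (real m + 1/2))) * sqrt (real m + 1/2))"
proof -
  define a where "a = pi * c / 2"
  have a: "a > 0" using assms(1) by (simp add: a_def)
  have pc: "pi * c > 0" using assms(1) by simp
  have dec: "decseq \<rho>" and rpos: "\<And>i. \<rho> i > 0"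
    and mult: "\<And>l. l > 0 \<Longrightarrow> finite {i. \<rho> i = l} \<and> has_multiplicity c l (card {i. \<rho> i = l})"
    using assms(2) by (auto simp: positive_eigenvalue_sequence_def)
  have gc: "continuous_on {-1..1} (g i)" for i
    using assms(3) by (simp add: orthonormal_eigenfunctions_def)
  define lam where "lam i = \<rho> i / (pi * c)" for i
  have eig: "eigenfun a (lam i) (g i)" for i
  proof -
    have "(\<lambda>x. complex_of_real (g i x)) \<in> eigenspace c (\<rho> i)"
      using assms(3) by (simp add: orthonormal_eigenfunctions_def)
    then have *: "\<forall>x\<in>{-1..1}. pi * c * sech_conv a (g i) x = \<rho> i * g i x"
      unfolding eigenspace_of_real[OF assms(1) gc] a_def .
    have "sech_conv a (g i) x = lam i * g i x" if "x \<in> {-1..1}" for x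
    proof -
      have "lam i * g i x = (pi * c * sech_conv a (g i) x) / (pi * c)"
        unfolding bspec[OF * that] by (simp add: lam_def)
      then show ?thesis using assms(1) by simp
    qed
    moreover have "lam i \<noteq> 0" using rpos[of i] assms(1) by (simp add: lam_def)
    ultimately show ?thesis using gc by (simp add: eigenfun_def)
  qed
  have orth: "ip (g i) (g j) = (if i = j then 1 else 0)" for i j
  proof -
    have "continuous_on {-1..1} (\<lambda>x. g i x * g j x)" by (intro continuous_on_mult gc)
    from LINT_I11(2)[OF this] show ?thesis
      using assms(3) by (simp add: orthonormal_eigenfunctions_def ip_def)
  qed
  \<comment> \<open>By simplicity N differs from \<open>lam i\<close> for all i <= m, since p is
    orthogonal to \<open>g i\<close>. Completeness of the sequence makes N some
    \<open>lam j\<close>, so j > m, and monotonicity together with \<open>N \<noteq> lam m\<close>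
    gives the strict inequality.\<close>
  have top: "N < lam m" if p: "eigenfun a N p" "x \<in> {-1..1}" "p x \<noteq> 0" and o: "\<And>i. i \<le> m \<Longrightarrow> ip p (g i) = 0" for N p x
  proof -
    have N: "N > 0" using eigenfun_nodal[OF a p] by metis
    have pcont: "continuous_on {-1..1} p" using p(1) by (simp add: eigenfun_def)
    have ne: "N \<noteq> lam i" if i: "i \<le> m" for i
    proof
      assume "N = lam i"
      then have "eigenfun a N (g i)" using eig[of i] by simp
      note s = conjunct2[OF eigenfun_simple[OF a p(1) this p(2,3)]]
      define t where "t = g i 1 / p 1"
      have gt: "g i x = t * p x + 0 * p x" if "x \<in> {-1..1}" for x
        using bspec[OF s that] by (simp add: t_def)
      have pC: "p \<in> C11" using pcont by simp
      have "ip (g i) p = ip (\<lambda>x. t * p x + 0 * p x) p" by (rule ip_cong[OF gt])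
      also have "\<dots> = t * ip p p" using ip_lincomb[OF pC pC pC, of t 0] by simp
      finally have "t * ip p p = 0" using o[OF i] by (simp add: ip_commute)
      moreover have "ip p p \<noteq> 0" using ip_eq_0[OF pC _ p(2)] p(3) by blast
      ultimately have "t = 0" by simp
      have "ip (g i) (g i) = ip (\<lambda>x. 0) (g i)"
        by (rule ip_cong) (use gt \<open>t = 0\<close> in simp)
      then show False using orth[of i i] by (simp add: ip_def)
    qed
    define l where "l = pi * c * N"
    have l: "l > 0" using pc N by (simp add: l_def)
    have "{i. \<rho> i = l} \<noteq> {}"
    proof
      assume e: "{i. \<rho> i = l} = {}"
      \<comment> \<open>If l were absent from the sequence, its multiplicity would be 0 and every
        element of the eigenspace a null function.\<close>
      have "has_multiplicity c l 0" using mult[OF l] unfolding e by simp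
      then have *: "\<And>h. h \<in> eigenspace c l \<Longrightarrow> AE x in I11. h x = 0" by (auto simp: has_multiplicity_def)
      have "(\<lambda>x. complex_of_real (p x)) \<in> eigenspace c l"
        unfolding eigenspace_of_real[OF assms(1) pcont] using p(1)
        by (simp add: eigenfun_def l_def a_def)
      from *[OF this] have "AE x in I11. p x = 0" by simp
      then show False using AE_I11_zero[OF pcont _ p(2)] p(3) by blast
    qed
    then obtain j where j: "\<rho> j = l" by blast
    then have Nj: "N = lam j" using assms(1) by (simp add: lam_def l_def)
    then have "m \<le> j" using ne[of j] by (meson linear)
    then have "\<rho> j \<le> \<rho> m" using dec by (simp add: decseq_def)
    then have "lam j \<le> lam m" using pc unfolding lam_def by (intro divide_right_mono) auto
    then show ?thesis using ne[of m] Nj by simp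
  qed
  have zeros: "finite {x\<in>{-1<..<1}. g m x = 0} \<and> card {x\<in>{-1<..<1}. g m x = 0} \<le> m"
  proof (rule card_zeros_le[OF a])
    show "eigenfun a (lam i) (g i)" if "i \<le> m" for i by (rule eig)
    show "ip (g i) (g j) = (if i = j then 1 else 0)" if "i \<le> m" "j \<le> m" for i j by (rule orth)
    show "N < lam m" if "eigenfun a N p" "x \<in> {-1..1}" "p x \<noteq> 0" "\<And>i. i \<le> m \<Longrightarrow> ip p (g i) = 0" for N p x
      by (rule top[OF that])
  qed
  have "\<exists>x\<in>{-1..1}. g m x \<noteq> 0"
  proof (rule ccontr)
    assume "\<not> ?thesis"
    then have "ip (g m) (g m) = ip (\<lambda>x. 0) (g m)" by (intro ip_cong) simp
    then show False using orth[of m m] by (simp add: ip_def)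
  qed
  then obtain x0 where x0: "x0 \<in> {-1..1}" "g m x0 \<noteq> 0" by blast
  obtain chi G G1 G2 where G: "\<And>x. (G has_real_derivative G1 x) (at x)" "\<And>x. (G1 has_real_derivative G2 x) (at x)"
    "\<And>x. x \<in> {-1..1} \<Longrightarrow> G x = g m x"
    "\<And>x. x \<in> {-1..1} \<Longrightarrow> pk (4 * a) x * G2 x = 4 * a * sinh (4 * a * x) * G1 x + (qk (4 * a) x - chi) * G x"
    by (rule eigenfun_ode[OF a eig x0]) (rule that; assumption)
  interpret sl_eigenfunction "4 * a" chi G G1 G2
  proof
    have "integral {-1..1} (\<lambda>x. (G x)\<^sup>2) = ip (g m) (g m)"
      unfolding ip_def by (intro integral_cong) (simp add: G(3) power2_eq_square)
    then show "integral {-1..1} (\<lambda>x. (G x)\<^sup>2) = 1" by (simp add: orth)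
    show "(G (- x))\<^sup>2 = (G x)\<^sup>2" if "x \<in> {-1..1}" for x
      using eigenfun_parity[OF a eig x0 that] G(3)[OF that] G(3)[of "- x"] that by simp
  qed (use a G in auto)
  let ?B = "prefactor c * bound_factor c (real m + 1/2)"
  have GZ: "{x\<in>{-1<..<1}. G x = 0} = {x\<in>{-1<..<1}. g m x = 0}"
    using G(3) by auto
  have B0: "0 \<le> ?B"
    using prefactor_lower(1)[OF assms(1)] bound_factor_square(1)[OF assms(1), of "real m + 1/2"] by simp
  have "\<bar>g m x\<bar> \<le> ?B" if x: "x \<in> {-1..1}" for x
  proof -
    have "(G x)\<^sup>2 \<le> ?B\<^sup>2"
    proof (cases "3 / 4 * (4 * a)\<^sup>2 * A \<le> chi")
      case True
      have "(G x)\<^sup>2 \<le> 314 / 100 * (real m + 1)"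
        by (rule sup_high_energy[OF True _ _ x]) (use zeros GZ in auto)
      then show ?thesis using high_energy_bound[OF assms(1), of m] by linarith
    next
      case False
      then have "(G x)\<^sup>2 \<le> 81 / 100 + 298 / 100 * sqrt (1 + (4 * a)\<^sup>2)"
        by (intro sup_low_energy x) simp
      moreover have "4 * a = 2 * pi * c" by (simp add: a_def)
      ultimately show ?thesis using low_energy_bound[OF assms(1), of "real m + 1/2"] by simp
    qed
    then have "(g m x)\<^sup>2 \<le> ?B\<^sup>2" by (simp add: G(3)[OF x])
    then have "\<bar>g m x\<bar>\<^sup>2 \<le> ?B\<^sup>2" by simp
    then show ?thesis using B0 by (rule power2_le_imp_le)
  qed
  then have "sup_norm (g m) \<le> ?B"
    unfolding sup_norm_def by (intro cSUP_least) auto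
  then show ?thesis by (simp only: prefactor_def bound_factor_def)
qed

end
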